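(* Let $\widehat{\mathfrak g}$ be an affine Kac-Moody Lie algebra of type $(ADE)^{(1)}$ with Cartan matrix $(a_{ij})_{i,j=0}^n$, let $L$ be a restricted $U_q(\widehat{\mathfrak g})$-module, let $\mathsf q=q^2$ and $$\mathcal S=\{x_i^+(z)\otimes1\,:\,i=1,\dots,n\}\subset\mathcal E(L)_t .$$ There exists a unique smallest graded nonlocal $\mathsf q$-vertex algebra $(\langle\mathcal S\rangle,Y,\mathbf 1)$ (inside $\mathcal E(L)_t$) which contains $\mathcal S$. Furthermore, $\langle\mathcal S\rangle$ is spanned by $$\left\{(x_{i_1}^{+}(z)\otimes 1)_{r_1}\cdots (x_{i_m}^{+}(z)\otimes 1)_{r_m}\mathbf 1\,:\,1\leq i_j\leq n,\ r_j<0,\ j=1,\dots,m,\ m\in\mathbb{Z}_{\geq 0}\right\}.$$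
   Context: Quantum affine algebra (Drinfeld realization, simply laced case). $q$ is an indeterminate, $[m]=(q^m-q^{-m})/(q-q^{-1})$, with corresponding factorials and (symmetric) binomials $\binom{m}{s}_q=[m][m-1]\cdots[m-s+1]/[s]!$. $U_q(\widehat{\mathfrak g})$ is the unital associative algebra over $\mathbb C(q^{1/2})$ generated by $x_i^\pm(k)$, $a_i(l)$, $K_i^{\pm1}$, $\gamma^{\pm1/2}$, $q^{\pm d}$ ($1\le i\le n$, $k,l\in\mathbb Z$, $l\ne0$) with relations: $\gamma^{\pm1/2}$ central; $K_iK_j=K_jK_i$, $K_iK_i^{-1}=K_i^{-1}K_i=1$; $[a_i(k),a_j(l)]=\delta_{k+l,0}\frac{[a_{ij}k]}{k}\frac{\gamma^k-\gamma^{-k}}{q-q^{-1}}$; $[a_i(k),K_j^{\pm1}]=[q^{\pm d},K_j^{\pm1}]=0$; $q^dx_i^\pm(k)q^{-d}=q^kx_i^\pm(k)$, $q^da_i(l)q^{-d}=q^la_i(l)$; $K_ix_j^\pm(k)K_i^{-1}=q^{\pm a_{ij}}x_j^\pm(k)$; $[a_i(k),x_j^\pm(l)]=\pm\frac{[a_{ij}k]}{k}\gamma^{\mp|k|/2}x_j^\pm(k+l)$; $x_i^\pm(k+1)x_j^\pm(l)-q^{\pm a_{ij}}x_j^\pm(l)x_i^\pm(k+1)=q^{\pm a_{ij}}x_i^\pm(k)x_j^\pm(l+1)-x_j^\pm(l+1)x_i^\pm(k)$; $[x_i^+(k),x_j^-(l)]=\frac{\delta_{ij}}{q-q^{-1}}(\gamma^{(k-l)/2}\psi_i(k+l)-\gamma^{(l-k)/2}\phi_i(k+l))$;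 and for $i\ne j$, $m=1-a_{ij}$, $\operatorname{Sym}_{l_1,\dots,l_m}\sum_{s=0}^m(-1)^s\binom ms_qx_i^\pm(l_1)\cdots x_i^\pm(l_s)x_j^\pm(k)x_i^\pm(l_{s+1})\cdots x_i^\pm(l_m)=0$. Here $\sum_{r\ge0}\phi_i(-r)z^r=K_i^{-1}\exp(-(q-q^{-1})\sum_{r\ge1}a_i(-r)z^r)$, $\sum_{r\ge0}\psi_i(r)z^{-r}=K_i\exp((q-q^{-1})\sum_{r\ge1}a_i(r)z^{-r})$, other $\phi_i(k),\psi_i(k)$ being $0$. On a module, $x_i^\pm(z)=\sum_{r\in\mathbb Z}x_i^\pm(r)z^{-r-1}$. $L$ restricted means that for every $v\in L$ and $i$, $x_i^\pm(r)v=0$ for $r$ sufficiently large, i.e. $x_i^\pm(z)\in\mathcal E(L)$. Operators. Let $\mathbb F=\mathbb C(q^{1/2})$. $L((z_1,\dots,z_m))$ denotes Laurent series with exponents bounded below in each variable; $\mathcal E(L)=\operatorname{Hom}(L,L((z)))$, $\mathcal E(L)_t=\mathcal E(L)\otimes\mathbb F[t]$; $a(z)\otimes t^\alpha$ is homogeneous of weight $\alpha$. $[r]_{\mathsf q}=(\mathsf q^r-1)/(\mathsf q-1)$, $[r]_{\mathsf q}!$ and $\binom ml_{\mathsf q}=[m]_{\mathsf q}\cdots[m-l+1]_{\mathsf q}/[l]_{\mathsf q}!$ as usual. $a^{[1]}(z)=\frac{a(z\mathsf q)-a(z)}{z(\mathsf q-1)}$, $a^{[r]}$ its $r$-th iterate.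 $\mathbb F[z]_0=\{p\in\mathbb F[z]:p(1)=1,\ p(\mathsf q^n)\ne0\ \forall n\in\mathbb Z_{\ge0}\}$. A sequence $(a_1(z)\otimes t^{\alpha_1},\dots,a_m(z)\otimes t^{\alpha_m})$ is quasi-commutative if for some $p\in\mathbb F[z]_0$, $\bigl(\prod_{i<j}p(z_j/z_i)\bigr)a_1(z_1)a_2(z_2\mathsf q^{\alpha_1})\cdots a_m(z_m\mathsf q^{\alpha_1+\cdots+\alpha_{m-1}})\in\operatorname{Hom}(L,L((z_1,\dots,z_m)))$; a sequence of general elements is quasi-commutative if all choices of homogeneous components are. For a quasi-commutative pair and $r\ge0$, $(a(z)\otimes t^\alpha)_{-r-1}(b(z)\otimes t^\beta)=\lim_{z_1\to z}\frac{p(z/z_1)}{[r]_{\mathsf q}!}a^{[r]}(z_1)b(z\mathsf q^{\alpha+r})\otimes t^{\alpha+\beta+r}$, with any $p\in\mathbb F[z]_0$ such that $p(z/z_1)a^{[r]}(z_1)b(z\mathsf q^{\alpha+r})\in\operatorname{Hom}(L,L((z_1,z)))$ (set $z_1=z$; independent of $p$); for $r<0$ the product is $0$; extend bilinearly. $Y(a,z_0)b=\sum_r(a_rb)z_0^{-r-1}$, $\mathbf 1=1\otimes1$. Iterated products are nested to the right. A graded nonlocal $\mathsf q$-vertex algebra is a $\mathbb Z$-graded space $V=\coprod_uV_{(u)}$ with a linear map $Y(\cdot,z_0):V\to(\operatorname{End}V)[[z_0^{\pm1}]]$, $Y(a,z_0)=\sum_ra_rz_0^{-r-1}$, and $\mathbf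 1\in V$ such that: $a_rb=0$ for $r\gg0$; $Y(\mathbf 1,z_0)=1_V$; $Y(a,z_0)\mathbf 1\in V[[z_0]]$ has constant term $a$; $a_rV_{(s)}\subseteq V_{(s+u-r-1)}$ for $a\in V_{(u)}$; and for $a\in V_{(u)}$, $b,c\in V$, $r,s\in\mathbb Z$: $(a_rb)_sc=\sum_{l\ge0}\binom{l-r-1}{l}_{\mathsf q}\mathsf q^{(s+l+1)(r-u+1)}a_{r-l}(b_{s+l}c)$ (this is $Y(a,z_0+z_2)Y(b,z_2\mathsf q^u)c=Y(Y(a,z_0)b,z_2)c$ with $z_2z_0=\mathsf qz_0z_2$). A graded nonlocal $\mathsf q$-vertex algebra inside $\mathcal E(L)_t$ is a subspace $V$ whose pairs are quasi-commutative, containing $\mathbf 1$, closed under all products, satisfying these axioms with $Y(a,z_0)b=\sum_{r\in\mathbb Z}(a_rb)z_0^{-r-1}$ formed from the products $a_rb$ of quasi-commutative pairs in $\mathcal E(L)_t$, with $\mathbf 1=1\otimes1$ (identity operator of $L$ tensor $1$), and with $V_{(u)}=\{a(z)\otimes t^u\in V\}$. *)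

theory Defs
  imports
    Complex_Main
    "HOL-Computational_Algebra.Polynomial"
    "HOL-Computational_Algebra.Fraction_Field"
    "HOL-Combinatorics.Permutations"
    "HOL-Library.Function_Algebras"
begin

section \<open>Affine Cartan matrices of type ADE\<close>

datatype ade = Type_A nat | Type_D nat | Type_E nat

fun ade_valid :: "ade \<Rightarrow> bool" where
  "ade_valid (Type_A n) \<longleftrightarrow> 1 \<le> n"
| "ade_valid (Type_D n) \<longleftrightarrow> 4 \<le> n"
| "ade_valid (Type_E n) \<longleftrightarrow> n \<in> {6, 7, 8}"

fun ade_rank :: "ade \<Rightarrow> nat" where
  "ade_rank (Type_A n) = n"
| "ade_rank (Type_D n) = n"
| "ade_rank (Type_E n) = n"

text \<open>Edges of the affine Dynkin diagrams in Bourbaki's labelling, with 0 the affine vertex.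
  The diagram of type \<open>Type_A 1\<close> has a double bond and is treated separately below.\<close>

fun affine_edges :: "ade \<Rightarrow> (nat \<times> nat) set" where
  "affine_edges (Type_A n) = {(i, i + 1) | i. 1 \<le> i \<and> i < n} \<union> {(0, 1), (0, n)}"
| "affine_edges (Type_D n) = {(i, i + 1) | i. 1 \<le> i \<and> i < n - 1} \<union> {(n - 2, n), (0, 2)}"
| "affine_edges (Type_E n) = {(i, i + 1) | i. 3 \<le> i \<and> i < n} \<union> {(1, 3), (2, 4)} \<union>
     {(0, if n = 6 then 2 else if n = 7 then 1 else 8)}"

definition affine_cartan :: "ade \<Rightarrow> nat \<Rightarrow> nat \<Rightarrow> int" where
  "affine_cartan X i j =
     (if i = j then 2
      else if (i, j) \<in> affine_edges X \<or> (j, i) \<in> affine_edges X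
      then (if X = Type_A 1 then -2 else -1)
      else 0)"

text \<open>The labelling of the vertices \<open>1,\<dots>,n\<close> is left free.\<close>

definition is_affine_ADE_cartan_matrix :: "nat \<Rightarrow> (nat \<Rightarrow> nat \<Rightarrow> int) \<Rightarrow> bool" where
  "is_affine_ADE_cartan_matrix n C \<longleftrightarrow>
     (\<exists>X \<sigma>. ade_valid X \<and> ade_rank X = n \<and> \<sigma> permutes {1..n} \<and>
       (\<forall>i\<le>n. \<forall>j\<le>n. C i j = affine_cartan X (\<sigma> i) (\<sigma> j)))"


section \<open>Modules over the quantum affine algebra\<close>

text \<open>The field of rational functions over the complex numbers in the indeterminate
  \<open>q\<^sup>1\<^sup>/\<^sup>2\<close>.\<close>

type_synonym qfield = "complex poly fract"

definition qhalf :: qfield where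
  "qhalf = Fract [:0, 1:] 1"

definition qpar :: qfield where
  "qpar = qhalf ^ 2"

definition sqint :: "int \<Rightarrow> qfield" where
  "sqint m = (qpar powi m - qpar powi (- m)) / (qpar - inverse qpar)"

definition sqbinom :: "nat \<Rightarrow> nat \<Rightarrow> qfield" where
  "sqbinom m s = (\<Prod>t<s. sqint (int m - int t)) / (\<Prod>t=1..s. sqint (int t))"

definition commuting :: "('l \<Rightarrow> 'l) \<Rightarrow> ('l \<Rightarrow> 'l) \<Rightarrow> bool" where
  "commuting S T \<longleftrightarrow> S \<circ> T = T \<circ> S"

definition op_powi :: "('l \<Rightarrow> 'l) \<Rightarrow> ('l \<Rightarrow> 'l) \<Rightarrow> int \<Rightarrow> 'l \<Rightarrow> 'l" where
  "op_powi T Tinv k = (if 0 \<le> k then T ^^ nat k else Tinv ^^ nat (- k))"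

text \<open>The coefficient of \<open>w\<^sup>r\<close> in \<open>exp (\<Sum>s\<ge>1. T s w\<^sup>s)\<close>, the \<open>T s\<close> being operators:
  the sum runs over the compositions of \<open>r\<close>, and a composition with \<open>m\<close> parts comes from the
  \<open>m\<close>-th power in the exponential series.\<close>

definition exp_coeff ::
    "(qfield \<Rightarrow> 'l::ab_group_add \<Rightarrow> 'l) \<Rightarrow> (nat \<Rightarrow> 'l \<Rightarrow> 'l) \<Rightarrow> nat \<Rightarrow> 'l \<Rightarrow> 'l" where
  "exp_coeff scale T r v =
     (\<Sum>rs\<in>{rs. 0 \<notin> set rs \<and> sum_list rs = r}.
        scale (1 / of_nat (fact (length rs))) (foldr T rs v))"

definition psi_op ::
    "(qfield \<Rightarrow> 'l::ab_group_add \<Rightarrow> 'l) \<Rightarrow> (int \<Rightarrow> 'l \<Rightarrow> 'l) \<Rightarrow> ('l \<Rightarrow> 'l) \<Rightarrow> int \<Rightarrow> 'l \<Rightarrow> 'l" where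
  "psi_op scale h Ki k v =
     (if k < 0 then 0
      else Ki (exp_coeff scale (\<lambda>r w. scale (qpar - inverse qpar) (h (int r) w)) (nat k) v))"

definition phi_op ::
    "(qfield \<Rightarrow> 'l::ab_group_add \<Rightarrow> 'l) \<Rightarrow> (int \<Rightarrow> 'l \<Rightarrow> 'l) \<Rightarrow> ('l \<Rightarrow> 'l) \<Rightarrow> int \<Rightarrow> 'l \<Rightarrow> 'l" where
  "phi_op scale h Kinvi k v =
     (if k > 0 then 0
      else Kinvi (exp_coeff scale
             (\<lambda>r w. scale (- (qpar - inverse qpar)) (h (- int r) w)) (nat (- k)) v))"

text \<open>A module over the quantum affine algebra, given by the operators by which the Drinfeld
  generators act.  The operators \<open>a i k\<close> matter only for \<open>k \<noteq> 0\<close>, and \<open>g\<close>, \<open>d\<close> are the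
  actions of \<open>\<gamma>\<^sup>1\<^sup>/\<^sup>2\<close>, \<open>q\<^sup>d\<close>.  The index \<open>(\<epsilon>, x)\<close> handles both signs of \<open>x\<^sub>i\<^sup>\<plusminus>\<close> at once.\<close>

locale quantum_affine_module = vector_space scale
  for n :: nat
    and C :: "nat \<Rightarrow> nat \<Rightarrow> int"
    and scale :: "qfield \<Rightarrow> 'l::ab_group_add \<Rightarrow> 'l"
    and xp xm a :: "nat \<Rightarrow> int \<Rightarrow> 'l \<Rightarrow> 'l"
    and K Kinv :: "nat \<Rightarrow> 'l \<Rightarrow> 'l"
    and g ginv d dinv :: "'l \<Rightarrow> 'l" +
  assumes linear_generators:
      "\<And>i k. i \<in> {1..n} \<Longrightarrow> Vector_Spaces.linear scale scale (xp i k)"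
      "\<And>i k. i \<in> {1..n} \<Longrightarrow> Vector_Spaces.linear scale scale (xm i k)"
      "\<And>i k. i \<in> {1..n} \<Longrightarrow> k \<noteq> 0 \<Longrightarrow> Vector_Spaces.linear scale scale (a i k)"
      "\<And>i. i \<in> {1..n} \<Longrightarrow> Vector_Spaces.linear scale scale (K i)"
      "\<And>i. i \<in> {1..n} \<Longrightarrow> Vector_Spaces.linear scale scale (Kinv i)"
      "Vector_Spaces.linear scale scale g"
      "Vector_Spaces.linear scale scale ginv"
      "Vector_Spaces.linear scale scale d"
      "Vector_Spaces.linear scale scale dinv"
    and inverses:
      "\<And>i. i \<in> {1..n} \<Longrightarrow> K i \<circ> Kinv i = id \<and> Kinv i \<circ> K i = id"
      "g \<circ> ginv = id" "ginv \<circ> g = id"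
      "d \<circ> dinv = id" "dinv \<circ> d = id"
    and gamma_central:
      "\<And>c i k. c \<in> {g, ginv} \<Longrightarrow> i \<in> {1..n} \<Longrightarrow> commuting c (xp i k)"
      "\<And>c i k. c \<in> {g, ginv} \<Longrightarrow> i \<in> {1..n} \<Longrightarrow> commuting c (xm i k)"
      "\<And>c i k. c \<in> {g, ginv} \<Longrightarrow> i \<in> {1..n} \<Longrightarrow> k \<noteq> 0 \<Longrightarrow> commuting c (a i k)"
      "\<And>c i. c \<in> {g, ginv} \<Longrightarrow> i \<in> {1..n} \<Longrightarrow> commuting c (K i) \<and> commuting c (Kinv i)"
      "\<And>c. c \<in> {g, ginv} \<Longrightarrow> commuting c d \<and> commuting c dinv"
    and K_K:
      "\<And>i j. i \<in> {1..n} \<Longrightarrow> j \<in> {1..n} \<Longrightarrow> commuting (K i) (K j)"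
    and a_a:
      "\<And>i j k l v. i \<in> {1..n} \<Longrightarrow> j \<in> {1..n} \<Longrightarrow> k \<noteq> 0 \<Longrightarrow> l \<noteq> 0 \<Longrightarrow>
         a i k (a j l v) - a j l (a i k v) =
           (if k + l = 0
            then scale (sqint (C i j * k) / of_int k / (qpar - inverse qpar))
                   (op_powi g ginv (2 * k) v - op_powi g ginv (- 2 * k) v)
            else 0)"
    and a_K:
      "\<And>i j k. i \<in> {1..n} \<Longrightarrow> j \<in> {1..n} \<Longrightarrow> k \<noteq> 0 \<Longrightarrow>
         commuting (a i k) (K j) \<and> commuting (a i k) (Kinv j)"
    and d_K:
      "\<And>D j. D \<in> {d, dinv} \<Longrightarrow> j \<in> {1..n} \<Longrightarrow> commuting D (K j) \<and> commuting D (Kinv j)"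
    and d_x:
      "\<And>x i k v. x \<in> {xp, xm} \<Longrightarrow> i \<in> {1..n} \<Longrightarrow>
         d (x i k (dinv v)) = scale (qpar powi k) (x i k v)"
    and d_a:
      "\<And>i l v. i \<in> {1..n} \<Longrightarrow> l \<noteq> 0 \<Longrightarrow> d (a i l (dinv v)) = scale (qpar powi l) (a i l v)"
    and K_x:
      "\<And>\<epsilon> x i j k v. (\<epsilon>, x) \<in> {(1, xp), (-1, xm)} \<Longrightarrow> i \<in> {1..n} \<Longrightarrow> j \<in> {1..n} \<Longrightarrow>
         K i (x j k (Kinv i v)) = scale (qpar powi (\<epsilon> * C i j)) (x j k v)"
    and a_x:
      "\<And>\<epsilon> x i j k l v. (\<epsilon>, x) \<in> {(1, xp), (-1, xm)} \<Longrightarrow> i \<in> {1..n} \<Longrightarrow> j \<in> {1..n} \<Longrightarrow> k \<noteq> 0 \<Longrightarrow>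
         a i k (x j l v) - x j l (a i k v) =
           scale (of_int \<epsilon> * (sqint (C i j * k) / of_int k))
             (op_powi g ginv (- \<epsilon> * \<bar>k\<bar>) (x j (k + l) v))"
    and x_x:
      "\<And>\<epsilon> x i j k l v. (\<epsilon>, x) \<in> {(1, xp), (-1, xm)} \<Longrightarrow> i \<in> {1..n} \<Longrightarrow> j \<in> {1..n} \<Longrightarrow>
         x i (k + 1) (x j l v) - scale (qpar powi (\<epsilon> * C i j)) (x j l (x i (k + 1) v)) =
         scale (qpar powi (\<epsilon> * C i j)) (x i k (x j (l + 1) v)) - x j (l + 1) (x i k v)"
    and xp_xm:
      "\<And>i j k l v. i \<in> {1..n} \<Longrightarrow> j \<in> {1..n} \<Longrightarrow>
         xp i k (xm j l v) - xm j l (xp i k v) =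
           (if i = j
            then scale (1 / (qpar - inverse qpar))
                   (op_powi g ginv (k - l) (psi_op scale (a i) (K i) (k + l) v) -
                    op_powi g ginv (l - k) (phi_op scale (a i) (Kinv i) (k + l) v))
            else 0)"
    and serre:
      "\<And>x i j k m (l :: nat \<Rightarrow> int) v.
         x \<in> {xp, xm} \<Longrightarrow> i \<in> {1..n} \<Longrightarrow> j \<in> {1..n} \<Longrightarrow> i \<noteq> j \<Longrightarrow> int m = 1 - C i j \<Longrightarrow>
         (\<Sum>\<sigma>\<in>{\<sigma>. \<sigma> permutes {1..m}}. \<Sum>s=0..m.
            scale ((-1) ^ s * sqbinom m s)
              (foldr (\<lambda>t. x i (l (\<sigma> t))) [1..<s+1]
                (x j k (foldr (\<lambda>t. x i (l (\<sigma> t))) [s+1..<m+1] v)))) = 0"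

definition restricted_module ::
    "nat \<Rightarrow> (nat \<Rightarrow> int \<Rightarrow> 'l::zero \<Rightarrow> 'l) \<Rightarrow> (nat \<Rightarrow> int \<Rightarrow> 'l \<Rightarrow> 'l) \<Rightarrow> bool" where
  "restricted_module n xp xm \<longleftrightarrow>
     (\<forall>v. \<forall>i\<in>{1..n}. \<exists>N. \<forall>r\<ge>N. xp i r v = 0 \<and> xm i r v = 0)"


section \<open>Fields, quasi-commutativity and products\<close>

text \<open>A formal distribution \<open>a(z)\<close> is the family of its coefficients: \<open>a k\<close> is the
  coefficient of \<open>z\<^sup>k\<close>.  For the field with modes \<open>x r\<close> this is the operator \<open>x (- k - 1)\<close>.\<close>

type_synonym 'l distr = "int \<Rightarrow> 'l \<Rightarrow> 'l"

definition field_of_modes :: "(int \<Rightarrow> 'l \<Rightarrow> 'l) \<Rightarrow> 'l distr" where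
  "field_of_modes x = (\<lambda>k. x (- k - 1))"

definition fields :: "('f::field \<Rightarrow> 'l::ab_group_add \<Rightarrow> 'l) \<Rightarrow> 'l distr set" where
  "fields scale =
     {a. (\<forall>k. Vector_Spaces.linear scale scale (a k)) \<and> (\<forall>v. \<exists>N. \<forall>k<N. a k v = 0)}"

text \<open>The tensor product of the space of fields with the polynomials in \<open>t\<close> is taken as the
  space of polynomials in \<open>t\<close> with fields as coefficients, \<open>a(z) \<otimes> t\<^sup>\<alpha>\<close> being
  \<open>monom a \<alpha>\<close>.\<close>

definition fields_t :: "('f::field \<Rightarrow> 'l::ab_group_add \<Rightarrow> 'l) \<Rightarrow> 'l distr poly set" where
  "fields_t scale = {A. \<forall>\<alpha>. coeff A \<alpha> \<in> fields scale}"

definition scale_t :: "('f::field \<Rightarrow> 'l::ab_group_add \<Rightarrow> 'l) \<Rightarrow> 'f \<Rightarrow> 'l distr poly \<Rightarrow> 'l distr poly" where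
  "scale_t scale c A = map_poly (\<lambda>a k v. scale c (a k v)) A"

definition vacuum :: "'l::ab_group_add distr poly" where
  "vacuum = monom (\<lambda>k v. if k = 0 then v else 0) 0"

definition qint :: "'f::field \<Rightarrow> int \<Rightarrow> 'f" where
  "qint Q r = (Q powi r - 1) / (Q - 1)"

definition qfact :: "'f::field \<Rightarrow> nat \<Rightarrow> 'f" where
  "qfact Q r = (\<Prod>t=1..r. qint Q (int t))"

definition qbinom :: "'f::field \<Rightarrow> int \<Rightarrow> nat \<Rightarrow> 'f" where
  "qbinom Q m l = (\<Prod>t<l. qint Q (m - int t)) / qfact Q l"

text \<open>The distribution \<open>a(c z)\<close>.\<close>

definition dilate :: "('f::field \<Rightarrow> 'l::ab_group_add \<Rightarrow> 'l) \<Rightarrow> 'f \<Rightarrow> 'l distr \<Rightarrow> 'l distr" where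
  "dilate scale c a = (\<lambda>k v. scale (c powi k) (a k v))"

text \<open>The \<open>q\<close>-derivative \<open>(a(z Q) - a(z)) / (z (Q - 1))\<close>; dividing by \<open>z\<close> shifts the index.\<close>

definition qderiv :: "('f::field \<Rightarrow> 'l::ab_group_add \<Rightarrow> 'l) \<Rightarrow> 'f \<Rightarrow> 'l distr \<Rightarrow> 'l distr" where
  "qderiv scale Q a =
     (\<lambda>k v. scale (1 / (Q - 1)) (dilate scale Q a (k + 1) v - a (k + 1) v))"

text \<open>Distributions in \<open>m\<close> variables, numbered \<open>0,\<dots>,m-1\<close>, are families of operators indexed by
  exponent vectors \<open>k\<close>; only the entries \<open>k i\<close> with \<open>i < m\<close> are relevant.\<close>

type_synonym 'l mdistr = "(nat \<Rightarrow> int) \<Rightarrow> 'l \<Rightarrow> 'l"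

definition mfields :: "('f::field \<Rightarrow> 'l::ab_group_add \<Rightarrow> 'l) \<Rightarrow> nat \<Rightarrow> 'l mdistr set" where
  "mfields scale m =
     {f. (\<forall>k. Vector_Spaces.linear scale scale (f k)) \<and>
         (\<forall>k k'. (\<forall>i<m. k i = k' i) \<longrightarrow> f k = f k') \<and>
         (\<forall>v. \<exists>N. \<forall>k. f k v \<noteq> 0 \<longrightarrow> (\<forall>i<m. N \<le> k i))}"

text \<open>For a list of pairs \<open>(a\<^sub>i, \<alpha>\<^sub>i)\<close>, the distribution
  \<open>a\<^sub>1(z\<^sub>1) a\<^sub>2(z\<^sub>2 Q^\<alpha>\<^sub>1) \<cdots> a\<^sub>m(z\<^sub>m Q^(\<alpha>\<^sub>1 + \<cdots> + \<alpha>\<^sub>m\<^sub>-\<^sub>1))\<close>.\<close>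

definition shifted_product ::
    "('f::field \<Rightarrow> 'l::ab_group_add \<Rightarrow> 'l) \<Rightarrow> 'f \<Rightarrow> ('l distr \<times> nat) list \<Rightarrow> 'l mdistr" where
  "shifted_product scale Q hs =
     (\<lambda>k. foldr (\<lambda>i. dilate scale (Q ^ (\<Sum>j<i. snd (hs ! j))) (fst (hs ! i)) (k i))
            [0..<length hs])"

text \<open>Multiplication by \<open>p(z\<^sub>j / z\<^sub>i)\<close>.\<close>

definition mult_ratio ::
    "('f::field \<Rightarrow> 'l::ab_group_add \<Rightarrow> 'l) \<Rightarrow> 'f poly \<Rightarrow> nat \<times> nat \<Rightarrow> 'l mdistr \<Rightarrow> 'l mdistr" where
  "mult_ratio scale p = (\<lambda>(i, j) f k v.
     \<Sum>e\<le>degree p. scale (coeff p e) (f (k(i := k i + int e, j := k j - int e)) v))"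

definition mult_ratios ::
    "('f::field \<Rightarrow> 'l::ab_group_add \<Rightarrow> 'l) \<Rightarrow> 'f poly \<Rightarrow> nat \<Rightarrow> 'l mdistr \<Rightarrow> 'l mdistr" where
  "mult_ratios scale p m f = fold (mult_ratio scale p) [(i, j). j \<leftarrow> [0..<m], i \<leftarrow> [0..<j]] f"

definition poly0 :: "'f::field \<Rightarrow> 'f poly set" where
  "poly0 Q = {p. poly p 1 = 1 \<and> (\<forall>n::nat. poly p (Q ^ n) \<noteq> 0)}"

definition qc_witness ::
    "('f::field \<Rightarrow> 'l::ab_group_add \<Rightarrow> 'l) \<Rightarrow> 'f \<Rightarrow> ('l distr \<times> nat) list \<Rightarrow> 'f poly \<Rightarrow> bool" where
  "qc_witness scale Q hs p \<longleftrightarrow>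
     p \<in> poly0 Q \<and>
     mult_ratios scale p (length hs) (shifted_product scale Q hs) \<in> mfields scale (length hs)"

definition quasi_commutative ::
    "('f::field \<Rightarrow> 'l::ab_group_add \<Rightarrow> 'l) \<Rightarrow> 'f \<Rightarrow> 'l distr poly list \<Rightarrow> bool" where
  "quasi_commutative scale Q As \<longleftrightarrow>
     (\<forall>\<alpha>s. length \<alpha>s = length As \<longrightarrow>
       (\<exists>p. qc_witness scale Q (map2 (\<lambda>A \<alpha>. (coeff A \<alpha>, \<alpha>)) As \<alpha>s) p))"

text \<open>Setting both variables of a two-variable distribution equal to \<open>z\<close>.\<close>

definition diagonal :: "'l::ab_group_add mdistr \<Rightarrow> 'l distr" where
  "diagonal f = (\<lambda>k v. let c = (\<lambda>i. f (\<lambda>t. if t = 0 then i else k - i) v) in \<Sum>i\<in>{i. c i \<noteq> 0}. c i)"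

text \<open>The product \<open>(a \<otimes> t\<^sup>\<alpha>)\<^sub>-\<^sub>r\<^sub>-\<^sub>1 (b \<otimes> t\<^sup>\<beta>)\<close>.  The shift of \<open>b\<close> by
  \<open>Q^(\<alpha> + r)\<close> is obtained by giving the \<open>r\<close>-th derivative of \<open>a\<close> the weight \<open>\<alpha> + r\<close>.
  The value is meaningful only for quasi-commutative pairs, where it does not depend on the
  chosen \<open>p\<close>.\<close>

definition hom_product ::
    "('f::field \<Rightarrow> 'l::ab_group_add \<Rightarrow> 'l) \<Rightarrow> 'f \<Rightarrow> nat \<Rightarrow> 'l distr \<Rightarrow> nat \<Rightarrow> 'l distr \<Rightarrow> nat \<Rightarrow>
     'l distr poly" where
  "hom_product scale Q r a \<alpha> b \<beta> =
     (let hs = [((qderiv scale Q ^^ r) a, \<alpha> + r), (b, \<beta>)];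
          p = (SOME p. qc_witness scale Q hs p);
          c = diagonal (mult_ratios scale p 2 (shifted_product scale Q hs))
      in monom (\<lambda>k v. scale (1 / qfact Q r) (c k v)) (\<alpha> + \<beta> + r))"

definition nth_product ::
    "('f::field \<Rightarrow> 'l::ab_group_add \<Rightarrow> 'l) \<Rightarrow> 'f \<Rightarrow> 'l distr poly \<Rightarrow> int \<Rightarrow> 'l distr poly \<Rightarrow>
     'l distr poly" where
  "nth_product scale Q A s B =
     (if 0 \<le> s then 0
      else \<Sum>\<alpha>\<le>degree A. \<Sum>\<beta>\<le>degree B.
             hom_product scale Q (nat (- s - 1)) (coeff A \<alpha>) \<alpha> (coeff B \<beta>) \<beta>)"


section \<open>Graded nonlocal q-vertex algebras\<close>

text \<open>\<open>V\<close> is the carrier, \<open>G u\<close> the subspace of weight \<open>u\<close> and \<open>Y a r b\<close> the product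
  \<open>a\<^sub>r b\<close>.  By truncation the sum in \<open>associativity\<close> over all \<open>l\<close> is finite.\<close>

locale graded_nonlocal_q_vertex_algebra = vector_space scl
  for scl :: "'f::field \<Rightarrow> 'v::ab_group_add \<Rightarrow> 'v"
    and Q :: 'f
    and V :: "'v set"
    and G :: "int \<Rightarrow> 'v set"
    and Y :: "'v \<Rightarrow> int \<Rightarrow> 'v \<Rightarrow> 'v"
    and vac :: 'v +
  assumes subspace_V: "subspace V"
    and subspace_G: "\<And>u. subspace (G u)" "\<And>u. G u \<subseteq> V"
    and direct_sum: "\<And>a. a \<in> V \<Longrightarrow>
      \<exists>!c. (\<forall>u. c u \<in> G u) \<and> finite {u. c u \<noteq> 0} \<and> a = (\<Sum>u | c u \<noteq> 0. c u)"
    and vac_closed: "vac \<in> V"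
    and Y_closed: "\<And>a b r. a \<in> V \<Longrightarrow> b \<in> V \<Longrightarrow> Y a r b \<in> V"
    and Y_linear:
      "\<And>a a' b r. a \<in> V \<Longrightarrow> a' \<in> V \<Longrightarrow> b \<in> V \<Longrightarrow> Y (a + a') r b = Y a r b + Y a' r b"
      "\<And>a b c r. a \<in> V \<Longrightarrow> b \<in> V \<Longrightarrow> Y (scl c a) r b = scl c (Y a r b)"
      "\<And>a b b' r. a \<in> V \<Longrightarrow> b \<in> V \<Longrightarrow> b' \<in> V \<Longrightarrow> Y a r (b + b') = Y a r b + Y a r b'"
      "\<And>a b c r. a \<in> V \<Longrightarrow> b \<in> V \<Longrightarrow> Y a r (scl c b) = scl c (Y a r b)"
    and truncation: "\<And>a b. a \<in> V \<Longrightarrow> b \<in> V \<Longrightarrow> \<exists>N. \<forall>r\<ge>N. Y a r b = 0"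
    and vacuum_axiom: "\<And>b r. b \<in> V \<Longrightarrow> Y vac r b = (if r = -1 then b else 0)"
    and creation: "\<And>a r. a \<in> V \<Longrightarrow> 0 \<le> r \<Longrightarrow> Y a r vac = 0"
      "\<And>a. a \<in> V \<Longrightarrow> Y a (-1) vac = a"
    and grading: "\<And>a b u s r. a \<in> G u \<Longrightarrow> b \<in> G s \<Longrightarrow> Y a r b \<in> G (s + u - r - 1)"
    and associativity: "\<And>a b c u r s. a \<in> G u \<Longrightarrow> b \<in> V \<Longrightarrow> c \<in> V \<Longrightarrow>
      Y (Y a r b) s c =
        (\<Sum>l | Y b (s + int l) c \<noteq> 0.
           scl (qbinom Q (int l - r - 1) l * Q powi ((s + int l + 1) * (r - u + 1)))
             (Y a (r - int l) (Y b (s + int l) c)))"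

definition weight_space :: "'l::ab_group_add distr poly set \<Rightarrow> int \<Rightarrow> 'l distr poly set" where
  "weight_space V u = (if u < 0 then {0} else {monom a (nat u) | a. monom a (nat u) \<in> V})"

definition q_vertex_algebra_in_fields ::
    "('f::field \<Rightarrow> 'l::ab_group_add \<Rightarrow> 'l) \<Rightarrow> 'f \<Rightarrow> 'l distr poly set \<Rightarrow> bool" where
  "q_vertex_algebra_in_fields scale Q V \<longleftrightarrow>
     V \<subseteq> fields_t scale \<and>
     (\<forall>a\<in>V. \<forall>b\<in>V. quasi_commutative scale Q [a, b]) \<and>
     graded_nonlocal_q_vertex_algebra (scale_t scale) Q V (weight_space V)
       (nth_product scale Q) vacuum"

definition smallest_q_vertex_algebra ::
    "('f::field \<Rightarrow> 'l::ab_group_add \<Rightarrow> 'l) \<Rightarrow> 'f \<Rightarrow> 'l distr poly set \<Rightarrow> 'l distr poly set \<Rightarrow> bool" where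
  "smallest_q_vertex_algebra scale Q S V \<longleftrightarrow>
     q_vertex_algebra_in_fields scale Q V \<and> S \<subseteq> V \<and>
     (\<forall>W. q_vertex_algebra_in_fields scale Q W \<and> S \<subseteq> W \<longrightarrow> V \<subseteq> W)"

end

(*
Write a(z) o_n b(z) for the value of a(z) b(z Q^n), obtained by multiplying with a polynomial
f(w/z) that makes the product regular and dividing by f(Q^n). The product
(a t^alpha)_{-r-1} (b t^beta) is the divided q-derivative of a of order r composed with b by
o_{alpha+r}. Two facts about o_n give the vertex algebra axioms: it is associative,
(a o_m b) o_{m+n} c = a o_m (b o_n c), and it obeys a twisted Leibniz rule for the q-derivative;
iterating the latter yields the q-binomial coefficients of the associativity axiom.

Existence of the values and their associativity come from locality, f(w/z) a(z) b(w) =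
g(w/z) b(w) a(z), where f has no root Q^n with n at least the weight of a. The generators are local
by the relation between x_i^+ and x_j^+, with f = 1 - q^{a_ij} x. If a_ij = 0, this f vanishes at 1,
but then the Serre relation says that the two fields commute. Locality is inherited by o_n,
dilations and multiplication by z^{-1}, and it implies regularity of triple products. The span of
the words is closed under all products by associativity and induction on words.
*)
theory Submission
  imports Defs
begin

section \<open>Polynomials in ratios of variables, and substitution\<close>

text \<open>Only one side of the locality relation is controlled. For i = j it reads (1 - q^2 w/z)
  x_i(z) x_i(w) = (q^2 - w/z) x_i(w) x_i(z): the left polynomial has the root Q^-1, which is no Q^n
  with n \<ge> 0, but the right one vanishes at Q. Products are therefore evaluated in one order,
  and the weight records from which power of Q on this is possible. A dilation of the left factor
  moves the roots up by one power of Q, which matches the power t^r that an r-th q-derivative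
  contributes. Regularity of pairs bounds the exponents of a triple product only for each fixed
  exponent of the third factor. Locality gives uniform bounds, because each factor can be made to
  act first on the vector. It may however be lost under sums, since the polynomials on the right
  differ. Hence locality is proved for fields built without sums, and only the regularity of pairs
  and triples is extended linearly.\<close>

locale distribution_calculus = vector_space scale
  for scale :: "'f::field \<Rightarrow> 'l::ab_group_add \<Rightarrow> 'l"
begin

abbreviation lin :: "('l \<Rightarrow> 'l) \<Rightarrow> bool" where
  "lin \<equiv> Vector_Spaces.linear scale scale"

lemma lin_iff:
  "lin T \<longleftrightarrow> (\<forall>x y. T (x + y) = T x + T y) \<and> (\<forall>c x. T (scale c x) = scale c (T x))"
  using vector_space_axioms by (auto simp: Vector_Spaces.linear_iff)

lemma linI:
  "(\<And>x y. T (x + y) = T x + T y) \<Longrightarrow> (\<And>c x. T (scale c x) = scale c (T x)) \<Longrightarrow> lin T"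
  by (simp add: lin_iff)

lemma lin_add: "lin T \<Longrightarrow> T (x + y) = T x + T y"
  by (simp add: lin_iff)

lemma lin_scale: "lin T \<Longrightarrow> T (scale c x) = scale c (T x)"
  by (simp add: lin_iff)

lemma lin_0: "lin T \<Longrightarrow> T 0 = 0"
  using lin_scale[of T 0 0] by simp

lemma lin_sum: "lin T \<Longrightarrow> T (\<Sum>i\<in>A. f i) = (\<Sum>i\<in>A. T (f i))"
  by (induction A rule: infinite_finite_induct) (simp_all add: lin_0 lin_add)

text \<open>A series is the family \<open>u\<close> of its coefficients. If multiplication by a monomial \<open>x\<close> moves the exponent
  \<open>\<sigma> k\<close> to \<open>k\<close>, then \<open>poly_act f \<sigma> u\<close> is the product \<open>f(x) u\<close>.\<close>

definition poly_act :: "'f poly \<Rightarrow> ('x \<Rightarrow> 'x) \<Rightarrow> ('x \<Rightarrow> 'l) \<Rightarrow> 'x \<Rightarrow> 'l" where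
  "poly_act f \<sigma> u x = (\<Sum>e\<le>degree f. scale (coeff f e) (u ((\<sigma> ^^ e) x)))"

text \<open>Coefficients beyond the degree are 0, so polynomials of different degrees can be
  compared over a common range.\<close>

lemma poly_act_bound:
  assumes "degree f \<le> N"
  shows "poly_act f \<sigma> u x = (\<Sum>e\<le>N. scale (coeff f e) (u ((\<sigma> ^^ e) x)))"
  unfolding poly_act_def
  by (rule sum.mono_neutral_left) (use assms in \<open>auto simp: coeff_eq_0\<close>)

lemma poly_act_0 [simp]: "poly_act 0 \<sigma> u x = 0"
  by (simp add: poly_act_def)

lemma poly_act_pCons: "poly_act (pCons c f) \<sigma> u x = scale c (u x) + poly_act f \<sigma> u (\<sigma> x)"
proof -
  have "poly_act (pCons c f) \<sigma> u x
      = (\<Sum>e\<le>Suc (degree f). scale (coeff (pCons c f) e) (u ((\<sigma> ^^ e) x)))"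
    by (rule poly_act_bound) (rule degree_pCons_le)
  also have "\<dots> = scale c (u x) + (\<Sum>e\<le>degree f. scale (coeff f e) (u ((\<sigma> ^^ e) (\<sigma> x))))"
    by (subst sum.atMost_Suc_shift) (simp add: funpow_swap1)
  finally show ?thesis
    by (simp add: poly_act_def)
qed

lemma poly_act_1 [simp]: "poly_act 1 \<sigma> u x = u x"
  by (simp add: poly_act_def)

lemma poly_act_add_poly: "poly_act (f + g) \<sigma> u x = poly_act f \<sigma> u x + poly_act g \<sigma> u x"
proof -
  let ?N = "max (degree f) (degree g)"
  have "degree (f + g) \<le> ?N" by (rule degree_add_le_max)
  then show ?thesis
    by (simp add: poly_act_bound[where N = ?N] scale_left_distrib sum.distrib)
qed

lemma poly_act_smult_poly: "poly_act (smult c f) \<sigma> u x = scale c (poly_act f \<sigma> u x)"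
  by (simp add: poly_act_bound[where N = "degree f", OF degree_smult_le] poly_act_def scale_sum_right)

lemma poly_act_add: "poly_act f \<sigma> (\<lambda>x. u x + u' x) x = poly_act f \<sigma> u x + poly_act f \<sigma> u' x"
  by (simp add: poly_act_def scale_right_distrib sum.distrib)

lemma poly_act_scale: "poly_act f \<sigma> (\<lambda>x. scale c (u x)) x = scale c (poly_act f \<sigma> u x)"
  by (simp add: poly_act_def scale_sum_right mult.commute)

lemma poly_act_zero: "poly_act f \<sigma> (\<lambda>x. 0) x = 0"
  by (simp add: poly_act_def)

text \<open>Series form a module over the polynomials. Regularising factors can thus be merged,
  enlarged and taken apart again.\<close>

lemma poly_act_mult: "poly_act (f * g) \<sigma> u = poly_act f \<sigma> (poly_act g \<sigma> u)"
proof (induction f)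
  case 0
  then show ?case by (simp add: fun_eq_iff)
next
  case (pCons c f)
  then show ?case
    by (auto simp: fun_eq_iff poly_act_pCons poly_act_add_poly poly_act_smult_poly mult_pCons_left)
qed

text \<open>Holds because the exponent shifts commute. It allows the factors for the three ratios of
  a triple product to be applied in whichever order a step requires.\<close>

lemma poly_act_commute:
  assumes "\<And>x. \<sigma> (\<tau> x) = \<tau> (\<sigma> x)"
  shows "poly_act f \<sigma> (poly_act g \<tau> u) = poly_act g \<tau> (poly_act f \<sigma> u)"
proof (induction g)
  case 0
  then show ?case by (simp add: fun_eq_iff poly_act_zero)
next
  case (pCons c g)
  have "poly_act f \<sigma> (\<lambda>x. poly_act g \<tau> u (\<tau> x)) x = poly_act f \<sigma> (poly_act g \<tau> u) (\<tau> x)" for x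
  proof -
    have "(\<sigma> ^^ e) (\<tau> x) = \<tau> ((\<sigma> ^^ e) x)" for e
      by (induction e) (simp_all add: assms)
    then show ?thesis by (simp add: poly_act_def[of f \<sigma>])
  qed
  with pCons show ?case
    by (simp add: fun_eq_iff poly_act_pCons poly_act_add poly_act_scale)
qed

text \<open>The case of a ratio that a substitution has made constant; the constant itself is
  absorbed into \<open>f\<close> by \<open>pcompose\<close>, so only the value at 1 is left.\<close>

lemma poly_act_id: "poly_act f id u x = scale (poly f 1) (u x)"
  by (simp add: poly_act_def poly_altdef scale_sum_left)

text \<open>A substitution such as \<open>z\<^sub>2 = c z\<^sub>1\<close> maps exponents by \<open>\<pi>\<close> and scales coefficients by \<open>w\<close>. The
  sum is meaningful only if it is finite.\<close>

definition push :: "('x \<Rightarrow> 'y) \<Rightarrow> ('x \<Rightarrow> 'f) \<Rightarrow> ('x \<Rightarrow> 'l) \<Rightarrow> 'y \<Rightarrow> 'l" where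
  "push \<pi> w u y = (\<Sum>x | \<pi> x = y \<and> u x \<noteq> 0. scale (w x) (u x))"

definition finite_fibres :: "('x \<Rightarrow> 'y) \<Rightarrow> ('x \<Rightarrow> 'l) \<Rightarrow> bool" where
  "finite_fibres \<pi> u \<longleftrightarrow> (\<forall>y. finite {x. \<pi> x = y \<and> u x \<noteq> 0})"

lemma pfinD: "finite_fibres \<pi> u \<Longrightarrow> finite {x. \<pi> x = y \<and> u x \<noteq> 0}"
  by (simp add: finite_fibres_def)

lemma finite_fibres_mono: "finite_fibres \<pi> u \<Longrightarrow> (\<And>x. u x = 0 \<Longrightarrow> u' x = 0) \<Longrightarrow> finite_fibres \<pi> u'"
  unfolding finite_fibres_def by (rule allI, rule finite_subset[where B = "{x. \<pi> x = y \<and> u x \<noteq> 0}" for y]) auto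

lemma push_eq:
  assumes "finite A" "{x. \<pi> x = y \<and> u x \<noteq> 0} \<subseteq> A" "A \<subseteq> {x. \<pi> x = y}"
  shows "push \<pi> w u y = (\<Sum>x\<in>A. scale (w x) (u x))"
  unfolding push_def by (rule sum.mono_neutral_left) (use assms in auto)

lemma push_add:
  assumes "finite_fibres \<pi> u" "finite_fibres \<pi> u'"
  shows "push \<pi> w (\<lambda>x. u x + u' x) y = push \<pi> w u y + push \<pi> w u' y"
proof -
  let ?A = "{x. \<pi> x = y \<and> u x \<noteq> 0} \<union> {x. \<pi> x = y \<and> u' x \<noteq> 0}"
  have "finite ?A" using assms by (simp add: finite_fibres_def)
  then have "push \<pi> w h y = (\<Sum>x\<in>?A. scale (w x) (h x))" if "h \<in> {u, u', \<lambda>x. u x + u' x}" for h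
    by (rule push_eq) (use that in auto)
  then show ?thesis
    by (simp add: scale_right_distrib sum.distrib)
qed

lemma push_lin:
  assumes "finite_fibres \<pi> u" "lin T"
  shows "push \<pi> w (\<lambda>x. T (u x)) y = T (push \<pi> w u y)"
proof -
  let ?A = "{x. \<pi> x = y \<and> u x \<noteq> 0}"
  have "finite ?A" using assms(1) by (rule pfinD)
  then have "push \<pi> w (\<lambda>x. T (u x)) y = (\<Sum>x\<in>?A. scale (w x) (T (u x)))"
    by (rule push_eq) (auto simp: lin_0[OF assms(2)])
  then show ?thesis
    by (simp add: push_def lin_sum[OF assms(2)] lin_scale[OF assms(2)])
qed

lemma lin_scale_fun: "lin (scale c)"
  by (rule linI) (simp_all add: scale_right_distrib mult.commute)

lemma push_scale: "finite_fibres \<pi> u \<Longrightarrow> push \<pi> w (\<lambda>x. scale c (u x)) y = scale c (push \<pi> w u y)"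
  using push_lin[OF _ lin_scale_fun] .

lemma push_zero: "push \<pi> w (\<lambda>x. 0) y = 0"
  by (simp add: push_def)

text \<open>\<open>\<sigma>\<close> matches the fibre over \<open>y\<close> with the fibre over
  \<open>\<sigma>' y\<close>, and the weights of matched terms differ by the constant factor
  \<open>\<kappa>\<close>.\<close>

lemma push_shift:
  assumes "bij \<sigma>" "inj \<sigma>'" "\<And>x. \<pi> (\<sigma> x) = \<sigma>' (\<pi> x)" "\<And>x. w x = \<kappa> * w (\<sigma> x)"
  shows "push \<pi> w (\<lambda>x. u (\<sigma> x)) y = scale \<kappa> (push \<pi> w u (\<sigma>' y))"
proof -
  have *: "\<sigma> (inv \<sigma> x) = x" "inv \<sigma> (\<sigma> x) = x" for x
    using assms(1) by (simp_all add: bij_is_surj surj_f_inv_f bij_is_inj)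
  have "bij_betw \<sigma> {x. \<pi> x = y \<and> u (\<sigma> x) \<noteq> 0} {x. \<pi> x = \<sigma>' y \<and> u x \<noteq> 0}"
  proof (rule bij_betwI[where g = "inv \<sigma>"])
    show "inv \<sigma> \<in> {x. \<pi> x = \<sigma>' y \<and> u x \<noteq> 0} \<rightarrow> {x. \<pi> x = y \<and> u (\<sigma> x) \<noteq> 0}"
    proof (intro Pi_I CollectI)
      fix x assume "x \<in> {x. \<pi> x = \<sigma>' y \<and> u x \<noteq> 0}"
      then have "\<sigma>' (\<pi> (inv \<sigma> x)) = \<sigma>' y" "u x \<noteq> 0"
        using assms(3)[of "inv \<sigma> x"] * by auto
      then show "\<pi> (inv \<sigma> x) = y \<and> u (\<sigma> (inv \<sigma> x)) \<noteq> 0"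
        using assms(2) * by (auto dest: injD)
    qed
    show "\<sigma> \<in> {x. \<pi> x = y \<and> u (\<sigma> x) \<noteq> 0} \<rightarrow> {x. \<pi> x = \<sigma>' y \<and> u x \<noteq> 0}"
      using assms(3) by auto
  qed (use * in auto)
  then have "(\<Sum>x | \<pi> x = y \<and> u (\<sigma> x) \<noteq> 0. scale (w (\<sigma> x)) (u (\<sigma> x))) = push \<pi> w u (\<sigma>' y)"
    unfolding push_def by (rule sum.reindex_bij_betw)
  from this[symmetric] show ?thesis
    unfolding push_def[of \<pi> w "\<lambda>x. u (\<sigma> x)"]
    by (subst assms(4)) (simp only: scale_sum_right scale_scale[symmetric])
qed

lemma finite_fibres_add: "finite_fibres \<pi> u \<Longrightarrow> finite_fibres \<pi> u' \<Longrightarrow> finite_fibres \<pi> (\<lambda>x. u x + u' x)"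
  unfolding finite_fibres_def
proof
  fix y assume "\<forall>y. finite {x. \<pi> x = y \<and> u x \<noteq> 0}" "\<forall>y. finite {x. \<pi> x = y \<and> u' x \<noteq> 0}"
  then have "finite ({x. \<pi> x = y \<and> u x \<noteq> 0} \<union> {x. \<pi> x = y \<and> u' x \<noteq> 0})"
    by simp
  then show "finite {x. \<pi> x = y \<and> u x + u' x \<noteq> 0}"
    by (rule rev_finite_subset) auto
qed

lemma finite_fibres_shift:
  assumes "inj \<sigma>" "\<And>x. \<pi> (\<sigma> x) = \<sigma>' (\<pi> x)" "finite_fibres \<pi> u"
  shows "finite_fibres \<pi> (\<lambda>x. u (\<sigma> x))"
  unfolding finite_fibres_def
proof
  fix y
  have "\<sigma> ` {x. \<pi> x = y \<and> u (\<sigma> x) \<noteq> 0} \<subseteq> {x. \<pi> x = \<sigma>' y \<and> u x \<noteq> 0}"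
    using assms(2) by auto
  then have "finite (\<sigma> ` {x. \<pi> x = y \<and> u (\<sigma> x) \<noteq> 0})"
    by (rule finite_subset) (rule pfinD[OF assms(3)])
  then show "finite {x. \<pi> x = y \<and> u (\<sigma> x) \<noteq> 0}"
    by (rule finite_imageD) (use assms(1) in \<open>auto simp: inj_on_def\<close>)
qed

lemma finite_fibres_poly_act:
  assumes "inj \<sigma>" "\<And>x. \<pi> (\<sigma> x) = \<sigma>' (\<pi> x)" "finite_fibres \<pi> u"
  shows "finite_fibres \<pi> (poly_act f \<sigma> u)"
proof (induction f)
  case 0
  then show ?case by (simp add: finite_fibres_def)
next
  case (pCons c f)
  have "finite_fibres \<pi> (\<lambda>x. scale c (u x) + poly_act f \<sigma> u (\<sigma> x))"
    by (intro finite_fibres_add finite_fibres_shift[OF assms(1), of \<pi> \<sigma>'] assms(2) pCons finite_fibres_mono[OF assms(3)]) auto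
  then show ?case
    by (rule finite_fibres_mono) (simp add: poly_act_pCons)
qed

text \<open>The substitution sends the monomial belonging to \<open>\<sigma>\<close> to
  \<open>\<kappa>\<close> times the one belonging to \<open>\<sigma>'\<close>, so f(x) becomes
  f(\<kappa> x).\<close>

lemma push_poly_act:
  assumes "bij \<sigma>" "inj \<sigma>'" "\<And>x. \<pi> (\<sigma> x) = \<sigma>' (\<pi> x)" "\<And>x. w x = \<kappa> * w (\<sigma> x)" "finite_fibres \<pi> u"
  shows "push \<pi> w (poly_act f \<sigma> u) = poly_act (pcompose f [:0, \<kappa>:]) \<sigma>' (push \<pi> w u)"
proof (induction f)
  case 0
  then show ?case by (simp add: fun_eq_iff push_def)
next
  case (pCons c f)
  have inj: "inj \<sigma>" using assms(1) by (rule bij_is_inj)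
  have "poly_act (pCons c f) \<sigma> u = (\<lambda>x. scale c (u x) + poly_act f \<sigma> u (\<sigma> x))"
    by (simp add: fun_eq_iff poly_act_pCons)
  moreover have "push \<pi> w (\<lambda>x. scale c (u x) + poly_act f \<sigma> u (\<sigma> x)) y =
      scale c (push \<pi> w u y) + scale \<kappa> (push \<pi> w (poly_act f \<sigma> u) (\<sigma>' y))" for y
  proof -
    have *: "finite_fibres \<pi> (\<lambda>x. scale c (u x))" "finite_fibres \<pi> (\<lambda>x. poly_act f \<sigma> u (\<sigma> x))"
      using finite_fibres_mono[OF assms(5)] finite_fibres_shift[OF inj, of \<pi> \<sigma>', OF assms(3) finite_fibres_poly_act[OF inj, of \<pi> \<sigma>', OF assms(3,5)]] by auto
    show ?thesis
      by (simp only: push_add[OF *] push_scale[OF assms(5)] push_shift[OF assms(1,2), of \<pi> w \<kappa>, OF assms(3,4)])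
  qed
  ultimately show ?case
    using pCons.IH
    by (simp add: fun_eq_iff pcompose_pCons poly_act_add_poly poly_act_smult_poly poly_act_pCons)
qed

text \<open>A Fubini argument: the support in a fibre of the composite is finite and is split
  according to the intermediate exponent.\<close>

lemma push_push:
  assumes "finite_fibres (\<pi>2 \<circ> \<pi>1) u"
  shows "push \<pi>2 w2 (push \<pi>1 w1 u) z = push (\<pi>2 \<circ> \<pi>1) (\<lambda>x. w2 (\<pi>1 x) * w1 x) u z"
proof -
  let ?A = "{x. \<pi>2 (\<pi>1 x) = z \<and> u x \<noteq> 0}"
  have fin: "finite ?A" using pfinD[OF assms, of z] by simp
  have "push (\<pi>2 \<circ> \<pi>1) (\<lambda>x. w2 (\<pi>1 x) * w1 x) u z = (\<Sum>x\<in>?A. scale (w2 (\<pi>1 x) * w1 x) (u x))"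
    by (simp add: push_def)
  also have "\<dots> = (\<Sum>y\<in>\<pi>1 ` ?A. \<Sum>x\<in>{x\<in>?A. \<pi>1 x = y}. scale (w2 (\<pi>1 x) * w1 x) (u x))"
    by (rule sum.image_gen[OF fin])
  also have "\<dots> = (\<Sum>y\<in>\<pi>1 ` ?A. scale (w2 y) (push \<pi>1 w1 u y))"
  proof (rule sum.cong[OF refl])
    fix y assume "y \<in> \<pi>1 ` ?A"
    then have "{x\<in>?A. \<pi>1 x = y} = {x. \<pi>1 x = y \<and> u x \<noteq> 0}" by auto
    then show "(\<Sum>x\<in>{x\<in>?A. \<pi>1 x = y}. scale (w2 (\<pi>1 x) * w1 x) (u x)) = scale (w2 y) (push \<pi>1 w1 u y)"
      by (simp add: push_def scale_sum_right)
  qed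
  also have "\<dots> = push \<pi>2 w2 (push \<pi>1 w1 u) z"
  proof (rule push_eq[symmetric])
    show "{y. \<pi>2 y = z \<and> push \<pi>1 w1 u y \<noteq> 0} \<subseteq> \<pi>1 ` ?A"
    proof clarify
      fix y assume "z = \<pi>2 y" "push \<pi>1 w1 u y \<noteq> 0"
      then obtain x where "\<pi>1 x = y" "u x \<noteq> 0"
        unfolding push_def by (auto elim!: sum.not_neutral_contains_not_neutral)
      then show "y \<in> \<pi>1 ` {x. \<pi>2 (\<pi>1 x) = \<pi>2 y \<and> u x \<noteq> 0}" by auto
    qed
  qed (use fin in auto)
  finally show ?thesis by simp
qed

lemma push_slice:
  assumes "inj \<iota>" "\<And>x. \<pi> x = y \<longleftrightarrow> x \<in> \<iota> ` {z. \<rho> z = y'}"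
  shows "push \<pi> w u y = push \<rho> (\<lambda>z. w (\<iota> z)) (\<lambda>z. u (\<iota> z)) y'"
proof -
  have "{x. \<pi> x = y \<and> u x \<noteq> 0} = \<iota> ` {z. \<rho> z = y' \<and> u (\<iota> z) \<noteq> 0}"
    using assms(2) by auto
  then show ?thesis
    unfolding push_def by (simp add: sum.reindex inj_on_subset[OF assms(1)])
qed

lemma finite_slice:
  assumes "\<And>x. \<pi> x = y \<longleftrightarrow> x \<in> \<iota> ` {z. \<rho> z = y'}" "finite_fibres \<rho> (\<lambda>z. u (\<iota> z))"
  shows "finite {x. \<pi> x = y \<and> u x \<noteq> 0}"
proof -
  have "{x. \<pi> x = y \<and> u x \<noteq> 0} = \<iota> ` {z. \<rho> z = y' \<and> u (\<iota> z) \<noteq> 0}"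
    using assms(1) by auto
  then show ?thesis
    using pfinD[OF assms(2)] by simp
qed

end

section \<open>Regularised products of two fields\<close>

text \<open>\<open>Q\<close> is kept abstract. As it is not a root of unity, the q-integers of
  positive numbers are invertible, which the divided q-derivatives require.\<close>

locale q_calculus = distribution_calculus scale
  for scale :: "'f::field \<Rightarrow> 'l::ab_group_add \<Rightarrow> 'l" +
  fixes Q :: 'f
  assumes Q_nonzero: "Q \<noteq> 0"
    and Q_power: "0 < n \<Longrightarrow> Q ^ n \<noteq> 1"
begin

lemma poly_dilation: "poly (pcompose f [:0, c:]) x = poly f (c * x)"
  by (simp add: poly_pcompose mult.commute)

text \<open>Multiplication by \<open>z\<^sub>2 / z\<^sub>1\<close>.\<close>

definition shift :: "int \<times> int \<Rightarrow> int \<times> int" where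
  "shift = (\<lambda>(i, j). (i + 1, j - 1))"

lemma shift_power: "(shift ^^ e) (i, j) = (i + int e, j - int e)"
  by (induction e) (simp_all add: shift_def)

lemma bij_shift: "bij shift"
  by (rule o_bij[where g = "\<lambda>(i, j). (i - 1, j + 1)"]) (auto simp: shift_def fun_eq_iff)

lemma inj_shift: "inj shift"
  using bij_shift by (rule bij_is_inj)

definition prod2 :: "'l distr \<Rightarrow> 'l distr \<Rightarrow> 'l \<Rightarrow> int \<times> int \<Rightarrow> 'l" where
  "prod2 a b v = (\<lambda>(i, j). a i (b j v))"

text \<open>Membership in L((z_1, z_2)) for a series already applied to one vector; the bound may
  depend on that vector.\<close>

definition regular2 :: "(int \<times> int \<Rightarrow> 'l) \<Rightarrow> bool" where
  "regular2 u \<longleftrightarrow> (\<exists>N. \<forall>i j. u (i, j) \<noteq> 0 \<longrightarrow> N \<le> i \<and> N \<le> j)"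

abbreviation add2 :: "int \<times> int \<Rightarrow> int" where
  "add2 \<equiv> \<lambda>(i, j). i + j"

text \<open>The coefficients of u(z, c z).\<close>

definition ev :: "'f \<Rightarrow> (int \<times> int \<Rightarrow> 'l) \<Rightarrow> int \<Rightarrow> 'l" where
  "ev c u = push add2 (\<lambda>(i, j). c powi j) u"

lemma reg2I: "(\<And>i j. u (i, j) \<noteq> 0 \<Longrightarrow> N \<le> i \<and> N \<le> j) \<Longrightarrow> regular2 u"
  by (auto simp: regular2_def)

lemma regular2_mono: "regular2 u \<Longrightarrow> (\<And>x. u x = 0 \<Longrightarrow> u' x = 0) \<Longrightarrow> regular2 u'"
  unfolding regular2_def by blast

lemma regular2_add: "regular2 u \<Longrightarrow> regular2 u' \<Longrightarrow> regular2 (\<lambda>x. u x + u' x)"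
proof -
  assume "regular2 u" "regular2 u'"
  then obtain N N' where
    "\<And>i j. u (i, j) \<noteq> 0 \<Longrightarrow> N \<le> i \<and> N \<le> j" "\<And>i j. u' (i, j) \<noteq> 0 \<Longrightarrow> N' \<le> i \<and> N' \<le> j"
    unfolding regular2_def by blast
  then have "min N N' \<le> i \<and> min N N' \<le> j" if "u (i, j) + u' (i, j) \<noteq> 0" for i j
    using that by (cases "u (i, j) = 0") (force+)
  then show ?thesis by (rule reg2I)
qed

lemma regular2_poly_act:
  assumes "regular2 u"
  shows "regular2 (poly_act g shift u)"
proof -
  obtain N where N: "\<And>i j. u (i, j) \<noteq> 0 \<Longrightarrow> N \<le> i \<and> N \<le> j"
    using assms unfolding regular2_def by blast
  show ?thesis
  proof (rule reg2I)
    fix i j assume "poly_act g shift u (i, j) \<noteq> 0"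
    then obtain e where "e \<le> degree g" "u (i + int e, j - int e) \<noteq> 0"
      unfolding poly_act_def shift_power by (auto elim!: sum.not_neutral_contains_not_neutral)
    then show "N - int (degree g) \<le> i \<and> N - int (degree g) \<le> j"
      using N[of "i + int e" "j - int e"] by auto
  qed
qed

lemma regular2_finite_fibres:
  assumes "regular2 u"
  shows "finite_fibres add2 u"
proof -
  obtain N where N: "\<And>i j. u (i, j) \<noteq> 0 \<Longrightarrow> N \<le> i \<and> N \<le> j"
    using assms unfolding regular2_def by blast
  have "{x. add2 x = y \<and> u x \<noteq> 0} \<subseteq> (\<lambda>i. (i, y - i)) ` {N..y - N}" for y
    using N by (auto simp: image_iff)
  then show ?thesis
    unfolding finite_fibres_def using finite_subset by blast
qed

text \<open>The ratio z_2/z_1 becomes the constant c, so \<open>g\<close> leaves as a scalar. This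
  makes a regularised value independent of the polynomial used to compute it.\<close>

lemma ev_poly_act:
  assumes "regular2 u" "c \<noteq> 0"
  shows "ev c (poly_act g shift u) k = scale (poly g c) (ev c u k)"
proof -
  have "ev c (poly_act g shift u) = poly_act (pcompose g [:0, c:]) id (ev c u)"
    unfolding ev_def
    by (rule push_poly_act[OF bij_shift])
       (use assms in \<open>auto simp: shift_def regular2_finite_fibres power_int_diff\<close>)
  then show ?thesis
    by (simp add: poly_act_id poly_dilation)
qed

lemma ev_add: "regular2 u \<Longrightarrow> regular2 u' \<Longrightarrow> ev c (\<lambda>x. u x + u' x) k = ev c u k + ev c u' k"
  unfolding ev_def by (intro push_add regular2_finite_fibres)

lemma ev_scale: "regular2 u \<Longrightarrow> ev c (\<lambda>x. scale d (u x)) k = scale d (ev c u k)"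
  unfolding ev_def by (intro push_scale regular2_finite_fibres)

text \<open>The distribution \<open>e(z)\<close> is the regularised value of \<open>a(z) b(z Q\<^sup>n)\<close>, computed with \<open>f(w / z)\<close>.\<close>

definition is_reg_val_with :: "'f poly \<Rightarrow> nat \<Rightarrow> 'l distr \<Rightarrow> 'l distr \<Rightarrow> 'l distr \<Rightarrow> bool" where
  "is_reg_val_with f n a b e \<longleftrightarrow> poly f (Q ^ n) \<noteq> 0 \<and> (\<forall>v. regular2 (poly_act f shift (prod2 a b v))) \<and>
     (\<forall>k v. ev (Q ^ n) (poly_act f shift (prod2 a b v)) k = scale (poly f (Q ^ n)) (e k v))"

definition is_reg_val :: "nat \<Rightarrow> 'l distr \<Rightarrow> 'l distr \<Rightarrow> 'l distr \<Rightarrow> bool" where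
  "is_reg_val n a b e \<longleftrightarrow> (\<exists>f. is_reg_val_with f n a b e)"

lemma is_reg_val_with_is_reg_val: "is_reg_val_with f n a b e \<Longrightarrow> is_reg_val n a b e"
  by (auto simp: is_reg_val_def)

lemma is_reg_val_with_exists:
  assumes "poly f (Q ^ n) \<noteq> 0" "\<And>v. regular2 (poly_act f shift (prod2 a b v))"
  shows "is_reg_val_with f n a b (\<lambda>k v. scale (1 / poly f (Q ^ n)) (ev (Q ^ n) (poly_act f shift (prod2 a b v)) k))"
  using assms by (simp add: is_reg_val_with_def)

text \<open>The factor \<open>h\<close> enters the series and the normalisation alike. Any two
  values can therefore be computed with a common polynomial, which gives uniqueness and
  additivity.\<close>

lemma is_reg_val_with_mult:
  assumes "is_reg_val_with f n a b e" "poly h (Q ^ n) \<noteq> 0"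
  shows "is_reg_val_with (h * f) n a b e"
  using assms Q_nonzero unfolding is_reg_val_with_def
  by (auto simp: poly_act_mult ev_poly_act regular2_poly_act simp flip: scale_scale)

lemma is_reg_val_common:
  assumes "is_reg_val n a b e" "is_reg_val n a' b' e'"
  obtains f where "is_reg_val_with f n a b e" "is_reg_val_with f n a' b' e'"
proof -
  obtain f f' where f: "is_reg_val_with f n a b e" "is_reg_val_with f' n a' b' e'"
    using assms by (auto simp: is_reg_val_def)
  have "is_reg_val_with (f' * f) n a b e" "is_reg_val_with (f * f') n a' b' e'"
    using f by (auto intro!: is_reg_val_with_mult) (auto simp: is_reg_val_with_def)
  then show ?thesis
    using that by (simp add: mult.commute)
qed

lemma is_reg_val_unique:
  assumes "is_reg_val n a b e" "is_reg_val n a b e'"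
  shows "e = e'"
proof -
  obtain f where "is_reg_val_with f n a b e" "is_reg_val_with f n a b e'"
    using is_reg_val_common assms by blast
  then have "poly f (Q ^ n) \<noteq> 0" "scale (poly f (Q ^ n)) (e k v) = scale (poly f (Q ^ n)) (e' k v)" for k v
    unfolding is_reg_val_with_def by metis+
  then show ?thesis by (simp add: fun_eq_iff)
qed

text \<open>Unspecified when no regularised value exists; the relation \<open>is_reg_val\<close>
  serves wherever existence is not yet available.\<close>

definition reg_val :: "nat \<Rightarrow> 'l distr \<Rightarrow> 'l distr \<Rightarrow> 'l distr" where
  "reg_val n a b = (THE e. is_reg_val n a b e)"

lemma reg_val_eq: "is_reg_val n a b e \<Longrightarrow> reg_val n a b = e"
  unfolding reg_val_def using is_reg_val_unique by blast

section \<open>Regularised values under sums, multiplication by 1/z and dilation\<close>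

abbreviation flds :: "'l distr set" where
  "flds \<equiv> fields scale"

lemma flds_lin: "a \<in> flds \<Longrightarrow> lin (a k)"
  by (simp add: fields_def)

lemma fldsD: "a \<in> flds \<Longrightarrow> \<exists>N. \<forall>k<N. a k v = 0"
  unfolding fields_def by blast

lemmas flds_add = lin_add[OF flds_lin]
  and flds_scale = lin_scale[OF flds_lin]
  and flds_0 = lin_0[OF flds_lin]
  and flds_sum = lin_sum[OF flds_lin]

definition dscale :: "'f \<Rightarrow> 'l distr \<Rightarrow> 'l distr" where
  "dscale c a = (\<lambda>k v. scale c (a k v))"

text \<open>The hypothesis on \<open>prod2\<close> lets one lemma serve additivity in the left and
  in the right argument.\<close>

lemma is_reg_val_combine:
  assumes "is_reg_val n a1 b1 e1" "is_reg_val n a2 b2 e2"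
    and "\<And>x v. prod2 a b v x = prod2 a1 b1 v x + prod2 a2 b2 v x"
  shows "is_reg_val n a b (\<lambda>k v. e1 k v + e2 k v)"
proof -
  obtain f where f: "is_reg_val_with f n a1 b1 e1" "is_reg_val_with f n a2 b2 e2"
    using is_reg_val_common assms(1,2) by blast
  have *: "poly_act f shift (prod2 a b v) =
      (\<lambda>x. poly_act f shift (prod2 a1 b1 v) x + poly_act f shift (prod2 a2 b2 v) x)" for v
    using assms(3) by (simp add: fun_eq_iff poly_act_def scale_right_distrib sum.distrib)
  have "is_reg_val_with f n a b (\<lambda>k v. e1 k v + e2 k v)"
    using f unfolding is_reg_val_with_def * by (auto simp: regular2_add ev_add scale_right_distrib)
  then show ?thesis by (rule is_reg_val_with_is_reg_val)
qed

lemma is_reg_val_scale: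
  assumes "is_reg_val n a1 b1 e1" "\<And>x v. prod2 a b v x = scale c (prod2 a1 b1 v x)"
  shows "is_reg_val n a b (dscale c e1)"
proof -
  obtain f where f: "is_reg_val_with f n a1 b1 e1"
    using assms(1) by (auto simp: is_reg_val_def)
  have *: "poly_act f shift (prod2 a b v) = (\<lambda>x. scale c (poly_act f shift (prod2 a1 b1 v) x))" for v
    using assms(2) by (simp add: fun_eq_iff poly_act_def scale_sum_right mult.commute)
  have "regular2 (\<lambda>x. scale c (poly_act f shift (prod2 a1 b1 v) x))" for v
    by (rule regular2_mono[of "poly_act f shift (prod2 a1 b1 v)"]) (use f in \<open>auto simp: is_reg_val_with_def\<close>)
  then have "is_reg_val_with f n a b (dscale c e1)"
    using f unfolding is_reg_val_with_def *
    by (auto simp: ev_scale dscale_def mult.commute)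
  then show ?thesis by (rule is_reg_val_with_is_reg_val)
qed

lemma is_reg_val_add_left: "is_reg_val n a b e \<Longrightarrow> is_reg_val n a' b e' \<Longrightarrow> is_reg_val n (a + a') b (e + e')"
  by (simp add: plus_fun_def, rule is_reg_val_combine[of n a b e a' b e']) (auto simp: prod2_def)

lemma is_reg_val_add_right:
  "a \<in> flds \<Longrightarrow> is_reg_val n a b e \<Longrightarrow> is_reg_val n a b' e' \<Longrightarrow> is_reg_val n a (b + b') (e + e')"
  by (simp add: plus_fun_def, rule is_reg_val_combine[of n a b e a b' e']) (auto simp: prod2_def flds_add)

lemma is_reg_val_scale_left: "is_reg_val n a b e \<Longrightarrow> is_reg_val n (dscale c a) b (dscale c e)"
  by (erule is_reg_val_scale) (auto simp: prod2_def dscale_def)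

lemma is_reg_val_scale_right: "a \<in> flds \<Longrightarrow> is_reg_val n a b e \<Longrightarrow> is_reg_val n a (dscale c b) (dscale c e)"
  by (erule is_reg_val_scale) (auto simp: prod2_def dscale_def flds_scale)

lemma is_reg_val_fields:
  assumes "a \<in> flds" "b \<in> flds" "is_reg_val n a b e"
  shows "e \<in> flds"
proof -
  obtain f where f: "is_reg_val_with f n a b e"
    using assms(3) by (auto simp: is_reg_val_def)
  let ?c = "poly f (Q ^ n)"
  have c: "?c \<noteq> 0" and reg: "\<And>v. regular2 (poly_act f shift (prod2 a b v))"
    and e: "\<And>k v. scale ?c (e k v) = ev (Q ^ n) (poly_act f shift (prod2 a b v)) k"
    using f by (auto simp: is_reg_val_with_def)
  have add: "poly_act f shift (prod2 a b (x + y)) =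
      (\<lambda>z. poly_act f shift (prod2 a b x) z + poly_act f shift (prod2 a b y) z)" for x y
    using assms(1,2)
    by (simp add: fun_eq_iff poly_act_def scale_right_distrib sum.distrib prod2_def flds_add shift_power)
  have scl: "poly_act f shift (prod2 a b (scale d x)) = (\<lambda>z. scale d (poly_act f shift (prod2 a b x) z))" for d x
    using assms(1,2)
    by (simp add: fun_eq_iff poly_act_def scale_sum_right prod2_def flds_scale shift_power mult.commute)
  have "lin (e k)" for k
  proof (rule linI)
    fix x y d
    have "scale ?c (e k (x + y)) = scale ?c (e k x + e k y)"
      by (simp add: e add scale_right_distrib ev_add reg)
    then show "e k (x + y) = e k x + e k y" by (rule scale_left_imp_eq[OF c])
    have "scale ?c (e k (scale d x)) = scale d (scale ?c (e k x))"
      by (simp add: e scl ev_scale reg del: scale_scale)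
    then have "scale ?c (e k (scale d x)) = scale ?c (scale d (e k x))"
      by (simp only: scale_left_commute)
    then show "e k (scale d x) = scale d (e k x)" by (rule scale_left_imp_eq[OF c])
  qed
  moreover have "\<exists>N. \<forall>k<N. e k v = 0" for v
  proof -
    obtain N where N: "\<And>i j. poly_act f shift (prod2 a b v) (i, j) \<noteq> 0 \<Longrightarrow> N \<le> i \<and> N \<le> j"
      using reg[of v] unfolding regular2_def by blast
    \<comment> \<open>Both exponents are at least N on the support, so their sum is at least
      2N.\<close>
    have "e k v = 0" if "k < 2 * N" for k
    proof -
      have "{x. add2 x = k \<and> poly_act f shift (prod2 a b v) x \<noteq> 0} = {}"
        using N that by fastforce
      then have "scale ?c (e k v) = 0"
        unfolding e ev_def push_def by (simp only: sum.empty)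
      then show ?thesis using c by simp
    qed
    then show ?thesis by blast
  qed
  ultimately show ?thesis by (simp add: fields_def)
qed

text \<open>Multiplication by 1/z. The q-derivative is a linear combination of
  \<open>zinv (dilate scale Q a)\<close> and \<open>zinv a\<close>, so these two operations are
  followed through all later constructions.\<close>

definition zinv :: "'l distr \<Rightarrow> 'l distr" where
  "zinv a = (\<lambda>k. a (k + 1))"

lemma is_reg_val_zinv_left:
  assumes "is_reg_val n a b e"
  shows "is_reg_val n (zinv a) b (zinv e)"
proof -
  obtain f where f: "is_reg_val_with f n a b e"
    using assms by (auto simp: is_reg_val_def)
  let ?t = "\<lambda>(i :: int, j :: int). (i + 1, j)"
  have *: "poly_act f shift (prod2 (zinv a) b v) = (\<lambda>x. poly_act f shift (prod2 a b v) (?t x))" for v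
    by (simp add: fun_eq_iff poly_act_def shift_power prod2_def zinv_def algebra_simps)
  have "regular2 (\<lambda>x. poly_act f shift (prod2 a b v) (?t x))" for v
  proof -
    obtain N where "\<And>i j. poly_act f shift (prod2 a b v) (i, j) \<noteq> 0 \<Longrightarrow> N \<le> i \<and> N \<le> j"
      using f unfolding is_reg_val_with_def regular2_def by blast
    then show ?thesis by (intro reg2I[of _ "N - 1"]) force
  qed
  moreover have "ev c (\<lambda>x. u (?t x)) k = ev c u (k + 1)" for c u k
  proof -
    have "push add2 (\<lambda>(i, j). c powi j) (\<lambda>x. u (?t x)) k
        = scale 1 (push add2 (\<lambda>(i, j). c powi j) u (k + 1))"
      by (rule push_shift, rule o_bij[where g = "\<lambda>(i, j). (i - 1, j)"]) (auto simp: fun_eq_iff)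
    then show ?thesis by (simp add: ev_def)
  qed
  ultimately have "is_reg_val_with f n (zinv a) b (zinv e)"
    using f unfolding is_reg_val_with_def * by (auto simp: zinv_def)
  then show ?thesis by (rule is_reg_val_with_is_reg_val)
qed

text \<open>The factor 1/z_2 is evaluated at z_2 = Q^n z, which leaves the scalar 1/Q^n.\<close>

lemma is_reg_val_zinv_right:
  assumes "is_reg_val n a b e"
  shows "is_reg_val n a (zinv b) (dscale (1 / Q ^ n) (zinv e))"
proof -
  obtain f where f: "is_reg_val_with f n a b e"
    using assms by (auto simp: is_reg_val_def)
  let ?t = "\<lambda>(i :: int, j :: int). (i, j + 1)"
  have *: "poly_act f shift (prod2 a (zinv b) v) = (\<lambda>x. poly_act f shift (prod2 a b v) (?t x))" for v
    by (simp add: fun_eq_iff poly_act_def shift_power prod2_def zinv_def algebra_simps)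
  have "regular2 (\<lambda>x. poly_act f shift (prod2 a b v) (?t x))" for v
  proof -
    obtain N where "\<And>i j. poly_act f shift (prod2 a b v) (i, j) \<noteq> 0 \<Longrightarrow> N \<le> i \<and> N \<le> j"
      using f unfolding is_reg_val_with_def regular2_def by blast
    then show ?thesis by (intro reg2I[of _ "N - 1"]) force
  qed
  moreover have "ev c (\<lambda>x. u (?t x)) k = scale (1 / c) (ev c u (k + 1))" if "c \<noteq> 0" for c u k
    unfolding ev_def
    by (rule push_shift, rule o_bij[where g = "\<lambda>(i, j). (i, j - 1)"])
       (use that in \<open>auto simp: fun_eq_iff power_int_add\<close>)
  ultimately have "is_reg_val_with f n a (zinv b) (dscale (1 / Q ^ n) (zinv e))"
    using f Q_nonzero unfolding is_reg_val_with_def * by (auto simp: zinv_def dscale_def mult.commute)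
  then show ?thesis by (rule is_reg_val_with_is_reg_val)
qed

text \<open>Rescaling coefficients is a substitution along the identity, so the general facts on
  \<open>push\<close> apply to dilations.\<close>

lemma push_id: "push id w u x = scale (w x) (u x)"
proof -
  have "push id w u x = (\<Sum>y\<in>{x}. scale (w y) (u y))"
    by (rule push_eq) auto
  then show ?thesis by simp
qed

lemma finite_fibres_id: "finite_fibres id u"
  by (auto simp: finite_fibres_def intro: finite_subset[of _ "{x}" for x])

text \<open>Dilating a variable multiplies the ratio z_2/z_1 by a constant, which the polynomial has
  to absorb.\<close>

lemma poly_act_weight:
  assumes "\<And>x. w x = \<kappa> * w (shift x)"
  shows "poly_act (pcompose f [:0, \<kappa>:]) shift (\<lambda>x. scale (w x) (u x)) = (\<lambda>x. scale (w x) (poly_act f shift u x))"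
  using push_poly_act[OF bij_shift inj_shift, of id w \<kappa> u f, OF _ assms finite_fibres_id]
  by (simp add: push_id[abs_def])

lemma ev_weight:
  assumes "regular2 u"
  shows "ev c (\<lambda>x. scale (w x) (u x)) k = push add2 (\<lambda>(i, j). c powi j * w (i, j)) u k"
proof -
  have "(\<lambda>x. scale (w x) (u x)) = push id w u"
    by (simp add: fun_eq_iff push_id)
  then have "ev c (\<lambda>x. scale (w x) (u x)) k = push add2 (\<lambda>(i, j). c powi j) (push id w u) k"
    by (simp add: ev_def)
  also have "\<dots> = push (add2 \<circ> id) (\<lambda>x. (case id x of (i, j) \<Rightarrow> c powi j) * w x) u k"
    by (rule push_push) (simp add: regular2_finite_fibres assms)
  finally show ?thesis
    by (simp add: case_prod_unfold)
qed

text \<open>a(Q z) b(Q^(n+1) z) is the value with index n taken at the point Q z. This is why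
  dilating a left factor raises the index by one.\<close>

lemma is_reg_val_dilate_left:
  assumes "is_reg_val n a b e"
  shows "is_reg_val (Suc n) (dilate scale Q a) b (dilate scale Q e)"
proof -
  obtain f where f: "is_reg_val_with f n a b e"
    using assms by (auto simp: is_reg_val_def)
  let ?w = "\<lambda>(i :: int, j :: int). Q powi i"
  let ?f = "pcompose f [:0, 1 / Q:]"
  have "prod2 (dilate scale Q a) b v = (\<lambda>x. scale (?w x) (prod2 a b v x))" for v
    by (simp add: fun_eq_iff prod2_def dilate_def)
  moreover have "poly_act ?f shift (\<lambda>x. scale (?w x) (u x)) = (\<lambda>x. scale (?w x) (poly_act f shift u x))" for u
    by (rule poly_act_weight) (use Q_nonzero in \<open>auto simp: shift_def power_int_add\<close>)
  ultimately have *: "poly_act ?f shift (prod2 (dilate scale Q a) b v) =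
      (\<lambda>x. scale (?w x) (poly_act f shift (prod2 a b v) x))" for v
    by simp
  have "regular2 (\<lambda>x. scale (?w x) (poly_act f shift (prod2 a b v) x))" for v
    by (rule regular2_mono[of "poly_act f shift (prod2 a b v)"]) (use f in \<open>auto simp: is_reg_val_with_def\<close>)
  moreover have "ev (Q ^ Suc n) (\<lambda>x. scale (?w x) (u x)) k = scale (Q powi k) (ev (Q ^ n) u k)"
    if "regular2 u" for u k
  proof -
    have "ev (Q ^ Suc n) (\<lambda>x. scale (?w x) (u x)) k
        = push add2 (\<lambda>(i, j). (Q ^ Suc n) powi j * ?w (i, j)) u k"
      by (rule ev_weight[OF that])
    also have "\<dots> = (\<Sum>x | add2 x = k \<and> u x \<noteq> 0.
        scale (Q powi k) (scale (case x of (i, j) \<Rightarrow> (Q ^ n) powi j) (u x)))"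
      unfolding push_def
      by (rule sum.cong)
         (use Q_nonzero in \<open>auto simp: power_int_mult_distrib power_int_add algebra_simps\<close>)
    finally show ?thesis
      by (simp add: ev_def push_def scale_sum_right)
  qed
  moreover have "poly ?f (Q ^ Suc n) = poly f (Q ^ n)"
    using Q_nonzero by (simp add: poly_dilation)
  ultimately have "is_reg_val_with ?f (Suc n) (dilate scale Q a) b (dilate scale Q e)"
    using f unfolding is_reg_val_with_def * by (auto simp: dilate_def mult.commute)
  then show ?thesis by (rule is_reg_val_with_is_reg_val)
qed

lemma is_reg_val_dilate_right:
  assumes "is_reg_val (Suc n) a b e" "a \<in> flds"
  shows "is_reg_val n a (dilate scale Q b) e"
proof -
  obtain f where f: "is_reg_val_with f (Suc n) a b e"
    using assms by (auto simp: is_reg_val_def)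
  let ?w = "\<lambda>(i :: int, j :: int). Q powi j"
  let ?f = "pcompose f [:0, Q:]"
  have "prod2 a (dilate scale Q b) v = (\<lambda>x. scale (?w x) (prod2 a b v x))" for v
    using assms(2) by (simp add: fun_eq_iff prod2_def dilate_def flds_scale)
  moreover have "poly_act ?f shift (\<lambda>x. scale (?w x) (u x)) = (\<lambda>x. scale (?w x) (poly_act f shift u x))" for u
    by (rule poly_act_weight) (use Q_nonzero in \<open>auto simp: shift_def power_int_diff\<close>)
  ultimately have *: "poly_act ?f shift (prod2 a (dilate scale Q b) v) =
      (\<lambda>x. scale (?w x) (poly_act f shift (prod2 a b v) x))" for v
    by simp
  have "regular2 (\<lambda>x. scale (?w x) (poly_act f shift (prod2 a b v) x))" for v
    by (rule regular2_mono[of "poly_act f shift (prod2 a b v)"]) (use f in \<open>auto simp: is_reg_val_with_def\<close>)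
  moreover have "ev (Q ^ n) (\<lambda>x. scale (?w x) (u x)) k = ev (Q ^ Suc n) u k"
    if "regular2 u" for u k
  proof -
    have "(\<lambda>(i, j). (Q ^ n) powi j * ?w (i, j)) = (\<lambda>(i :: int, j). (Q ^ Suc n) powi j)"
      by (auto simp: fun_eq_iff power_int_mult_distrib)
    then show ?thesis
      by (subst ev_weight[OF that]) (simp only: ev_def)
  qed
  moreover have "poly ?f (Q ^ n) = poly f (Q ^ Suc n)"
    by (simp add: poly_dilation)
  ultimately have "is_reg_val_with ?f n a (dilate scale Q b) e"
    using f unfolding is_reg_val_with_def * by auto
  then show ?thesis by (rule is_reg_val_with_is_reg_val)
qed

section \<open>Three variables: locality and associativity\<close>

text \<open>The three shifts encode multiplication by z_2/z_1, z_3/z_1 and z_3/z_2.\<close>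

definition shift12 :: "int \<times> int \<times> int \<Rightarrow> int \<times> int \<times> int" where
  "shift12 = (\<lambda>(i, j, l). (i + 1, j - 1, l))"

definition shift13 :: "int \<times> int \<times> int \<Rightarrow> int \<times> int \<times> int" where
  "shift13 = (\<lambda>(i, j, l). (i + 1, j, l - 1))"

definition shift23 :: "int \<times> int \<times> int \<Rightarrow> int \<times> int \<times> int" where
  "shift23 = (\<lambda>(i, j, l). (i, j + 1, l - 1))"

lemma bij_shift12: "bij shift12"
  by (rule o_bij[where g = "\<lambda>(i, j, l). (i - 1, j + 1, l)"]) (auto simp: shift12_def fun_eq_iff)

lemma bij_shift13: "bij shift13"
  by (rule o_bij[where g = "\<lambda>(i, j, l). (i - 1, j, l + 1)"]) (auto simp: shift13_def fun_eq_iff)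

lemma bij_shift23: "bij shift23"
  by (rule o_bij[where g = "\<lambda>(i, j, l). (i, j - 1, l + 1)"]) (auto simp: shift23_def fun_eq_iff)

lemma shift12_power: "(shift12 ^^ e) (i, j, l) = (i + int e, j - int e, l)"
  by (induction e) (simp_all add: shift12_def)

lemma shift13_power: "(shift13 ^^ e) (i, j, l) = (i + int e, j, l - int e)"
  by (induction e) (simp_all add: shift13_def)

lemma shift23_power: "(shift23 ^^ e) (i, j, l) = (i, j + int e, l - int e)"
  by (induction e) (simp_all add: shift23_def)

lemma poly_act_shift12: "poly_act f shift12 u (i, j, l) = poly_act f shift (\<lambda>(i, j). u (i, j, l)) (i, j)"
  by (simp add: poly_act_def shift12_power shift_power)

lemma poly_act_shift13: "poly_act f shift13 u (i, j, l) = poly_act f shift (\<lambda>(i, l). u (i, j, l)) (i, l)"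
  by (simp add: poly_act_def shift13_power shift_power)

lemma poly_act_shift23: "poly_act f shift23 u (i, j, l) = poly_act f shift (\<lambda>(j, l). u (i, j, l)) (j, l)"
  by (simp add: poly_act_def shift23_power shift_power)

lemma commute_12_13: "poly_act f shift12 (poly_act g shift13 u) = poly_act g shift13 (poly_act f shift12 u)"
  by (rule poly_act_commute) (auto simp: shift12_def shift13_def)

lemma commute_12_23: "poly_act f shift12 (poly_act g shift23 u) = poly_act g shift23 (poly_act f shift12 u)"
  by (rule poly_act_commute) (auto simp: shift12_def shift23_def)

lemma commute_13_23: "poly_act f shift13 (poly_act g shift23 u) = poly_act g shift23 (poly_act f shift13 u)"
  by (rule poly_act_commute) (auto simp: shift13_def shift23_def)

lemma poly_act_lin: "lin T \<Longrightarrow> poly_act f \<sigma> (\<lambda>x. T (u x)) x = T (poly_act f \<sigma> u x)"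
  by (simp add: poly_act_def lin_sum lin_scale)

text \<open>With \<open>\<chi>\<close> a coordinate of the exponent, this is the bound in one
  variable. The coordinates are separated because each is bounded by a different reordering of the
  same product.\<close>

definition bounded_along :: "('x \<Rightarrow> int) \<Rightarrow> ('x \<Rightarrow> 'l) \<Rightarrow> bool" where
  "bounded_along \<chi> u \<longleftrightarrow> (\<exists>N. \<forall>x. u x \<noteq> 0 \<longrightarrow> N \<le> \<chi> x)"

text \<open>Each application of \<open>\<sigma>\<close> moves the coordinate by \<open>d\<close>, so
  the bound drops by at most the degree times the absolute value of \<open>d\<close>.\<close>

lemma bounded_along_poly_act:
  assumes "bounded_along \<chi> u" "\<And>x. \<chi> (\<sigma> x) = \<chi> x + d"
  shows "bounded_along \<chi> (poly_act f \<sigma> u)"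
proof -
  obtain N where N: "\<And>x. u x \<noteq> 0 \<Longrightarrow> N \<le> \<chi> x"
    using assms(1) by (auto simp: bounded_along_def)
  have chi: "\<chi> ((\<sigma> ^^ e) x) = \<chi> x + int e * d" for e x
    by (induction e) (simp_all add: assms(2) algebra_simps)
  have "N - int (degree f) * \<bar>d\<bar> \<le> \<chi> x" if nz: "poly_act f \<sigma> u x \<noteq> 0" for x
  proof -
    obtain e where e: "e \<le> degree f" "u ((\<sigma> ^^ e) x) \<noteq> 0"
      using nz unfolding poly_act_def by (auto elim!: sum.not_neutral_contains_not_neutral)
    have "int e * d \<le> int (degree f) * \<bar>d\<bar>"
      by (rule order_trans[of _ "int e * \<bar>d\<bar>"]) (use e(1) in \<open>auto intro: mult_left_mono mult_right_mono\<close>)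
    with N[OF e(2)] chi[of e x] show ?thesis by simp
  qed
  then show ?thesis
    unfolding bounded_along_def by blast
qed

lemma regular2_bounded: "regular2 u \<longleftrightarrow> bounded_along fst u \<and> bounded_along snd u"
  unfolding regular2_def bounded_along_def by simp (meson min.coboundedI1 min.coboundedI2)

definition regular3 :: "(int \<times> int \<times> int \<Rightarrow> 'l) \<Rightarrow> bool" where
  "regular3 u \<longleftrightarrow> bounded_along fst u \<and> bounded_along (fst \<circ> snd) u \<and> bounded_along (snd \<circ> snd) u"

lemma reg3D:
  assumes "regular3 u"
  shows "\<exists>N. \<forall>i j l. u (i, j, l) \<noteq> 0 \<longrightarrow> N \<le> i \<and> N \<le> j \<and> N \<le> l"
proof -
  obtain N1 N2 N3 where
    "\<And>x. u x \<noteq> 0 \<Longrightarrow> N1 \<le> fst x"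
    "\<And>x. u x \<noteq> 0 \<Longrightarrow> N2 \<le> (fst \<circ> snd) x"
    "\<And>x. u x \<noteq> 0 \<Longrightarrow> N3 \<le> (snd \<circ> snd) x"
    using assms unfolding regular3_def bounded_along_def by blast
  then have N: "N1 \<le> i" "N2 \<le> j" "N3 \<le> l" if "u (i, j, l) \<noteq> 0" for i j l
    using that by fastforce+
  then have "min N1 (min N2 N3) \<le> i \<and> min N1 (min N2 N3) \<le> j \<and> min N1 (min N2 N3) \<le> l"
    if "u (i, j, l) \<noteq> 0" for i j l
    using N[OF that] by linarith
  then show ?thesis by blast
qed

lemma regular3_poly_act:
  assumes "regular3 u"
  shows "regular3 (poly_act f shift12 u)" "regular3 (poly_act f shift13 u)" "regular3 (poly_act f shift23 u)"
  using assms unfolding regular3_def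
  by (auto intro: bounded_along_poly_act[where d = 1] bounded_along_poly_act[where d = 0]
      bounded_along_poly_act[where d = "-1"] simp: shift12_def shift13_def shift23_def split: prod.splits)

text \<open>The substitution z_2 = c z_1, which leaves a series in z_1 and z_3;
  \<open>merge23\<close> is z_3 = c z_2.\<close>

definition merge12 :: "'f \<Rightarrow> (int \<times> int \<times> int \<Rightarrow> 'l) \<Rightarrow> int \<times> int \<Rightarrow> 'l" where
  "merge12 c u = push (\<lambda>(i, j, l). (i + j, l)) (\<lambda>(i, j, l). c powi j) u"

definition merge23 :: "'f \<Rightarrow> (int \<times> int \<times> int \<Rightarrow> 'l) \<Rightarrow> int \<times> int \<Rightarrow> 'l" where
  "merge23 c u = push (\<lambda>(i, j, l). (i, j + l)) (\<lambda>(i, j, l). c powi l) u"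

abbreviation finite12 :: "(int \<times> int \<times> int \<Rightarrow> 'l) \<Rightarrow> bool" where
  "finite12 u \<equiv> finite_fibres (\<lambda>(i, j, l). (i + j, l)) u"

abbreviation finite23 :: "(int \<times> int \<times> int \<Rightarrow> 'l) \<Rightarrow> bool" where
  "finite23 u \<equiv> finite_fibres (\<lambda>(i, j, l). (i, j + l)) u"

lemma merge12_slice: "merge12 c u (k, l) = ev c (\<lambda>(i, j). u (i, j, l)) k"
proof -
  have "merge12 c u (k, l) = push add2 (\<lambda>z. case (fst z, snd z, l) of (i, j, l) \<Rightarrow> c powi j)
      (\<lambda>z. u (fst z, snd z, l)) k"
    unfolding merge12_def by (rule push_slice) (auto simp: inj_on_def image_iff)
  then show ?thesis by (simp add: ev_def case_prod_unfold)
qed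

lemma merge23_slice: "merge23 c u (i, k) = ev c (\<lambda>(j, l). u (i, j, l)) k"
proof -
  have "merge23 c u (i, k) = push add2 (\<lambda>z. case (i, fst z, snd z) of (i, j, l) \<Rightarrow> c powi l)
      (\<lambda>z. u (i, fst z, snd z)) k"
    unfolding merge23_def by (rule push_slice) (auto simp: inj_on_def image_iff)
  then show ?thesis by (simp add: ev_def case_prod_unfold)
qed

lemma fin12I:
  assumes "\<And>l. regular2 (\<lambda>(i, j). u (i, j, l))"
  shows "finite12 u"
  unfolding finite_fibres_def
proof
  fix y :: "int \<times> int"
  have "finite_fibres add2 (\<lambda>z. u (fst z, snd z, snd y))"
    using regular2_finite_fibres[OF assms[of "snd y"]] by (simp add: case_prod_unfold)
  then show "finite {x. (case x of (i, j, l) \<Rightarrow> (i + j, l)) = y \<and> u x \<noteq> 0}"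
    by (intro finite_slice[where \<rho> = add2 and y' = "fst y"])
       (auto simp: image_iff case_prod_unfold prod_eq_iff)
qed

lemma fin23I:
  assumes "\<And>i. regular2 (\<lambda>(j, l). u (i, j, l))"
  shows "finite23 u"
  unfolding finite_fibres_def
proof
  fix y :: "int \<times> int"
  have "finite_fibres add2 (\<lambda>z. u (fst y, fst z, snd z))"
    using regular2_finite_fibres[OF assms[of "fst y"]] by (simp add: case_prod_unfold)
  then show "finite {x. (case x of (i, j, l) \<Rightarrow> (i, j + l)) = y \<and> u x \<noteq> 0}"
    by (intro finite_slice[where \<rho> = add2 and y' = "snd y"])
       (auto simp: image_iff case_prod_unfold prod_eq_iff)
qed

text \<open>After z_2 = c z_1 the ratio z_3/z_2 is z_3/z_1 divided by c, whence g(x/c).\<close>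

lemma merge12_poly_act:
  assumes "finite12 U" "c \<noteq> 0"
  shows "merge12 c (poly_act f shift13 (poly_act g shift23 U)) = poly_act (f * pcompose g [:0, 1 / c:]) shift (merge12 c U)"
proof -
  have 1: "merge12 c (poly_act g shift23 U) = poly_act (pcompose g [:0, 1 / c:]) shift (merge12 c U)"
    unfolding merge12_def
    by (rule push_poly_act[OF bij_shift23 inj_shift])
       (use assms in \<open>auto simp: shift23_def shift_def power_int_add\<close>)
  have fin: "finite12 (poly_act g shift23 U)"
    by (rule finite_fibres_poly_act[OF bij_is_inj[OF bij_shift23], where \<sigma>' = shift])
       (use assms in \<open>auto simp: shift23_def shift_def\<close>)
  have "merge12 c (poly_act f shift13 (poly_act g shift23 U)) = poly_act (pcompose f [:0, 1:]) shift (merge12 c (poly_act g shift23 U))"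
    unfolding merge12_def
    by (rule push_poly_act[OF bij_shift13 inj_shift]) (use fin in \<open>auto simp: shift13_def shift_def\<close>)
  then show ?thesis
    by (simp add: 1 poly_act_mult)
qed

text \<open>After z_3 = c z_2 the ratio z_3/z_1 is c z_2/z_1, whence g(c x).\<close>

lemma merge23_poly_act:
  assumes "finite23 U" "c \<noteq> 0"
  shows "merge23 c (poly_act f shift12 (poly_act g shift13 U)) = poly_act (f * pcompose g [:0, c:]) shift (merge23 c U)"
proof -
  have 1: "merge23 c (poly_act g shift13 U) = poly_act (pcompose g [:0, c:]) shift (merge23 c U)"
    unfolding merge23_def
    by (rule push_poly_act[OF bij_shift13 inj_shift])
       (use assms in \<open>auto simp: shift13_def shift_def power_int_diff\<close>)
  have fin: "finite23 (poly_act g shift13 U)"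
    by (rule finite_fibres_poly_act[OF bij_is_inj[OF bij_shift13], where \<sigma>' = shift])
       (use assms in \<open>auto simp: shift13_def shift_def\<close>)
  have "merge23 c (poly_act f shift12 (poly_act g shift13 U)) = poly_act (pcompose f [:0, 1:]) shift (merge23 c (poly_act g shift13 U))"
    unfolding merge23_def
    by (rule push_poly_act[OF bij_shift12 inj_shift]) (use fin in \<open>auto simp: shift12_def shift_def\<close>)
  then show ?thesis
    by (simp add: 1 poly_act_mult)
qed

section \<open>Products of three fields and their evaluation\<close>

definition prod3 :: "'l distr \<Rightarrow> 'l distr \<Rightarrow> 'l distr \<Rightarrow> 'l \<Rightarrow> int \<times> int \<times> int \<Rightarrow> 'l" where
  "prod3 a b c v = (\<lambda>(i, j, l). a i (b j (c l v)))"

lemma poly_act_shift12_prod3: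
  "poly_act f shift12 (prod3 a b c v) (i, j, l) = poly_act f shift (prod2 a b (c l v)) (i, j)"
  by (simp add: poly_act_shift12 prod3_def prod2_def)

lemma poly_act_shift23_prod3:
  assumes "a \<in> flds"
  shows "poly_act f shift23 (prod3 a b c v) (i, j, l) = a i (poly_act f shift (prod2 b c v) (j, l))"
proof -
  have "poly_act f shift23 (prod3 a b c v) (i, j, l) = poly_act f shift (\<lambda>x. a i (prod2 b c v x)) (j, l)"
    by (simp add: poly_act_shift23 prod3_def prod2_def case_prod_unfold)
  then show ?thesis
    using poly_act_lin[OF flds_lin[OF assms]] by simp
qed

lemma merge12_prod3:
  assumes "is_reg_val_with f m a b e"
  shows "finite12 (poly_act f shift12 (prod3 a b c v))"
    and "merge12 (Q ^ m) (poly_act f shift12 (prod3 a b c v)) = (\<lambda>x. scale (poly f (Q ^ m)) (prod2 e c v x))"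
proof -
  have *: "(\<lambda>(i, j). poly_act f shift12 (prod3 a b c v) (i, j, l)) = poly_act f shift (prod2 a b (c l v))" for l
    by (auto simp: poly_act_shift12_prod3)
  show "finite12 (poly_act f shift12 (prod3 a b c v))"
    by (rule fin12I) (use assms in \<open>auto simp: * is_reg_val_with_def\<close>)
  show "merge12 (Q ^ m) (poly_act f shift12 (prod3 a b c v)) = (\<lambda>x. scale (poly f (Q ^ m)) (prod2 e c v x))"
    using assms by (auto simp: fun_eq_iff merge12_slice * is_reg_val_with_def prod2_def)
qed

text \<open>The merged sum lies inside the operator \<open>a i\<close> and is moved out by
  linearity; in \<open>merge12_prod3\<close> the third field merely supplies a vector.\<close>

lemma merge23_prod3:
  assumes "is_reg_val_with f m b c e" "a \<in> flds"
  shows "finite23 (poly_act f shift23 (prod3 a b c v))"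
    and "merge23 (Q ^ m) (poly_act f shift23 (prod3 a b c v)) = (\<lambda>x. scale (poly f (Q ^ m)) (prod2 a e v x))"
proof -
  have *: "(\<lambda>(j, l). poly_act f shift23 (prod3 a b c v) (i, j, l)) = (\<lambda>x. a i (poly_act f shift (prod2 b c v) x))" for i
    by (auto simp: poly_act_shift23_prod3[OF assms(2)])
  have reg: "regular2 (poly_act f shift (prod2 b c v))" for v
    using assms(1) by (simp add: is_reg_val_with_def)
  show "finite23 (poly_act f shift23 (prod3 a b c v))"
    by (rule fin23I, unfold *, rule regular2_mono[OF reg[of v]]) (simp add: flds_0[OF assms(2)])
  have "ev c (\<lambda>x. a i (poly_act f shift (prod2 b c' v) x)) k = a i (ev c (poly_act f shift (prod2 b c' v)) k)"
    if "regular2 (poly_act f shift (prod2 b c' v))" for c i k c'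
    unfolding ev_def by (rule push_lin[OF regular2_finite_fibres[OF that] flds_lin[OF assms(2)]])
  then show "merge23 (Q ^ m) (poly_act f shift23 (prod3 a b c v)) = (\<lambda>x. scale (poly f (Q ^ m)) (prod2 a e v x))"
    using assms by (auto simp: fun_eq_iff merge23_slice * is_reg_val_with_def prod2_def flds_scale)
qed

abbreviation add3 :: "int \<times> int \<times> int \<Rightarrow> int" where
  "add3 \<equiv> \<lambda>(i, j, l). i + j + l"

lemma regular3_finite_fibres:
  assumes "regular3 u"
  shows "finite_fibres add3 u"
proof -
  obtain N where N: "\<And>i j l. u (i, j, l) \<noteq> 0 \<Longrightarrow> N \<le> i \<and> N \<le> j \<and> N \<le> l"
    using reg3D[OF assms] by blast
  \<comment> \<open>Of three exponents with sum y, two are at least N each, which bounds the third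
    by y - 2N.\<close>
  have "{x. add3 x = y \<and> u x \<noteq> 0} \<subseteq> {N..y - 2 * N} \<times> {N..y - 2 * N} \<times> {N..y - 2 * N}" for y
    using N by fastforce
  then show ?thesis
    unfolding finite_fibres_def by (meson finite_subset finite_SigmaI finite_atLeastAtMost_int)
qed

lemma push_neq_0E:
  assumes "push \<pi> w u y \<noteq> 0"
  obtains x where "\<pi> x = y" "u x \<noteq> 0"
  using assms unfolding push_def by (auto elim!: sum.not_neutral_contains_not_neutral)

text \<open>Setting z_2 = c z_1 and then z_3 = d z_1 is a single substitution by
  \<open>push_push\<close>; regularity supplies the finiteness.\<close>

lemma regular3_merge12:
  assumes "regular3 u"
  shows "regular2 (merge12 c u)" "ev d (merge12 c u) k = push add3 (\<lambda>(i, j, l). c powi j * d powi l) u k"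
proof -
  obtain N where N: "\<And>i j l. u (i, j, l) \<noteq> 0 \<Longrightarrow> N \<le> i \<and> N \<le> j \<and> N \<le> l"
    using reg3D[OF assms] by blast
  show "regular2 (merge12 c u)"
  proof (rule reg2I)
    fix k l assume "merge12 c u (k, l) \<noteq> 0"
    then obtain i j where "i + j = k" "u (i, j, l) \<noteq> 0"
      unfolding merge12_def by (auto elim!: push_neq_0E)
    \<comment> \<open>The merged exponent has the bound 2N, the other one N; which is smaller
      depends on the sign of N.\<close>
    then show "min N (2 * N) \<le> k \<and> min N (2 * N) \<le> l"
      using N[of i j l] by auto
  qed
  have *: "add2 \<circ> (\<lambda>(i, j, l). (i + j, l)) = add3"
    by (auto simp: fun_eq_iff)
  show "ev d (merge12 c u) k = push add3 (\<lambda>(i, j, l). c powi j * d powi l) u k"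
    unfolding ev_def merge12_def
    by (subst push_push) (simp_all only: * regular3_finite_fibres[OF assms], simp add: case_prod_unfold mult.commute)
qed

text \<open>With z_3 = c z_2 and z_2 = d z_1 the third variable becomes c d z_1. Both orders of
  merging thus yield the same sum once the constants match.\<close>

lemma regular3_merge23:
  assumes "regular3 u" "d \<noteq> 0"
  shows "regular2 (merge23 c u)" "ev d (merge23 c u) k = push add3 (\<lambda>(i, j, l). d powi j * (c * d) powi l) u k"
proof -
  obtain N where N: "\<And>i j l. u (i, j, l) \<noteq> 0 \<Longrightarrow> N \<le> i \<and> N \<le> j \<and> N \<le> l"
    using reg3D[OF assms(1)] by blast
  show "regular2 (merge23 c u)"
  proof (rule reg2I)
    fix i k assume "merge23 c u (i, k) \<noteq> 0"
    then obtain j l where "j + l = k" "u (i, j, l) \<noteq> 0"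
      unfolding merge23_def by (auto elim!: push_neq_0E)
    then show "min N (2 * N) \<le> i \<and> min N (2 * N) \<le> k"
      using N[of i j l] by auto
  qed
  have *: "add2 \<circ> (\<lambda>(i, j, l). (i, j + l)) = add3"
    by (auto simp: fun_eq_iff)
  have "ev d (merge23 c u) k = push add3
      (\<lambda>x. (case (\<lambda>(i, j, l). (i, j + l)) x of (i, j) \<Rightarrow> d powi j) * (case x of (i, j, l) \<Rightarrow> c powi l)) u k"
    unfolding ev_def merge23_def
    by (subst push_push) (simp_all only: * regular3_finite_fibres[OF assms(1)])
  also have "\<dots> = push add3 (\<lambda>(i, j, l). d powi j * (c * d) powi l) u k"
  proof -
    have **: "(\<lambda>x. (case (\<lambda>(i, j, l). (i, j + l)) x of (i, j) \<Rightarrow> d powi j) * (case x of (i, j, l) \<Rightarrow> c powi l)) =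
        (\<lambda>(i :: int, j, l). d powi j * (c * d) powi l)"
      using assms(2) by (auto simp: fun_eq_iff power_int_add power_int_mult_distrib)
    show ?thesis by (simp only: **)
  qed
  finally show "ev d (merge23 c u) k = push add3 (\<lambda>(i, j, l). d powi j * (c * d) powi l) u k" .
qed

text \<open>That is, \<open>f(w / z) a(z) b(w) = g(w / z) b(w) a(z)\<close>.\<close>

definition local_via :: "'f poly \<Rightarrow> 'f poly \<Rightarrow> 'l distr \<Rightarrow> 'l distr \<Rightarrow> bool" where
  "local_via f g a b \<longleftrightarrow> (\<forall>v. poly_act f shift (prod2 a b v) = poly_act g shift (\<lambda>(i, j). b j (a i v)))"

lemma locD:
  "local_via f g a b \<Longrightarrow> poly_act f shift (\<lambda>(i, j). a i (b j v)) x = poly_act g shift (\<lambda>(i, j). b j (a i v)) x"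
  by (simp add: local_via_def prod2_def)

lemma local_via_12:
  assumes "local_via f g a b"
  shows "poly_act f shift12 (prod3 a b c v) = poly_act g shift12 (\<lambda>(i, j, l). b j (a i (c l v)))"
  using locD[OF assms] by (auto simp: fun_eq_iff poly_act_shift12 prod3_def)

lemma local_via_23:
  assumes "local_via f g b c" "a \<in> flds"
  shows "poly_act f shift23 (prod3 a b c v) = poly_act g shift23 (\<lambda>(i, j, l). a i (c l (b j v)))"
proof -
  have "poly_act f shift (\<lambda>x. a i (h x)) y = a i (poly_act f shift h y)" for f h i y
    by (rule poly_act_lin[OF flds_lin[OF assms(2)]])
  from this[of f _ "\<lambda>(j, l). b j (c l v)"] this[of g _ "\<lambda>(j, l). c l (b j v)"]
  show ?thesis
    using locD[OF assms(1)] by (auto simp: fun_eq_iff poly_act_shift23 prod3_def case_prod_unfold)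
qed

lemma local_via_13_right:
  assumes "local_via f g a c" "b \<in> flds"
  shows "poly_act f shift13 (\<lambda>(i, j, l). b j (a i (c l v))) = poly_act g shift13 (\<lambda>(i, j, l). b j (c l (a i v)))"
proof -
  have "poly_act f shift (\<lambda>x. b j (h x)) y = b j (poly_act f shift h y)" for f h j y
    by (rule poly_act_lin[OF flds_lin[OF assms(2)]])
  from this[of f _ "\<lambda>(i, l). a i (c l v)"] this[of g _ "\<lambda>(i, l). c l (a i v)"]
  show ?thesis
    using locD[OF assms(1)] by (auto simp: fun_eq_iff poly_act_shift13 case_prod_unfold)
qed

lemma local_via_13_left:
  assumes "local_via f g a c"
  shows "poly_act f shift13 (\<lambda>(i, j, l). a i (c l (b j v))) = poly_act g shift13 (\<lambda>(i, j, l). c l (a i (b j v)))"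
  using locD[OF assms] by (auto simp: fun_eq_iff poly_act_shift13)

lemma bounded_alongI: "(\<And>x. \<chi> x < N \<Longrightarrow> u x = 0) \<Longrightarrow> bounded_along \<chi> u"
  unfolding bounded_along_def by (metis not_less)

text \<open>The field that acts first on \<open>v\<close> has bounded exponents. The given order
  bounds those of \<open>b\<close>, the exchanged order those of \<open>a\<close>.\<close>

lemma regular2_local_via:
  assumes "local_via f g a b" "a \<in> flds" "b \<in> flds"
  shows "regular2 (poly_act f shift (prod2 a b v))"
  unfolding regular2_bounded
proof
  obtain N where "\<And>k. k < N \<Longrightarrow> a k v = 0" using fldsD[OF assms(2)] by blast
  then have "bounded_along fst (\<lambda>(i, j). b j (a i v))"
    by (intro bounded_alongI[where N = N]) (auto simp: flds_0[OF assms(3)])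
  moreover have "poly_act f shift (prod2 a b v) = poly_act g shift (\<lambda>(i, j). b j (a i v))"
    using assms(1) by (simp add: local_via_def)
  ultimately show "bounded_along fst (poly_act f shift (prod2 a b v))"
    by (auto intro!: bounded_along_poly_act[where d = 1] simp: shift_def)
next
  obtain N where "\<And>k. k < N \<Longrightarrow> b k v = 0" using fldsD[OF assms(3)] by blast
  then have "bounded_along snd (prod2 a b v)"
    by (intro bounded_alongI[where N = N]) (auto simp: prod2_def flds_0[OF assms(2)])
  then show "bounded_along snd (poly_act f shift (prod2 a b v))"
    by (rule bounded_along_poly_act[where d = "-1"]) (auto simp: shift_def)
qed

text \<open>Each coordinate is bounded in an order where its field acts first on \<open>v\<close>:
  the third in the given order, the second after exchanging \<open>b\<close> and \<open>c\<close>,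
  the first after moving \<open>a\<close> past both. Multiplying by polynomials preserves each
  bound.\<close>

lemma regular3_local_via:
  assumes "local_via f12 g12 a b" "local_via f13 g13 a c" "local_via f23 g23 b c"
    and flds: "a \<in> flds" "b \<in> flds" "c \<in> flds"
  shows "regular3 (poly_act f12 shift12 (poly_act f13 shift13 (poly_act f23 shift23 (prod3 a b c v))))"
proof -
  let ?G = "poly_act f12 shift12 (poly_act f13 shift13 (poly_act f23 shift23 (prod3 a b c v)))"
  let ?bca = "\<lambda>(i, j, l). b j (c l (a i v))" and ?acb = "\<lambda>(i, j, l). a i (c l (b j v))"
  have papp1: "bounded_along fst u \<Longrightarrow> bounded_along fst (poly_act f s u)"
    if "s \<in> {shift12, shift13, shift23}" for f s and u :: "int \<times> int \<times> int \<Rightarrow> 'l"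
    using that by (auto intro: bounded_along_poly_act[where d = 1] bounded_along_poly_act[where d = 0]
        simp: shift12_def shift13_def shift23_def split: prod.splits)
  have papp2: "bounded_along (fst \<circ> snd) u \<Longrightarrow> bounded_along (fst \<circ> snd) (poly_act f s u)"
    if "s \<in> {shift12, shift13, shift23}" for f s and u :: "int \<times> int \<times> int \<Rightarrow> 'l"
    using that by (auto intro: bounded_along_poly_act[where d = 1] bounded_along_poly_act[where d = 0]
        bounded_along_poly_act[where d = "-1"] simp: shift12_def shift13_def shift23_def split: prod.splits)
  have papp3: "bounded_along (snd \<circ> snd) u \<Longrightarrow> bounded_along (snd \<circ> snd) (poly_act f s u)"
    if "s \<in> {shift12, shift13, shift23}" for f s and u :: "int \<times> int \<times> int \<Rightarrow> 'l"
    using that by (auto intro: bounded_along_poly_act[where d = "-1"] bounded_along_poly_act[where d = 0]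
        simp: shift12_def shift13_def shift23_def split: prod.splits)
  have "?G = poly_act f23 shift23 (poly_act f13 shift13 (poly_act f12 shift12 (prod3 a b c v)))"
    by (simp only: commute_12_13 commute_12_23 commute_13_23)
  also have "\<dots> = poly_act f23 shift23 (poly_act g12 shift12 (poly_act f13 shift13 (\<lambda>(i, j, l). b j (a i (c l v)))))"
    by (simp only: local_via_12[OF assms(1)] commute_12_13)
  also have "\<dots> = poly_act f23 shift23 (poly_act g12 shift12 (poly_act g13 shift13 ?bca))"
    by (simp only: local_via_13_right[OF assms(2) flds(2)])
  finally have G1: "?G = \<dots>" .
  have G2: "?G = poly_act f12 shift12 (poly_act f13 shift13 (poly_act g23 shift23 ?acb))"
    by (simp only: local_via_23[OF assms(3) flds(1)])
  obtain N where "\<And>k. k < N \<Longrightarrow> a k v = 0" using fldsD[OF flds(1)] by blast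
  then have "bounded_along fst ?bca"
    by (intro bounded_alongI[where N = N]) (auto simp: flds_0[OF flds(2)] flds_0[OF flds(3)])
  then have 1: "bounded_along fst ?G"
    unfolding G1 by (intro papp1) auto
  obtain N where "\<And>k. k < N \<Longrightarrow> b k v = 0" using fldsD[OF flds(2)] by blast
  then have "bounded_along (fst \<circ> snd) ?acb"
    by (intro bounded_alongI[where N = N]) (auto simp: flds_0[OF flds(1)] flds_0[OF flds(3)])
  then have 2: "bounded_along (fst \<circ> snd) ?G"
    unfolding G2 by (intro papp2) auto
  obtain N where "\<And>k. k < N \<Longrightarrow> c k v = 0" using fldsD[OF flds(3)] by blast
  then have "bounded_along (snd \<circ> snd) (prod3 a b c v)"
    by (intro bounded_alongI[where N = N]) (auto simp: prod3_def flds_0[OF flds(1)] flds_0[OF flds(2)])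
  then have 3: "bounded_along (snd \<circ> snd) ?G"
    by (intro papp3) auto
  show ?thesis using 1 2 3 by (simp add: regular3_def)
qed

lemma poly_act_scale_fun: "poly_act f \<sigma> (\<lambda>x. scale c (u x)) = (\<lambda>x. scale c (poly_act f \<sigma> u x))"
  by (simp add: fun_eq_iff poly_act_scale)

text \<open>The identity is proved on three-variable series: all factors are moved past \<open>a(z)\<close>
  before the second and the third variable are identified.\<close>

lemma local_via_reg_val_right:
  assumes "local_via f1 g1 a b" "local_via f2 g2 a c" "is_reg_val_with p n b c e"
    and flds: "a \<in> flds" "b \<in> flds" "c \<in> flds"
  shows "local_via (f1 * pcompose f2 [:0, Q ^ n:]) (g1 * pcompose g2 [:0, Q ^ n:]) a e"
  unfolding local_via_def
proof
  fix v
  let ?c = "poly p (Q ^ n)"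
  have c: "?c \<noteq> 0" and Qn: "Q ^ n \<noteq> 0" using assms(3) Q_nonzero by (simp_all add: is_reg_val_with_def)
  let ?U = "poly_act p shift23 (prod3 a b c v)"
  let ?U' = "poly_act p shift23 (\<lambda>(i, j, l). b j (c l (a i v)))"
  have slice: "(\<lambda>(j, l). ?U' (i, j, l)) = poly_act p shift (prod2 b c (a i v))" for i
    by (auto simp: poly_act_shift23 prod2_def)
  have fin: "finite23 ?U'"
    by (rule fin23I, unfold slice) (use assms(3) in \<open>simp add: is_reg_val_with_def\<close>)
  have U': "merge23 (Q ^ n) ?U' = (\<lambda>x. scale ?c ((\<lambda>(i, k). e k (a i v)) x))"
    using assms(3) by (auto simp: fun_eq_iff merge23_slice slice is_reg_val_with_def)
  have "poly_act f1 shift12 (poly_act f2 shift13 ?U) = poly_act p shift23 (poly_act f2 shift13 (poly_act f1 shift12 (prod3 a b c v)))"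
    by (simp only: commute_12_13 commute_12_23 commute_13_23)
  also have "\<dots> = poly_act p shift23 (poly_act g1 shift12 (poly_act f2 shift13 (\<lambda>(i, j, l). b j (a i (c l v)))))"
    by (simp only: local_via_12[OF assms(1)] commute_12_13)
  also have "\<dots> = poly_act g1 shift12 (poly_act g2 shift13 ?U')"
    by (simp only: local_via_13_right[OF assms(2) flds(2)] commute_12_23 commute_13_23)
  finally have "merge23 (Q ^ n) (poly_act f1 shift12 (poly_act f2 shift13 ?U)) = merge23 (Q ^ n) (poly_act g1 shift12 (poly_act g2 shift13 ?U'))"
    by simp
  then have "poly_act (f1 * pcompose f2 [:0, Q ^ n:]) shift (\<lambda>x. scale ?c (prod2 a e v x)) =
      poly_act (g1 * pcompose g2 [:0, Q ^ n:]) shift (\<lambda>x. scale ?c ((\<lambda>(i, k). e k (a i v)) x))"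
    unfolding merge23_poly_act[OF merge23_prod3(1)[OF assms(3) flds(1)] Qn] merge23_poly_act[OF fin Qn]
      merge23_prod3(2)[OF assms(3) flds(1)] U' .
  then show "poly_act (f1 * pcompose f2 [:0, Q ^ n:]) shift (prod2 a e v) =
      poly_act (g1 * pcompose g2 [:0, Q ^ n:]) shift (\<lambda>(i, k). e k (a i v))"
    unfolding poly_act_scale_fun fun_eq_iff using c by simp
qed

text \<open>The mirror image: \<open>c\<close> is moved to the left past \<open>b\<close> and then
  \<open>a\<close> before the first two variables are identified. With z_2 = Q^n z_1 the ratio
  z_3/z_2 is z_3/z_1 divided by Q^n, which explains the argument of \<open>f2\<close> and
  \<open>g2\<close>.\<close>

lemma local_via_reg_val_left:
  assumes "local_via f1 g1 a c" "local_via f2 g2 b c" "is_reg_val_with p n a b e"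
    and flds: "a \<in> flds" "b \<in> flds" "c \<in> flds"
  shows "local_via (f1 * pcompose f2 [:0, 1 / Q ^ n:]) (g1 * pcompose g2 [:0, 1 / Q ^ n:]) e c"
  unfolding local_via_def
proof
  fix v
  let ?c = "poly p (Q ^ n)"
  have c: "?c \<noteq> 0" and Qn: "Q ^ n \<noteq> 0" using assms(3) Q_nonzero by (simp_all add: is_reg_val_with_def)
  let ?U = "poly_act p shift12 (prod3 a b c v)"
  let ?U' = "poly_act p shift12 (\<lambda>(i, j, l). c l (a i (b j v)))"
  have slice: "(\<lambda>(i, j). ?U' (i, j, l)) = (\<lambda>x. c l (poly_act p shift (prod2 a b v) x))" for l
  proof -
    have "?U' (i, j, l) = poly_act p shift (\<lambda>x. c l (prod2 a b v x)) (i, j)" for i j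
      by (simp add: poly_act_shift12 prod2_def case_prod_unfold)
    then show ?thesis
      by (auto simp: poly_act_lin[OF flds_lin[OF flds(3)]])
  qed
  have reg: "regular2 (poly_act p shift (prod2 a b v))"
    using assms(3) by (simp add: is_reg_val_with_def)
  have fin: "finite12 ?U'"
    by (rule fin12I, unfold slice, rule regular2_mono[OF reg]) (simp add: flds_0[OF flds(3)])
  have "ev d (\<lambda>x. c l (poly_act p shift (prod2 a b v) x)) k = c l (ev d (poly_act p shift (prod2 a b v)) k)" for d l k
    unfolding ev_def by (rule push_lin[OF regular2_finite_fibres[OF reg] flds_lin[OF flds(3)]])
  then have U': "merge12 (Q ^ n) ?U' = (\<lambda>x. scale ?c ((\<lambda>(k, l). c l (e k v)) x))"
    using assms(3) by (auto simp: fun_eq_iff merge12_slice slice is_reg_val_with_def flds_scale[OF flds(3)])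
  have "poly_act f1 shift13 (poly_act f2 shift23 ?U) = poly_act p shift12 (poly_act f1 shift13 (poly_act f2 shift23 (prod3 a b c v)))"
    by (simp only: commute_12_13 commute_12_23)
  also have "\<dots> = poly_act p shift12 (poly_act g2 shift23 (poly_act f1 shift13 (\<lambda>(i, j, l). a i (c l (b j v)))))"
    by (simp only: local_via_23[OF assms(2) flds(1)] commute_13_23)
  also have "\<dots> = poly_act g1 shift13 (poly_act g2 shift23 ?U')"
    by (simp only: local_via_13_left[OF assms(1)] commute_12_13 commute_12_23 commute_13_23)
  finally have "merge12 (Q ^ n) (poly_act f1 shift13 (poly_act f2 shift23 ?U)) = merge12 (Q ^ n) (poly_act g1 shift13 (poly_act g2 shift23 ?U'))"
    by simp
  then have "poly_act (f1 * pcompose f2 [:0, 1 / Q ^ n:]) shift (\<lambda>x. scale ?c (prod2 e c v x)) =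
      poly_act (g1 * pcompose g2 [:0, 1 / Q ^ n:]) shift (\<lambda>x. scale ?c ((\<lambda>(k, l). c l (e k v)) x))"
    unfolding merge12_poly_act[OF merge12_prod3(1)[OF assms(3)] Qn] merge12_poly_act[OF fin Qn]
      merge12_prod3(2)[OF assms(3)] U' .
  then show "poly_act (f1 * pcompose f2 [:0, 1 / Q ^ n:]) shift (prod2 e c v) =
      poly_act (g1 * pcompose g2 [:0, 1 / Q ^ n:]) shift (\<lambda>(k, l). c l (e k v))"
    unfolding poly_act_scale_fun fun_eq_iff using c by simp
qed

section \<open>Associativity of regularised values\<close>

definition regularizes3 :: "'f poly \<Rightarrow> 'f poly \<Rightarrow> 'f poly \<Rightarrow> 'l distr \<Rightarrow> 'l distr \<Rightarrow> 'l distr \<Rightarrow> bool" where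
  "regularizes3 f12 f13 f23 a b c \<longleftrightarrow>
     (\<forall>v. regular3 (poly_act f12 shift12 (poly_act f13 shift13 (poly_act f23 shift23 (prod3 a b c v)))))"

lemma regular2_unscale: "regular2 (\<lambda>x. scale c (u x)) \<Longrightarrow> c \<noteq> 0 \<Longrightarrow> regular2 u"
  by (erule regular2_mono) simp

text \<open>Both nestings evaluate one triple series, multiplied by all three polynomials and
  regular in all variables. For such a series the order of identifying variables is irrelevant; what
  has to be compared are the scalars removed at each stage.\<close>

lemma is_reg_val_assoc:
  assumes f12: "is_reg_val_with f12 m a b e" and f23: "is_reg_val_with f23 n b c e'"
    and reg: "regularizes3 f12 f13 f23 a b c" and f13: "poly f13 (Q ^ (m + n)) \<noteq> 0"
    and a: "a \<in> flds"
  obtains h where "is_reg_val (m + n) e c h" "is_reg_val m a e' h"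
proof -
  let ?G = "\<lambda>v. poly_act f12 shift12 (poly_act f13 shift13 (poly_act f23 shift23 (prod3 a b c v)))"
  let ?c12 = "poly f12 (Q ^ m)" and ?c13 = "poly f13 (Q ^ (m + n))" and ?c23 = "poly f23 (Q ^ n)"
  have G: "regular3 (?G v)" for v using reg by (simp add: regularizes3_def)
  have c: "?c12 \<noteq> 0" "?c23 \<noteq> 0" and Qn: "Q ^ k \<noteq> 0" for k
    using f12 f23 Q_nonzero by (simp_all add: is_reg_val_with_def)
  \<comment> \<open>The regular triple series at (z, Q^m z, Q^(m+n) z).\<close>
  define T where "T v k = push add3 (\<lambda>(i, j, l). (Q ^ m) powi j * (Q ^ (m + n)) powi l) (?G v) k" for v k
  define h where "h k v = scale (1 / (?c12 * ?c13 * ?c23)) (T v k)" for k v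
  \<comment> \<open>What is left of the factors after z_2 = Q^m z_1. At z_3 = Q^(m+n) z_1 its value
    is f13(Q^(m+n)) f23(Q^n).\<close>
  let ?h1 = "f13 * pcompose f23 [:0, 1 / Q ^ m:]"
  have "?G v = poly_act f13 shift13 (poly_act f23 shift23 (poly_act f12 shift12 (prod3 a b c v)))" for v
    by (simp only: commute_12_13 commute_12_23)
  then have 1: "merge12 (Q ^ m) (?G v) = (\<lambda>x. scale ?c12 (poly_act ?h1 shift (prod2 e c v) x))" for v
    by (simp only: merge12_poly_act[OF merge12_prod3(1)[OF f12] Qn] merge12_prod3(2)[OF f12] poly_act_scale_fun)
  have reg1: "regular2 (poly_act ?h1 shift (prod2 e c v))" for v
    using regular3_merge12(1)[OF G, of "Q ^ m" v] c(1) unfolding 1 by (rule regular2_unscale)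
  have T: "scale ?c12 (ev (Q ^ (m + n)) (poly_act ?h1 shift (prod2 e c v)) k) = T v k" for v k
    unfolding ev_scale[OF reg1, symmetric] T_def 1[symmetric] by (rule regular3_merge12(2)[OF G])
  then have T1: "ev (Q ^ (m + n)) (poly_act ?h1 shift (prod2 e c v)) k = scale (1 / ?c12) (T v k)" for v k
    using c(1) by (simp flip: T)
  have "poly ?h1 (Q ^ (m + n)) = ?c13 * ?c23"
    using Q_nonzero by (simp add: poly_dilation power_add)
  then have "is_reg_val_with ?h1 (m + n) e c h"
    using c f13 reg1 by (simp add: is_reg_val_with_def T1 h_def)
  then have first: "is_reg_val (m + n) e c h" by (rule is_reg_val_with_is_reg_val)
  \<comment> \<open>Likewise after z_3 = Q^n z_2; at z_2 = Q^m z_1 the value is f12(Q^m)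
    f13(Q^(m+n)).\<close>
  let ?h2 = "f12 * pcompose f13 [:0, Q ^ n:]"
  have 2: "merge23 (Q ^ n) (?G v) = (\<lambda>x. scale ?c23 (poly_act ?h2 shift (prod2 a e' v) x))" for v
    by (simp only: merge23_poly_act[OF merge23_prod3(1)[OF f23 a] Qn] merge23_prod3(2)[OF f23 a] poly_act_scale_fun)
  have regular2: "regular2 (poly_act ?h2 shift (prod2 a e' v))" for v
    using regular3_merge23(1)[OF G Qn, of "Q ^ n" v] c(2) unfolding 2 by (rule regular2_unscale)
  have T': "scale ?c23 (ev (Q ^ m) (poly_act ?h2 shift (prod2 a e' v)) k) = T v k" for v k
    unfolding ev_scale[OF regular2, symmetric] T_def 2[symmetric]
    using regular3_merge23(2)[OF G Qn, of m "Q ^ n"] by (simp add: power_add mult.commute)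
  then have T2: "ev (Q ^ m) (poly_act ?h2 shift (prod2 a e' v)) k = scale (1 / ?c23) (T v k)" for v k
    using c(2) by (simp flip: T')
  have "poly ?h2 (Q ^ m) = ?c12 * ?c13"
    by (simp add: poly_dilation power_add mult.commute)
  then have "is_reg_val_with ?h2 m a e' h"
    using c f13 regular2 by (simp add: is_reg_val_with_def T2 h_def)
  then have "is_reg_val m a e' h" by (rule is_reg_val_with_is_reg_val)
  with first show ?thesis by (rule that)
qed

section \<open>Weighted spaces of fields\<close>

lemma dscale_apply [simp]: "dscale c a k v = scale c (a k v)"
  by (simp add: dscale_def)

sublocale distr: vector_space dscale
  by unfold_locales (simp_all add: fun_eq_iff scale_right_distrib scale_left_distrib)

lemma fldsI: "(\<And>k. lin (a k)) \<Longrightarrow> (\<And>v. \<exists>N. \<forall>k<N. a k v = 0) \<Longrightarrow> a \<in> flds"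
  by (simp add: fields_def)

lemma fields_zero: "0 \<in> flds"
  by (rule fldsI) (auto intro: linI)

lemma fields_add: "a \<in> flds \<Longrightarrow> b \<in> flds \<Longrightarrow> a + b \<in> flds"
proof (rule fldsI)
  fix v assume "a \<in> flds" "b \<in> flds"
  then obtain N N' where "\<forall>k<N. a k v = 0" "\<forall>k<N'. b k v = 0"
    using fldsD by meson
  then have "\<forall>k<min N N'. (a + b) k v = 0" by simp
  then show "\<exists>N. \<forall>k<N. (a + b) k v = 0" by blast
qed (auto intro!: linI simp: flds_add flds_scale scale_right_distrib algebra_simps)

lemma fields_dscale: "a \<in> flds \<Longrightarrow> dscale c a \<in> flds"
  using fldsD[of a]
  by (intro fldsI) (auto intro!: linI simp: flds_add flds_scale scale_right_distrib mult.commute, metis scale_zero_right)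

lemma fields_zinv: "a \<in> flds \<Longrightarrow> zinv a \<in> flds"
proof (rule fldsI)
  fix v assume "a \<in> flds"
  then obtain N where "\<forall>k<N. a k v = 0" using fldsD by blast
  then have "\<forall>k<N - 1. zinv a k v = 0" by (simp add: zinv_def)
  then show "\<exists>N. \<forall>k<N. zinv a k v = 0" by blast
qed (auto simp: zinv_def flds_lin)

lemma fields_dilate: "a \<in> flds \<Longrightarrow> dilate scale c a \<in> flds"
  using fldsD[of a]
  by (intro fldsI) (auto intro!: linI simp: dilate_def flds_add flds_scale scale_right_distrib mult.commute, metis scale_zero_right)

definition one :: "'l distr" where
  "one = (\<lambda>k v. if k = 0 then v else 0)"

lemma fields_one: "one \<in> flds"
  by (rule fldsI) (auto simp: one_def intro!: linI)

text \<open>A field of weight m is a left factor only in values with index n \<ge> m, so these are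
  the powers of Q at which a division takes place.\<close>

definition nonvanishing_from :: "nat \<Rightarrow> 'f poly \<Rightarrow> bool" where
  "nonvanishing_from m f \<longleftrightarrow> (\<forall>n\<ge>m. poly f (Q ^ n) \<noteq> 0)"

lemma goodD: "nonvanishing_from m f \<Longrightarrow> m \<le> n \<Longrightarrow> poly f (Q ^ n) \<noteq> 0"
  by (simp add: nonvanishing_from_def)

lemma nonvanishing_from_one: "nonvanishing_from m 1"
  by (simp add: nonvanishing_from_def)

lemma nonvanishing_from_mult: "nonvanishing_from m f \<Longrightarrow> nonvanishing_from m g \<Longrightarrow> nonvanishing_from m (f * g)"
  by (simp add: nonvanishing_from_def)

lemma nonvanishing_from_mono: "nonvanishing_from m f \<Longrightarrow> m \<le> n \<Longrightarrow> nonvanishing_from n f"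
  by (simp add: nonvanishing_from_def)

lemma nonvanishing_from_up: "nonvanishing_from m f \<Longrightarrow> nonvanishing_from m (pcompose f [:0, Q ^ n:])"
  by (simp add: nonvanishing_from_def poly_dilation flip: power_add)

text \<open>At Q^k the new polynomial is f(Q^(k-n)): the roots move up by n powers of Q, at the
  price of n in the weight.\<close>

lemma nonvanishing_from_down: "nonvanishing_from m f \<Longrightarrow> nonvanishing_from (n + m) (pcompose f [:0, 1 / Q ^ n:])"
  unfolding nonvanishing_from_def
proof (intro allI impI)
  fix k assume *: "\<forall>n\<ge>m. poly f (Q ^ n) \<noteq> 0" "n + m \<le> k"
  then have "1 / Q ^ n * Q ^ k = Q ^ (k - n)"
    using Q_nonzero by (simp add: power_diff)
  then show "poly (pcompose f [:0, 1 / Q ^ n:]) (Q ^ k) \<noteq> 0"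
    using * by (simp add: poly_dilation)
qed

text \<open>One-sided: \<open>f\<close> belongs to the order in which \<open>a\<close> is the left
  factor, and \<open>g\<close> may vanish at powers of Q.\<close>

definition local_from :: "nat \<Rightarrow> 'l distr \<Rightarrow> 'l distr \<Rightarrow> bool" where
  "local_from m a b \<longleftrightarrow> (\<exists>f g. nonvanishing_from m f \<and> local_via f g a b)"

section \<open>Inheritance of locality\<close>

lemma poly_act_translate:
  assumes "\<And>x. t (shift x) = shift (t x)"
  shows "poly_act f shift (\<lambda>x. u (t x)) = (\<lambda>x. poly_act f shift u (t x))"
proof -
  have "(shift ^^ e) (t x) = t ((shift ^^ e) x)" for e x
    by (induction e) (simp_all add: assms)
  then show ?thesis by (simp add: poly_act_def fun_eq_iff)
qed

lemma local_from_mono: "local_from m a b \<Longrightarrow> m \<le> n \<Longrightarrow> local_from n a b"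
  unfolding local_from_def using nonvanishing_from_mono by blast

lemma local_from_zinv_left: "local_from m a b \<Longrightarrow> local_from m (zinv a) b"
proof -
  assume "local_from m a b"
  then obtain f g where fg: "nonvanishing_from m f" "local_via f g a b" by (auto simp: local_from_def)
  let ?t = "\<lambda>(i :: int, j :: int). (i + 1, j)"
  have "poly_act f shift (\<lambda>x. u (?t x)) = (\<lambda>x. poly_act f shift u (?t x))" for f u
    by (rule poly_act_translate) (auto simp: shift_def)
  moreover have "prod2 (zinv a) b v = (\<lambda>x. prod2 a b v (?t x))"
    "(\<lambda>(i, j). b j (zinv a i v)) = (\<lambda>x. (\<lambda>(i, j). b j (a i v)) (?t x))" for v
    by (auto simp: prod2_def zinv_def)
  ultimately have "local_via f g (zinv a) b"
    using fg(2) by (simp add: local_via_def)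
  with fg(1) show ?thesis by (auto simp: local_from_def)
qed

lemma local_from_zinv_right: "local_from m a b \<Longrightarrow> local_from m a (zinv b)"
proof -
  assume "local_from m a b"
  then obtain f g where fg: "nonvanishing_from m f" "local_via f g a b" by (auto simp: local_from_def)
  let ?t = "\<lambda>(i :: int, j :: int). (i, j + 1)"
  have "poly_act f shift (\<lambda>x. u (?t x)) = (\<lambda>x. poly_act f shift u (?t x))" for f u
    by (rule poly_act_translate) (auto simp: shift_def)
  moreover have "prod2 a (zinv b) v = (\<lambda>x. prod2 a b v (?t x))"
    "(\<lambda>(i, j). zinv b j (a i v)) = (\<lambda>x. (\<lambda>(i, j). b j (a i v)) (?t x))" for v
    by (auto simp: prod2_def zinv_def)
  ultimately have "local_via f g a (zinv b)"
    using fg(2) by (simp add: local_via_def)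
  with fg(1) show ?thesis by (auto simp: local_from_def)
qed

text \<open>Replacing z by Q z divides w/z by Q and pushes the roots of \<open>f\<close> up by one
  power of Q. For a dilation of the second argument they move down instead, and the weight
  stays.\<close>

lemma local_from_dilate_left:
  assumes "local_from m a b" "b \<in> flds"
  shows "local_from (Suc m) (dilate scale Q a) b"
proof -
  obtain f g where fg: "nonvanishing_from m f" "local_via f g a b" using assms by (auto simp: local_from_def)
  let ?w = "\<lambda>(i :: int, j :: int). Q powi i"
  have "poly_act (pcompose f [:0, 1 / Q:]) shift (\<lambda>x. scale (?w x) (u x)) =
      (\<lambda>x. scale (?w x) (poly_act f shift u x))" for f u
    by (rule poly_act_weight) (use Q_nonzero in \<open>auto simp: shift_def power_int_add\<close>)
  moreover have "prod2 (dilate scale Q a) b v = (\<lambda>x. scale (?w x) (prod2 a b v x))"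
    "(\<lambda>(i, j). b j (dilate scale Q a i v)) = (\<lambda>x. scale (?w x) ((\<lambda>(i, j). b j (a i v)) x))" for v
    using assms(2) by (auto simp: prod2_def dilate_def flds_scale)
  ultimately have "local_via (pcompose f [:0, 1 / Q:]) (pcompose g [:0, 1 / Q:]) (dilate scale Q a) b"
    using fg(2) by (simp add: local_via_def)
  with nonvanishing_from_down[OF fg(1), of 1] show ?thesis by (auto simp: local_from_def)
qed

lemma local_from_dilate_right:
  assumes "local_from m a b" "a \<in> flds"
  shows "local_from m a (dilate scale Q b)"
proof -
  obtain f g where fg: "nonvanishing_from m f" "local_via f g a b" using assms by (auto simp: local_from_def)
  let ?w = "\<lambda>(i :: int, j :: int). Q powi j"
  have "poly_act (pcompose f [:0, Q:]) shift (\<lambda>x. scale (?w x) (u x)) =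
      (\<lambda>x. scale (?w x) (poly_act f shift u x))" for f u
    by (rule poly_act_weight) (use Q_nonzero in \<open>auto simp: shift_def power_int_diff\<close>)
  moreover have "prod2 a (dilate scale Q b) v = (\<lambda>x. scale (?w x) (prod2 a b v x))"
    "(\<lambda>(i, j). dilate scale Q b j (a i v)) = (\<lambda>x. scale (?w x) ((\<lambda>(i, j). b j (a i v)) x))" for v
    using assms(2) by (auto simp: prod2_def dilate_def flds_scale)
  ultimately have "local_via (pcompose f [:0, Q:]) (pcompose g [:0, Q:]) a (dilate scale Q b)"
    using fg(2) by (simp add: local_via_def)
  with nonvanishing_from_up[OF fg(1), of 1] show ?thesis by (auto simp: local_from_def)
qed

lemma local_from_one:
  assumes "a \<in> flds"
  shows "local_from m a one" "local_from m one a"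
proof -
  have "local_via 1 1 a one" "local_via 1 1 one a"
    using assms by (auto simp: local_via_def prod2_def one_def fun_eq_iff flds_0)
  then show "local_from m a one" "local_from m one a"
    unfolding local_from_def using nonvanishing_from_one by blast+
qed

lemma local_from_reg_val_right:
  assumes "local_from m a b" "local_from m a c" "is_reg_val n b c e" "a \<in> flds" "b \<in> flds" "c \<in> flds"
  shows "local_from m a e"
proof -
  obtain f1 g1 f2 g2 p where *: "nonvanishing_from m f1" "local_via f1 g1 a b" "nonvanishing_from m f2" "local_via f2 g2 a c" "is_reg_val_with p n b c e"
    using assms by (auto simp: local_from_def is_reg_val_def)
  then show ?thesis
    using local_via_reg_val_right[OF *(2,4,5) assms(4-6)] nonvanishing_from_mult[OF *(1) nonvanishing_from_up[OF *(3)]]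
    by (auto simp: local_from_def)
qed

text \<open>The roots of \<open>f2\<close> are pushed up by Q^n and are avoided from n + k on; those
  of \<open>f1\<close> are avoided because m \<le> n. The weight \<open>n + k\<close> is the power
  of t that the product will carry.\<close>

lemma local_from_reg_val_left:
  assumes "local_from m a c" "local_from k b c" "is_reg_val n a b e" "m \<le> n" "a \<in> flds" "b \<in> flds" "c \<in> flds"
  shows "local_from (n + k) e c"
proof -
  obtain f1 g1 f2 g2 p where *: "nonvanishing_from m f1" "local_via f1 g1 a c" "nonvanishing_from k f2" "local_via f2 g2 b c" "is_reg_val_with p n a b e"
    using assms by (auto simp: local_from_def is_reg_val_def)
  have "nonvanishing_from (n + k) f1" by (rule nonvanishing_from_mono[OF *(1)]) (use assms(4) in simp)
  then show ?thesis
    using local_via_reg_val_left[OF *(2,4,5) assms(5-7)] nonvanishing_from_mult[OF _ nonvanishing_from_down[OF *(3), of n]]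
    unfolding local_from_def by blast
qed

lemma qderiv_eq:
  "qderiv scale Q a = dscale (1 / (Q - 1)) (zinv (dilate scale Q a) + dscale (-1) (zinv a))"
  by (simp add: qderiv_def zinv_def fun_eq_iff)

section \<open>Regularity of linear combinations\<close>

lemma bounded_along_add:
  assumes "bounded_along \<chi> u" "bounded_along \<chi> u'"
  shows "bounded_along \<chi> (\<lambda>x. u x + u' x)"
proof -
  obtain N N' where N: "\<And>x. u x \<noteq> 0 \<Longrightarrow> N \<le> \<chi> x" "\<And>x. u' x \<noteq> 0 \<Longrightarrow> N' \<le> \<chi> x"
    using assms unfolding bounded_along_def by blast
  have "min N N' \<le> \<chi> x" if "u x + u' x \<noteq> 0" for x
    using that N[of x] by (cases "u x = 0") auto
  then show ?thesis unfolding bounded_along_def by blast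
qed

lemma bounded_along_mono:
  "bounded_along \<chi> u \<Longrightarrow> (\<And>x. u x = 0 \<Longrightarrow> u' x = 0) \<Longrightarrow> bounded_along \<chi> u'"
  unfolding bounded_along_def by blast

lemma regular3_add: "regular3 u \<Longrightarrow> regular3 u' \<Longrightarrow> regular3 (\<lambda>x. u x + u' x)"
  by (simp add: regular3_def bounded_along_add)

lemma regular3_scale: "regular3 u \<Longrightarrow> regular3 (\<lambda>x. scale c (u x))"
  unfolding regular3_def by (auto intro: bounded_along_mono)

lemma regular2_scale: "regular2 u \<Longrightarrow> regular2 (\<lambda>x. scale c (u x))"
  by (auto intro: regular2_mono)

lemma regularizes3_mult:
  assumes "regularizes3 f12 f13 f23 a b c"
  shows "regularizes3 (g12 * f12) (g13 * f13) (g23 * f23) a b c"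
  unfolding regularizes3_def
proof
  fix v
  have "poly_act (g12 * f12) shift12 (poly_act (g13 * f13) shift13 (poly_act (g23 * f23) shift23 (prod3 a b c v))) =
    poly_act g12 shift12 (poly_act g13 shift13 (poly_act g23 shift23 (poly_act f12 shift12 (poly_act f13 shift13 (poly_act f23 shift23 (prod3 a b c v))))))"
    by (simp only: poly_act_mult commute_12_13 commute_12_23 commute_13_23)
  then show "regular3 (poly_act (g12 * f12) shift12 (poly_act (g13 * f13) shift13 (poly_act (g23 * f23) shift23 (prod3 a b c v))))"
    using regular3_poly_act(1)[OF regular3_poly_act(2)[OF regular3_poly_act(3)[OF assms[unfolded regularizes3_def, rule_format, of v]]]]
    by (simp only:)
qed

text \<open>Regularity passes to sums by multiplying the polynomials of the summands. With locality
  this equalises the \<open>f\<close> but in general not the \<open>g\<close>.\<close>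

definition regularizable2 :: "nat \<Rightarrow> 'l distr \<Rightarrow> 'l distr \<Rightarrow> bool" where
  "regularizable2 m a b \<longleftrightarrow> (\<exists>f. nonvanishing_from m f \<and> (\<forall>v. regular2 (poly_act f shift (prod2 a b v))))"

text \<open>The ratios z_2/z_1 and z_3/z_1 are governed by the weight \<open>m\<close> of the first
  field, z_3/z_2 by the weight \<open>k\<close> of the second; the third field is never a left
  factor.\<close>

definition regularizable3 :: "nat \<Rightarrow> nat \<Rightarrow> 'l distr \<Rightarrow> 'l distr \<Rightarrow> 'l distr \<Rightarrow> bool" where
  "regularizable3 m k a b c \<longleftrightarrow> (\<exists>f12 f13 f23. nonvanishing_from m f12 \<and> nonvanishing_from m f13 \<and> nonvanishing_from k f23 \<and> regularizes3 f12 f13 f23 a b c)"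

lemma poly_act_add_fun: "poly_act f \<sigma> (\<lambda>x. u x + u' x) = (\<lambda>x. poly_act f \<sigma> u x + poly_act f \<sigma> u' x)"
  by (simp add: fun_eq_iff poly_act_add)

lemma regularizable2_combine:
  assumes "regularizable2 m a1 b1" "regularizable2 m a2 b2"
    and "\<And>v. prod2 a b v = (\<lambda>x. scale c1 (prod2 a1 b1 v x) + scale c2 (prod2 a2 b2 v x))"
  shows "regularizable2 m a b"
proof -
  obtain f1 f2 where f: "nonvanishing_from m f1" "nonvanishing_from m f2"
    "\<And>v. regular2 (poly_act f1 shift (prod2 a1 b1 v))" "\<And>v. regular2 (poly_act f2 shift (prod2 a2 b2 v))"
    using assms(1,2) unfolding regularizable2_def by blast
  have "regular2 (poly_act (f2 * f1) shift (prod2 a1 b1 v))" "regular2 (poly_act (f1 * f2) shift (prod2 a2 b2 v))" for v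
    unfolding poly_act_mult by (intro regular2_poly_act f)+
  then have "regular2 (poly_act (f1 * f2) shift (prod2 a b v))" for v
    unfolding assms(3) poly_act_add_fun poly_act_scale_fun
    by (intro regular2_add regular2_scale) (simp_all only: mult.commute[of f1])
  then show ?thesis
    unfolding regularizable2_def using nonvanishing_from_mult[OF f(1,2)] by blast
qed

lemma regularizable3_combine:
  assumes "regularizable3 m k a1 b1 c1" "regularizable3 m k a2 b2 c2"
    and "\<And>v. prod3 a b c v = (\<lambda>x. scale d1 (prod3 a1 b1 c1 v x) + scale d2 (prod3 a2 b2 c2 v x))"
  shows "regularizable3 m k a b c"
proof -
  obtain f12 f13 f23 where f: "nonvanishing_from m f12" "nonvanishing_from m f13" "nonvanishing_from k f23" "regularizes3 f12 f13 f23 a1 b1 c1"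
    using assms(1) unfolding regularizable3_def by blast
  obtain g12 g13 g23 where g: "nonvanishing_from m g12" "nonvanishing_from m g13" "nonvanishing_from k g23" "regularizes3 g12 g13 g23 a2 b2 c2"
    using assms(2) unfolding regularizable3_def by blast
  have 1: "regularizes3 (g12 * f12) (g13 * f13) (g23 * f23) a1 b1 c1"
    using f(4) by (rule regularizes3_mult)
  have "regularizes3 (f12 * g12) (f13 * g13) (f23 * g23) a2 b2 c2"
    using g(4) by (rule regularizes3_mult)
  then have 2: "regularizes3 (g12 * f12) (g13 * f13) (g23 * f23) a2 b2 c2"
    by (simp only: mult.commute)
  have "regularizes3 (g12 * f12) (g13 * f13) (g23 * f23) a b c"
    unfolding regularizes3_def assms(3) poly_act_add_fun poly_act_scale_fun
    using 1 2 by (intro allI regular3_add regular3_scale) (simp_all add: regularizes3_def)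
  moreover have "nonvanishing_from m (g12 * f12)" "nonvanishing_from m (g13 * f13)" "nonvanishing_from k (g23 * f23)"
    by (intro nonvanishing_from_mult f g)+
  ultimately show ?thesis
    unfolding regularizable3_def by blast
qed

end

section \<open>Fields generated by mutually local fields\<close>

locale local_fields = q_calculus scale Q
  for scale :: "'f::field \<Rightarrow> 'l::ab_group_add \<Rightarrow> 'l" and Q :: 'f +
  fixes gens :: "'l distr set"
  assumes gens_fields: "gens \<subseteq> fields scale"
    and gens_local: "a \<in> gens \<Longrightarrow> b \<in> gens \<Longrightarrow> local_from 0 a b"
begin

text \<open>Locality does not survive addition, so it is established for the fields obtained from the
  generators without linear combinations; \<open>pure m a\<close> says that \<open>a\<close> may occur with the weight \<open>t\<^sup>m\<close>.\<close>

inductive pure :: "nat \<Rightarrow> 'l distr \<Rightarrow> bool" where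
  base: "a \<in> gens \<Longrightarrow> pure 0 a"
| one: "pure 0 one"
| weaken: "pure m a \<Longrightarrow> pure (Suc m) a"
| zinv: "pure m a \<Longrightarrow> pure m (zinv a)"
| dilate: "pure m a \<Longrightarrow> pure (Suc m) (dilate scale Q a)"
| reg_val: "pure m a \<Longrightarrow> pure k b \<Longrightarrow> m \<le> n \<Longrightarrow> is_reg_val n a b e \<Longrightarrow> pure (n + k) e"

lemma pure_fields: "pure m a \<Longrightarrow> a \<in> flds"
  by (induction rule: pure.induct)
     (use gens_fields in \<open>auto intro: fields_one fields_zinv fields_dilate is_reg_val_fields\<close>)

lemma pure_local_right:
  assumes a: "a \<in> flds" and gens: "\<And>b. b \<in> gens \<Longrightarrow> local_from m a b"
  shows "pure k b \<Longrightarrow> local_from m a b"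
proof (induction rule: pure.induct)
  case (reg_val m' b k c n e)
  then show ?case
    by (intro local_from_reg_val_right[of m a b c n e] a pure_fields[of m' b] pure_fields[of k c])
qed (simp_all add: gens a local_from_one local_from_zinv_right local_from_dilate_right)

lemma pure_local_left:
  assumes b: "b \<in> flds" and gens: "\<And>a. a \<in> gens \<Longrightarrow> local_from 0 a b"
  shows "pure m a \<Longrightarrow> local_from m a b"
proof (induction rule: pure.induct)
  case (weaken m a)
  from weaken.IH show ?case by (rule local_from_mono) simp
next
  case (reg_val m a k b' n e)
  then show ?case
    by (intro local_from_reg_val_left[of m a b k b' n e] b pure_fields[of m a] pure_fields[of k b'])
qed (simp_all add: gens b local_from_one local_from_zinv_left local_from_dilate_left)

text \<open>Two successive inductions: the right factor is built up against a generator on the left,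
  at weight 0; then the left factor is built up and accumulates its weight.\<close>

lemma pure_local:
  assumes "pure m a" "pure k b"
  shows "local_from m a b"
proof -
  have "local_from 0 x b" if "x \<in> gens" for x
    by (rule pure_local_right[OF _ _ assms(2)]) (use that gens_fields gens_local in auto)
  then show ?thesis
    using pure_local_left[OF pure_fields[OF assms(2)] _ assms(1)] by simp
qed

inductive weighted :: "nat \<Rightarrow> 'l distr \<Rightarrow> bool" where
  zero: "weighted m 0"
| pure: "pure m a \<Longrightarrow> weighted m a"
| add: "weighted m a \<Longrightarrow> weighted m b \<Longrightarrow> weighted m (a + b)"
| dscale: "weighted m a \<Longrightarrow> weighted m (dscale c a)"

lemma weighted_fields: "weighted m a \<Longrightarrow> a \<in> flds"
  by (induction rule: weighted.induct) (blast intro: pure_fields fields_zero fields_add fields_dscale)+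

lemma weighted_Suc: "weighted m a \<Longrightarrow> weighted (Suc m) a"
  by (induction rule: weighted.induct) (blast intro: weighted.intros pure.intros)+

lemma weighted_zinv: "weighted m a \<Longrightarrow> weighted m (zinv a)"
proof (induction rule: weighted.induct)
  case (zero m)
  have "zinv 0 = (0 :: 'l distr)" by (simp add: zinv_def fun_eq_iff)
  then show ?case by (simp only: weighted.zero)
next
  case (add m a b)
  have "zinv (a + b) = zinv a + zinv b" by (simp add: zinv_def fun_eq_iff)
  with add.IH show ?case by (simp only: weighted.add)
next
  case (dscale m a c)
  have "zinv (dscale c a) = dscale c (zinv a)" by (simp add: zinv_def fun_eq_iff)
  with dscale.IH show ?case by (simp only: weighted.dscale)
qed (blast intro: weighted.intros pure.intros)+

lemma weighted_dilate: "weighted m a \<Longrightarrow> weighted (Suc m) (dilate scale Q a)"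
proof (induction rule: weighted.induct)
  case (zero m)
  have "dilate scale Q 0 = 0" by (simp add: dilate_def fun_eq_iff)
  then show ?case by (simp only: weighted.zero)
next
  case (add m a b)
  have "dilate scale Q (a + b) = dilate scale Q a + dilate scale Q b"
    by (simp add: dilate_def fun_eq_iff scale_right_distrib)
  with add.IH show ?case by (simp only: weighted.add)
next
  case (dscale m a c)
  have "dilate scale Q (dscale c a) = dscale c (dilate scale Q a)"
    by (simp add: dilate_def fun_eq_iff mult.commute)
  with dscale.IH show ?case by (simp only: weighted.dscale)
qed (blast intro: weighted.intros pure.intros)+

text \<open>The dilated term of the q-derivative has weight \<open>Suc m\<close>, the undilated one
  only \<open>m\<close>; weakening brings both to the same weight.\<close>

lemma weighted_qderiv: "weighted m a \<Longrightarrow> weighted (Suc m) (qderiv scale Q a)"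
  unfolding qderiv_eq by (intro weighted.add weighted.dscale weighted_zinv weighted_dilate weighted_Suc)

lemma weighted_sum: "(\<And>i. i \<in> A \<Longrightarrow> weighted m (f i)) \<Longrightarrow> weighted m (\<Sum>i\<in>A. f i)"
  by (induction A rule: infinite_finite_induct) (auto intro: weighted.intros)

lemma regularizable2_zero: "(\<And>v x. prod2 a b v x = 0) \<Longrightarrow> regularizable2 m a b"
  unfolding regularizable2_def by (intro exI[of _ 1]) (simp add: nonvanishing_from_one regular2_def)

lemma pure_regularizable2:
  assumes "pure m a" "pure k b"
  shows "regularizable2 m a b"
proof -
  obtain f g where "nonvanishing_from m f" "local_via f g a b"
    using pure_local[OF assms] unfolding local_from_def by blast
  then show ?thesis
    unfolding regularizable2_def using regular2_local_via[of f g a b] assms[THEN pure_fields] by blast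
qed

lemma weighted_regularizable2:
  assumes "weighted m a" "weighted k b"
  shows "regularizable2 m a b"
  using assms(1)
proof (induction rule: weighted.induct)
  case (zero m)
  show ?case by (rule regularizable2_zero) (auto simp: prod2_def)
next
  case (pure m a)
  note a = pure_fields[OF pure]
  show ?case using assms(2)
  proof (induction rule: weighted.induct)
    case (zero k)
    show ?case by (rule regularizable2_zero) (auto simp: prod2_def flds_0[OF a])
  next
    case (pure k b)
    show ?case using \<open>pure m a\<close> pure by (rule pure_regularizable2)
  next
    case (add k b b')
    show ?case
      by (rule regularizable2_combine[OF add.IH, where ?c1.0 = 1 and ?c2.0 = 1])
         (auto simp: prod2_def fun_eq_iff flds_add[OF a])
  next
    \<comment> \<open>A scalar multiple is treated as a combination whose second coefficient is
      0.\<close>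
    case (dscale k b c)
    show ?case
      by (rule regularizable2_combine[OF dscale.IH dscale.IH, where ?c1.0 = c and ?c2.0 = 0])
         (auto simp: prod2_def fun_eq_iff flds_scale[OF a])
  qed
next
  case (add m a a')
  show ?case
    by (rule regularizable2_combine[OF add.IH, where ?c1.0 = 1 and ?c2.0 = 1]) (auto simp: prod2_def fun_eq_iff)
next
  case (dscale m a c)
  show ?case
    by (rule regularizable2_combine[OF dscale.IH dscale.IH, where ?c1.0 = c and ?c2.0 = 0])
       (auto simp: prod2_def fun_eq_iff)
qed

lemma regularizable3_zero: "(\<And>v x. prod3 a b c v x = 0) \<Longrightarrow> regularizable3 m k a b c"
  unfolding regularizable3_def regularizes3_def
  by (intro exI[of _ 1]) (simp add: nonvanishing_from_one regular3_def bounded_along_def)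

lemma pure_regularizable3:
  assumes "pure m a" "pure k b" "pure j c"
  shows "regularizable3 m k a b c"
proof -
  obtain f12 g12 f13 g13 f23 g23 where
    "nonvanishing_from m f12" "local_via f12 g12 a b" "nonvanishing_from m f13" "local_via f13 g13 a c" "nonvanishing_from k f23" "local_via f23 g23 b c"
    using pure_local assms unfolding local_from_def by metis
  then show ?thesis
    unfolding regularizable3_def regularizes3_def using regular3_local_via assms[THEN pure_fields] by blast
qed

lemma weighted_regularizable3:
  assumes "weighted m a" "weighted k b" "weighted j c"
  shows "regularizable3 m k a b c"
  using assms(1)
proof (induction rule: weighted.induct)
  case (zero m)
  show ?case by (rule regularizable3_zero) (auto simp: prod3_def)
next
  case (pure m a)
  note a = pure_fields[OF pure]
  show ?case using assms(2)
  proof (induction rule: weighted.induct)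
    case (zero k)
    show ?case by (rule regularizable3_zero) (auto simp: prod3_def flds_0[OF a])
  next
    case (pure k b)
    note b = pure_fields[OF pure]
    show ?case using assms(3)
    proof (induction rule: weighted.induct)
      case (zero j)
      show ?case by (rule regularizable3_zero) (auto simp: prod3_def flds_0[OF a] flds_0[OF b])
    next
      case (pure j c)
      show ?case using \<open>pure m a\<close> \<open>pure k b\<close> pure by (rule pure_regularizable3)
    next
      case (add j c c')
      show ?case
        by (rule regularizable3_combine[OF add.IH, where ?d1.0 = 1 and ?d2.0 = 1])
           (auto simp: prod3_def fun_eq_iff flds_add[OF a] flds_add[OF b])
    next
      case (dscale j c d)
      show ?case
        by (rule regularizable3_combine[OF dscale.IH dscale.IH, where ?d1.0 = d and ?d2.0 = 0])
           (auto simp: prod3_def fun_eq_iff flds_scale[OF a] flds_scale[OF b])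
    qed
  next
    case (add k b b')
    show ?case
      by (rule regularizable3_combine[OF add.IH, where ?d1.0 = 1 and ?d2.0 = 1])
         (auto simp: prod3_def fun_eq_iff flds_add[OF a])
  next
    case (dscale k b d)
    show ?case
      by (rule regularizable3_combine[OF dscale.IH dscale.IH, where ?d1.0 = d and ?d2.0 = 0])
         (auto simp: prod3_def fun_eq_iff flds_scale[OF a])
  qed
next
  case (add m a a')
  show ?case
    by (rule regularizable3_combine[OF add.IH, where ?d1.0 = 1 and ?d2.0 = 1]) (auto simp: prod3_def fun_eq_iff)
next
  case (dscale m a d)
  show ?case
    by (rule regularizable3_combine[OF dscale.IH dscale.IH, where ?d1.0 = d and ?d2.0 = 0])
       (auto simp: prod3_def fun_eq_iff)
qed

section \<open>Bilinearity and associativity of regularised values\<close>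

lemma weighted_is_reg_val:
  assumes "weighted m a" "weighted k b" "m \<le> n"
  shows "is_reg_val n a b (reg_val n a b)"
proof -
  obtain f where "nonvanishing_from m f" "\<And>v. regular2 (poly_act f shift (prod2 a b v))"
    using weighted_regularizable2[OF assms(1,2)] by (auto simp: regularizable2_def)
  then have "is_reg_val_with f n a b (\<lambda>k v. scale (1 / poly f (Q ^ n)) (ev (Q ^ n) (poly_act f shift (prod2 a b v)) k))"
    using goodD[OF _ assms(3)] by (intro is_reg_val_with_exists) auto
  then show ?thesis
    using reg_val_eq is_reg_val_with_is_reg_val by metis
qed

lemma reg_val_zero:
  assumes "\<And>v x. prod2 a b v x = 0"
  shows "reg_val n a b = 0"
proof (rule reg_val_eq)
  have "poly_act 1 shift (prod2 a b v) = (\<lambda>x. 0)" for v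
    using assms by (simp add: fun_eq_iff)
  then have "is_reg_val_with 1 n a b 0"
    by (simp add: is_reg_val_with_def regular2_def ev_def push_zero)
  then show "is_reg_val n a b 0" by (rule is_reg_val_with_is_reg_val)
qed

lemma reg_val_zero_left: "reg_val n 0 b = 0"
  by (rule reg_val_zero) (auto simp: prod2_def)

lemma reg_val_zero_right: "a \<in> flds \<Longrightarrow> reg_val n a 0 = 0"
  by (rule reg_val_zero) (auto simp: prod2_def flds_0)

lemma reg_val_add_left: "weighted m a \<Longrightarrow> weighted m a' \<Longrightarrow> weighted k b \<Longrightarrow> m \<le> n \<Longrightarrow> reg_val n (a + a') b = reg_val n a b + reg_val n a' b"
  by (intro reg_val_eq is_reg_val_add_left weighted_is_reg_val)

lemma reg_val_add_right: "weighted m a \<Longrightarrow> weighted k b \<Longrightarrow> weighted k b' \<Longrightarrow> m \<le> n \<Longrightarrow> reg_val n a (b + b') = reg_val n a b + reg_val n a b'"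
  by (intro reg_val_eq is_reg_val_add_right weighted_is_reg_val weighted_fields)

lemma reg_val_dscale_left: "weighted m a \<Longrightarrow> weighted k b \<Longrightarrow> m \<le> n \<Longrightarrow> reg_val n (dscale c a) b = dscale c (reg_val n a b)"
  by (intro reg_val_eq is_reg_val_scale_left weighted_is_reg_val)

lemma reg_val_dscale_right: "weighted m a \<Longrightarrow> weighted k b \<Longrightarrow> m \<le> n \<Longrightarrow> reg_val n a (dscale c b) = dscale c (reg_val n a b)"
  by (intro reg_val_eq is_reg_val_scale_right weighted_is_reg_val weighted_fields)

lemma reg_val_zinv_left: "weighted m a \<Longrightarrow> weighted k b \<Longrightarrow> m \<le> n \<Longrightarrow> reg_val n (zinv a) b = zinv (reg_val n a b)"
  by (intro reg_val_eq is_reg_val_zinv_left weighted_is_reg_val)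

lemma reg_val_zinv_right:
  "weighted m a \<Longrightarrow> weighted k b \<Longrightarrow> m \<le> n \<Longrightarrow> reg_val n a (zinv b) = dscale (1 / Q ^ n) (zinv (reg_val n a b))"
  by (intro reg_val_eq is_reg_val_zinv_right weighted_is_reg_val)

lemma reg_val_dilate_left:
  "weighted m a \<Longrightarrow> weighted k b \<Longrightarrow> m \<le> n \<Longrightarrow> reg_val (Suc n) (dilate scale Q a) b = dilate scale Q (reg_val n a b)"
  by (intro reg_val_eq is_reg_val_dilate_left weighted_is_reg_val)

lemma reg_val_dilate_right:
  "weighted m a \<Longrightarrow> weighted k b \<Longrightarrow> m \<le> n \<Longrightarrow> reg_val n a (dilate scale Q b) = reg_val (Suc n) a b"
  by (intro reg_val_eq is_reg_val_dilate_right weighted_is_reg_val weighted_fields) auto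

lemma weighted_reg_val:
  assumes "weighted m a" "weighted k b" "m \<le> n"
  shows "weighted (n + k) (reg_val n a b)"
  using assms(1,3)
proof (induction rule: weighted.induct)
  case (zero m)
  show ?case by (simp only: reg_val_zero_left weighted.zero)
next
  case (pure m a)
  note a = weighted.pure[OF pure(1)]
  show ?case using assms(2)
  proof (induction rule: weighted.induct)
    case (zero k)
    show ?case by (simp only: reg_val_zero_right[OF weighted_fields[OF a]] weighted.zero)
  next
    case (pure k b)
    show ?case
      by (intro weighted.pure pure.reg_val[OF \<open>pure m a\<close> pure \<open>m \<le> n\<close>] weighted_is_reg_val[OF a weighted.pure[OF pure] \<open>m \<le> n\<close>])
  next
    case (add k b b')
    then show ?case by (simp only: reg_val_add_right[OF a add(1,2) \<open>m \<le> n\<close>] weighted.add)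
  next
    case (dscale k b c)
    then show ?case by (simp only: reg_val_dscale_right[OF a dscale(1) \<open>m \<le> n\<close>] weighted.dscale)
  qed
next
  case (add m a a')
  then show ?case by (simp only: reg_val_add_left[OF add(1,2) assms(2)] weighted.add)
next
  case (dscale m a c)
  then show ?case by (simp only: reg_val_dscale_left[OF dscale(1) assms(2)] weighted.dscale)
qed

lemma reg_val_assoc:
  assumes "weighted m a" "weighted k b" "weighted j c" "m \<le> p" "k \<le> r"
  shows "reg_val (p + r) (reg_val p a b) c = reg_val p a (reg_val r b c)"
proof -
  obtain f12 f13 f23 where f: "nonvanishing_from m f12" "nonvanishing_from m f13" "nonvanishing_from k f23" "regularizes3 f12 f13 f23 a b c"
    using weighted_regularizable3[OF assms(1-3)] by (auto simp: regularizable3_def)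
  obtain g h where g: "is_reg_val_with g p a b (reg_val p a b)" and h: "is_reg_val_with h r b c (reg_val r b c)"
    using weighted_is_reg_val[OF assms(1,2,4)] weighted_is_reg_val[OF assms(2,3,5)] by (auto simp: is_reg_val_def)
  \<comment> \<open>The polynomial that computes a value and the one that regularises the triple
    product have to coincide, so they are multiplied.\<close>
  have "is_reg_val_with (f12 * g) p a b (reg_val p a b)" "is_reg_val_with (f23 * h) r b c (reg_val r b c)"
    using g h goodD[OF f(1) assms(4)] goodD[OF f(3) assms(5)] by (auto intro: is_reg_val_with_mult)
  moreover have "regularizes3 (f12 * g) f13 (f23 * h) a b c"
    using regularizes3_mult[OF f(4), of g 1 h] by (simp add: mult.commute)
  ultimately obtain e where "is_reg_val (p + r) (reg_val p a b) c e" "is_reg_val p a (reg_val r b c) e"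
    by (rule is_reg_val_assoc) (use goodD[OF f(2), of "p + r"] assms weighted_fields in auto)
  then show ?thesis by (simp add: reg_val_eq)
qed

section \<open>Divided q-derivatives and the twisted Leibniz rule\<close>

lemma Q_neq_1: "Q \<noteq> 1"
  using Q_power[of 1] by simp

text \<open>The difference of a(Q z) b(Q^(n+1) z) and a(z) b(Q^n z) is split at a(z) b(Q^(n+1) z),
  so the derivative of \<open>a\<close> meets \<open>b\<close> at the index n + 1. The factor Q^n
  arises because the derivative of \<open>b\<close> at Q^n z divides by Q^n z instead of z.\<close>

lemma qderiv_reg_val:
  assumes "weighted m a" "weighted k b" "m \<le> n"
  shows "qderiv scale Q (reg_val n a b) =
    reg_val (Suc n) (qderiv scale Q a) b + dscale (Q ^ n) (reg_val n a (qderiv scale Q b))"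
proof -
  note a = assms(1) and b = assms(2)
  have le: "Suc m \<le> Suc n" "m \<le> Suc n" using assms(3) by simp_all
  have Wa: "weighted (Suc m) a" "weighted (Suc m) (zinv a)" "weighted (Suc m) (dscale (-1) (zinv a))"
      "weighted (Suc m) (dilate scale Q a)" "weighted (Suc m) (zinv (dilate scale Q a))"
      "weighted (Suc m) (zinv (dilate scale Q a) + dscale (-1) (zinv a))"
    by (intro weighted.add weighted.dscale weighted_zinv weighted_dilate weighted_Suc a)+
  have Wb: "weighted (Suc k) b" "weighted (Suc k) (zinv b)" "weighted (Suc k) (dscale (-1) (zinv b))"
      "weighted (Suc k) (dilate scale Q b)" "weighted (Suc k) (zinv (dilate scale Q b))"
      "weighted (Suc k) (zinv (dilate scale Q b) + dscale (-1) (zinv b))"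
    by (intro weighted.add weighted.dscale weighted_zinv weighted_dilate weighted_Suc b)+
  have "reg_val (Suc n) (qderiv scale Q a) b = dscale (1 / (Q - 1))
      (zinv (dilate scale Q (reg_val n a b)) + dscale (-1) (zinv (reg_val (Suc n) a b)))"
    by (simp only: qderiv_eq reg_val_dscale_left[OF Wa(6) b le(1)] reg_val_add_left[OF Wa(5,3) b le(1)]
        reg_val_dscale_left[OF Wa(2) b le(1)] reg_val_zinv_left[OF Wa(4) b le(1)]
        reg_val_zinv_left[OF Wa(1) b le(1)] reg_val_dilate_left[OF a b assms(3)])
  moreover have "reg_val n a (qderiv scale Q b) = dscale (1 / (Q - 1))
      (dscale (1 / Q ^ n) (zinv (reg_val (Suc n) a b)) + dscale (-1) (dscale (1 / Q ^ n) (zinv (reg_val n a b))))"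
    by (simp only: qderiv_eq reg_val_dscale_right[OF a Wb(6) assms(3)] reg_val_add_right[OF a Wb(5,3) assms(3)]
        reg_val_dscale_right[OF a Wb(2) assms(3)] reg_val_zinv_right[OF a Wb(4) assms(3)]
        reg_val_zinv_right[OF a Wb(1) assms(3)] reg_val_dilate_right[OF a b assms(3)])
  ultimately show ?thesis
    using Q_nonzero by (simp add: qderiv_eq fun_eq_iff scale_right_distrib scale_right_diff_distrib)
qed

definition divided_qderiv :: "nat \<Rightarrow> 'l distr \<Rightarrow> 'l distr" where
  "divided_qderiv r a = dscale (1 / qfact Q r) ((qderiv scale Q ^^ r) a)"

lemma qint_nonzero: "0 < r \<Longrightarrow> qint Q (int r) \<noteq> 0"
  using Q_power[of r] Q_neq_1 by (simp add: qint_def)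

lemma qint_0: "qint Q 0 = 0"
  by (simp add: qint_def)

lemma qint_add: "qint Q (int (l + k)) = qint Q (int l) + Q ^ l * qint Q (int k)"
proof -
  have "Q powi int (l + k) - 1 = (Q ^ l - 1) + Q ^ l * (Q ^ k - 1)"
    unfolding power_int_of_nat by (simp add: power_add algebra_simps)
  then show ?thesis
    by (simp only: qint_def add_divide_distrib times_divide_eq_right power_int_of_nat)
qed

lemma qfact_0: "qfact Q 0 = 1"
  by (simp add: qfact_def)

lemma qfact_Suc: "qfact Q (Suc r) = qint Q (int (Suc r)) * qfact Q r"
  by (simp add: qfact_def prod.nat_ivl_Suc' mult.commute)

lemma qfact_nonzero: "qfact Q r \<noteq> 0"
  unfolding qfact_def by (subst prod_zero_iff) (auto simp: qint_nonzero simp del: of_nat_eq_0_iff)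

lemma qderiv_add: "qderiv scale Q (a + b) = qderiv scale Q a + qderiv scale Q b"
  by (simp add: qderiv_def dilate_def fun_eq_iff scale_right_distrib scale_right_diff_distrib)

lemma qderiv_dscale: "qderiv scale Q (dscale c a) = dscale c (qderiv scale Q a)"
  by (simp add: qderiv_def dilate_def fun_eq_iff scale_right_diff_distrib mult_ac)

lemma qderiv_zero: "qderiv scale Q 0 = 0"
  using qderiv_dscale[of 0 0] by simp

lemma qderiv_sum: "qderiv scale Q (\<Sum>i\<in>A. f i) = (\<Sum>i\<in>A. qderiv scale Q (f i))"
  by (induction A rule: infinite_finite_induct)
     (simp_all only: sum.infinite sum.empty sum.insert not_False_eq_True qderiv_zero qderiv_add)

lemma qderiv_power_dscale: "(qderiv scale Q ^^ r) (dscale c a) = dscale c ((qderiv scale Q ^^ r) a)"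
  by (induction r) (simp_all only: funpow.simps comp_apply id_apply qderiv_dscale)

lemma qderiv_power_add:
  "(qderiv scale Q ^^ r) (a + b) = (qderiv scale Q ^^ r) a + (qderiv scale Q ^^ r) b"
  by (induction r) (simp_all only: funpow.simps comp_apply id_apply qderiv_add)

lemma divided_qderiv_0 [simp]: "divided_qderiv 0 a = a"
  by (simp add: divided_qderiv_def qfact_0)

lemma qderiv_divided_qderiv: "qderiv scale Q (divided_qderiv r a) = dscale (qint Q (int (Suc r))) (divided_qderiv (Suc r) a)"
  using qint_nonzero[of "Suc r"] by (simp add: divided_qderiv_def qderiv_dscale qfact_Suc del: of_nat_Suc)

lemma divided_qderiv_add: "divided_qderiv r (a + b) = divided_qderiv r a + divided_qderiv r b"
  by (simp add: divided_qderiv_def qderiv_power_add distr.scale_right_distrib)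

lemma divided_qderiv_dscale: "divided_qderiv r (dscale c a) = dscale c (divided_qderiv r a)"
  by (simp add: divided_qderiv_def qderiv_power_dscale mult.commute)

text \<open>The origin of the q-binomial coefficients in the associativity axiom.\<close>

lemma divided_qderiv_divided_qderiv:
  "divided_qderiv l (divided_qderiv r a) = dscale (qfact Q (l + r) / (qfact Q l * qfact Q r)) (divided_qderiv (l + r) a)"
  using qfact_nonzero by (simp add: divided_qderiv_def qderiv_power_dscale funpow_add)

lemma weighted_divided_qderiv: "weighted m a \<Longrightarrow> weighted (m + r) (divided_qderiv r a)"
proof -
  assume "weighted m a"
  then have "weighted (m + r) ((qderiv scale Q ^^ r) a)"
    by (induction r) (auto intro: weighted_qderiv)
  then show ?thesis unfolding divided_qderiv_def by (rule weighted.dscale)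
qed

lemma qbinom_eq: "qbinom Q (int (l + r)) l = qfact Q (l + r) / (qfact Q l * qfact Q r)"
proof -
  have "(\<Prod>t<l. qint Q (int (l + r) - int t)) * qfact Q r = qfact Q (l + r)"
  proof (induction l)
    case (Suc l)
    have "(\<Prod>t<Suc l. qint Q (int (Suc l + r) - int t)) =
        qint Q (int (Suc (l + r))) * (\<Prod>t<l. qint Q (int (l + r) - int t))"
      by (subst prod.lessThan_Suc_shift) (simp add: algebra_simps)
    with Suc.IH show ?case
      by (simp only: qfact_Suc add_Suc mult.assoc)
  qed simp
  then show ?thesis
    using qfact_nonzero by (simp add: qbinom_def divide_simps)
qed

text \<open>Dividing by the q-factorials absorbs the binomials of the Leibniz rule. In the induction
  each term \<open>V l\<close> arises twice, and its two coefficients combine by [s+1] = [l] + Q^l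
  [s+1-l]; the common factor [s+1] is cancelled at the end.\<close>

lemma divided_qderiv_reg_val:
  assumes "weighted m a" "weighted k b" "m \<le> n"
  shows "divided_qderiv s (reg_val n a b) =
    (\<Sum>l\<le>s. dscale (Q ^ (n * (s - l))) (reg_val (n + l) (divided_qderiv l a) (divided_qderiv (s - l) b)))"
proof (induction s)
  case 0
  show ?case by simp
next
  case (Suc s)
  define V where "V l = reg_val (n + l) (divided_qderiv l a) (divided_qderiv (Suc s - l) b)" for l
  have step: "qderiv scale Q (reg_val (n + l) (divided_qderiv l a) (divided_qderiv (s - l) b)) =
      dscale (qint Q (int (Suc l))) (V (Suc l)) + dscale (Q ^ (n + l) * qint Q (int (Suc s - l))) (V l)"
    if "l \<le> s" for l
  proof -
    have weighted: "weighted (m + l) (divided_qderiv l a)" "weighted (k + (s - l)) (divided_qderiv (s - l) b)" "m + l \<le> n + l"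
        "weighted (m + Suc l) (divided_qderiv (Suc l) a)" "weighted (k + Suc (s - l)) (divided_qderiv (Suc (s - l)) b)" "m + Suc l \<le> Suc (n + l)"
      using assms by (auto intro: weighted_divided_qderiv simp del: add_Suc_right)
    show ?thesis
      unfolding qderiv_reg_val[OF weighted(1-3)] qderiv_divided_qderiv reg_val_dscale_left[OF weighted(4,2,6)]
        reg_val_dscale_right[OF weighted(1,5,3)] V_def
      using that by (simp add: Suc_diff_le)
  qed
  have "dscale (qint Q (int (Suc s))) (divided_qderiv (Suc s) (reg_val n a b)) = qderiv scale Q (divided_qderiv s (reg_val n a b))"
    by (simp only: qderiv_divided_qderiv)
  also have "\<dots> = (\<Sum>l\<le>s. dscale (Q ^ (n * (s - l))) (qderiv scale Q (reg_val (n + l) (divided_qderiv l a) (divided_qderiv (s - l) b))))"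
    by (simp only: Suc.IH qderiv_sum qderiv_dscale)
  also have "\<dots> = (\<Sum>l\<le>s. dscale (Q ^ (n * (s - l)) * qint Q (int (Suc l))) (V (Suc l))) +
      (\<Sum>l\<le>s. dscale (Q ^ (n * (s - l)) * (Q ^ (n + l) * qint Q (int (Suc s - l)))) (V l))"
    by (simp add: step distr.scale_right_distrib sum.distrib del: of_nat_Suc)
  \<comment> \<open>The index shift adds a term for l = 0, which vanishes since [0] = 0; the
    companion sum gains a vanishing term for l = s + 1 in the same way.\<close>
  also have "(\<Sum>l\<le>s. dscale (Q ^ (n * (s - l)) * qint Q (int (Suc l))) (V (Suc l))) =
      (\<Sum>l\<le>Suc s. dscale (Q ^ (n * (Suc s - l)) * qint Q (int l)) (V l))"
    by (subst sum.atMost_Suc_shift) (simp add: qint_0 del: of_nat_Suc)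
  also have "(\<Sum>l\<le>s. dscale (Q ^ (n * (s - l)) * (Q ^ (n + l) * qint Q (int (Suc s - l)))) (V l)) =
      (\<Sum>l\<le>Suc s. dscale (Q ^ (n * (Suc s - l)) * (Q ^ l * qint Q (int (Suc s - l)))) (V l))"
  proof -
    have "Q ^ (n * (s - l)) * Q ^ (n + l) = Q ^ (n * (Suc s - l)) * Q ^ l" if "l \<le> s" for l
      using that by (simp add: Suc_diff_le algebra_simps flip: power_add)
    then show ?thesis
      by (subst sum.atMost_Suc) (simp add: qint_0 mult.assoc[symmetric])
  qed
  also have "(\<Sum>l\<le>Suc s. dscale (Q ^ (n * (Suc s - l)) * qint Q (int l)) (V l)) + \<dots> =
      (\<Sum>l\<le>Suc s. dscale (qint Q (int (Suc s)) * Q ^ (n * (Suc s - l))) (V l))"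
    unfolding sum.distrib[symmetric]
  proof (rule sum.cong[OF refl])
    fix l assume "l \<in> {..Suc s}"
    then have "qint Q (int (Suc s)) = qint Q (int l) + Q ^ l * qint Q (int (Suc s - l))"
      using qint_add[of l "Suc s - l"] by simp
    then show "dscale (Q ^ (n * (Suc s - l)) * qint Q (int l)) (V l) +
        dscale (Q ^ (n * (Suc s - l)) * (Q ^ l * qint Q (int (Suc s - l)))) (V l) =
        dscale (qint Q (int (Suc s)) * Q ^ (n * (Suc s - l))) (V l)"
      by (simp only: distr.scale_left_distrib[symmetric]) (simp add: algebra_simps)
  qed
  also have "\<dots> = dscale (qint Q (int (Suc s))) (\<Sum>l\<le>Suc s. dscale (Q ^ (n * (Suc s - l))) (V l))"
    by (simp only: distr.scale_sum_right distr.scale_scale)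
  finally show ?case
    unfolding V_def by (rule distr.scale_left_imp_eq[OF qint_nonzero[of "Suc s"], rotated]) simp
qed

section \<open>Products with negative modes\<close>

lemma reg_val_sum_left:
  assumes "\<And>i. i \<in> A \<Longrightarrow> weighted m (f i)" "weighted k b" "m \<le> n"
  shows "reg_val n (\<Sum>i\<in>A. f i) b = (\<Sum>i\<in>A. reg_val n (f i) b)"
  using assms(1)
proof (induction A rule: infinite_finite_induct)
  case (insert x A)
  then have "reg_val n (f x + sum f A) b = reg_val n (f x) b + reg_val n (sum f A) b"
    by (intro reg_val_add_left[OF _ _ assms(2,3)] weighted_sum) auto
  moreover have "reg_val n (sum f A) b = (\<Sum>i\<in>A. reg_val n (f i) b)"
    by (rule insert.IH) (simp add: insert.prems)
  ultimately show ?case by (simp only: sum.insert[OF insert.hyps])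
qed (simp_all only: sum.infinite sum.empty reg_val_zero_left not_False_eq_True)

text \<open>The field in the product of \<open>a \<otimes> t^m\<close> and
  \<open>b \<otimes> t^k\<close> with mode -r-1. It does not depend on k, and the index
  \<open>m + r\<close> is the weight of the divided derivative.\<close>

definition mode_prod :: "nat \<Rightarrow> 'l distr \<Rightarrow> nat \<Rightarrow> 'l distr \<Rightarrow> 'l distr" where
  "mode_prod r a m b = reg_val (m + r) (divided_qderiv r a) b"

lemma weighted_mode_prod: "weighted m a \<Longrightarrow> weighted k b \<Longrightarrow> weighted (m + r + k) (mode_prod r a m b)"
  unfolding mode_prod_def by (intro weighted_reg_val[OF weighted_divided_qderiv]) auto

text \<open>The Leibniz rule expands the s-th derivative of the inner product, repeated derivatives
  of \<open>a\<close> merge with a q-binomial, and \<open>reg_val_assoc\<close> moves the bracket.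
  The powers of Q are those of the Leibniz rule at index m + r.\<close>

lemma mode_prod_assoc:
  assumes "weighted m a" "weighted k b" "weighted j c"
  shows "mode_prod s (mode_prod r a m b) (m + k + r) c =
    (\<Sum>l\<le>s. dscale (qbinom Q (int (l + r)) l * Q ^ ((s - l) * (m + r)))
      (mode_prod (r + l) a m (mode_prod (s - l) b k c)))"
proof -
  \<comment> \<open>The weight m + k + r of the inner product, raised by its s derivatives.\<close>
  define N where "N = m + k + r + s"
  have Wa: "weighted (m + r) (divided_qderiv r a)" using assms(1) by (rule weighted_divided_qderiv)
  have *: "divided_qderiv s (mode_prod r a m b) = (\<Sum>l\<le>s. dscale (qbinom Q (int (l + r)) l * Q ^ ((s - l) * (m + r)))
      (reg_val (m + r + l) (divided_qderiv (r + l) a) (divided_qderiv (s - l) b)))"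
    unfolding mode_prod_def divided_qderiv_reg_val[OF Wa assms(2) order_refl]
  proof (rule sum.cong[OF refl])
    fix l assume "l \<in> {..s}"
    have weighted: "weighted (m + (r + l)) (divided_qderiv (r + l) a)" "weighted (k + (s - l)) (divided_qderiv (s - l) b)"
      by (intro weighted_divided_qderiv assms)+
    have dd: "divided_qderiv l (divided_qderiv r a) = dscale (qbinom Q (int (l + r)) l) (divided_qderiv (r + l) a)"
      by (simp only: divided_qderiv_divided_qderiv qbinom_eq add.commute)
    have "reg_val (m + r + l) (divided_qderiv l (divided_qderiv r a)) (divided_qderiv (s - l) b) =
      dscale (qbinom Q (int (l + r)) l) (reg_val (m + r + l) (divided_qderiv (r + l) a) (divided_qderiv (s - l) b))"
      unfolding dd
      by (rule reg_val_dscale_left[OF weighted]) simp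
    then show "dscale (Q ^ ((m + r) * (s - l))) (reg_val (m + r + l) (divided_qderiv l (divided_qderiv r a)) (divided_qderiv (s - l) b)) =
      dscale (qbinom Q (int (l + r)) l * Q ^ ((s - l) * (m + r)))
        (reg_val (m + r + l) (divided_qderiv (r + l) a) (divided_qderiv (s - l) b))"
      by (simp only: distr.scale_scale mult.commute)
  qed
  have "mode_prod s (mode_prod r a m b) (m + k + r) c = reg_val N (divided_qderiv s (mode_prod r a m b)) c"
    by (simp add: mode_prod_def[of s] N_def)
  also have "\<dots> = (\<Sum>l\<le>s. reg_val N (dscale (qbinom Q (int (l + r)) l * Q ^ ((s - l) * (m + r)))
      (reg_val (m + r + l) (divided_qderiv (r + l) a) (divided_qderiv (s - l) b))) c)"
    unfolding *
  proof (rule reg_val_sum_left[OF _ assms(3) order_refl])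
    fix l assume "l \<in> {..s}"
    have "weighted (m + r + l + (k + (s - l))) (reg_val (m + r + l) (divided_qderiv (r + l) a) (divided_qderiv (s - l) b))"
      by (rule weighted_reg_val[OF weighted_divided_qderiv[OF assms(1)] weighted_divided_qderiv[OF assms(2)]]) simp
    then show "weighted N (dscale (qbinom Q (int (l + r)) l * Q ^ ((s - l) * (m + r)))
      (reg_val (m + r + l) (divided_qderiv (r + l) a) (divided_qderiv (s - l) b)))"
      using \<open>l \<in> {..s}\<close> by (intro weighted.dscale) (simp add: N_def algebra_simps)
  qed
  also have "\<dots> = (\<Sum>l\<le>s. dscale (qbinom Q (int (l + r)) l * Q ^ ((s - l) * (m + r)))
      (mode_prod (r + l) a m (mode_prod (s - l) b k c)))"
  proof (rule sum.cong[OF refl])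
    fix l assume l: "l \<in> {..s}"
    note weighted = weighted_divided_qderiv[OF assms(1), of "r + l"] weighted_divided_qderiv[OF assms(2), of "s - l"] assms(3)
    \<comment> \<open>The splitting required by \<open>reg_val_assoc\<close>: the weights of the two
      differentiated fields.\<close>
    have N: "N = (m + r + l) + (k + (s - l))" using l by (simp add: N_def)
    have "weighted N (reg_val (m + r + l) (divided_qderiv (r + l) a) (divided_qderiv (s - l) b))"
      unfolding N by (rule weighted_reg_val[OF weighted(1,2)]) simp
    then have "reg_val N (dscale d (reg_val (m + r + l) (divided_qderiv (r + l) a) (divided_qderiv (s - l) b))) c =
        dscale d (reg_val N (reg_val (m + r + l) (divided_qderiv (r + l) a) (divided_qderiv (s - l) b)) c)" for d
      by (rule reg_val_dscale_left[OF _ assms(3) order_refl])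
    moreover have "reg_val N (reg_val (m + r + l) (divided_qderiv (r + l) a) (divided_qderiv (s - l) b)) c =
        reg_val (m + r + l) (divided_qderiv (r + l) a) (reg_val (k + (s - l)) (divided_qderiv (s - l) b) c)"
      unfolding N by (rule reg_val_assoc[OF weighted]) simp_all
    ultimately show "reg_val N (dscale (qbinom Q (int (l + r)) l * Q ^ ((s - l) * (m + r)))
      (reg_val (m + r + l) (divided_qderiv (r + l) a) (divided_qderiv (s - l) b))) c =
      dscale (qbinom Q (int (l + r)) l * Q ^ ((s - l) * (m + r)))
      (mode_prod (r + l) a m (mode_prod (s - l) b k c))"
      by (simp add: mode_prod_def add.assoc)
  qed
  finally show ?thesis .
qed

end

section \<open>The products and the vertex algebra axioms\<close>

context q_calculus
begin

lemma coeff_scale_t [simp]: "coeff (scale_t scale c A) u = dscale c (coeff A u)"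
  unfolding scale_t_def dscale_def by (rule coeff_map_poly) (simp add: fun_eq_iff)

sublocale polyt: vector_space "scale_t scale"
  by unfold_locales
     (simp_all only: poly_eq_iff coeff_scale_t coeff_add distr.scale_right_distrib
        distr.scale_left_distrib distr.scale_scale distr.scale_one simp_thms)

lemma scale_t_monom: "scale_t scale c (monom a u) = monom (dscale c a) u"
  by (rule poly_eqI) (simp only: coeff_scale_t coeff_monom if_distrib[of "dscale c"] distr.scale_zero_right)

text \<open>With two variables the list of index pairs is \<open>[(0, 1)]\<close>, so the
  definitions in several variables reduce to one polynomial in z_2/z_1.\<close>

lemma shifted_ratio:
  "mult_ratios scale p 2 (shifted_product scale Q [(a, m), (b, k)]) \<kappa> v =
     poly_act p shift (prod2 a (dilate scale (Q ^ m) b) v) (\<kappa> 0, \<kappa> 1)"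
proof -
  have "[(i, j). j \<leftarrow> [0..<2], i \<leftarrow> [0..<j]] = [(0, 1 :: nat)]"
    by (simp add: upt_conv_Cons numeral_2_eq_2)
  then show ?thesis
    by (simp add: mult_ratios_def mult_ratio_def shifted_product_def poly_act_def shift_power prod2_def
        upt_conv_Cons numeral_2_eq_2 dilate_def)
qed

text \<open>Two conventions meet here: the definition dilates \<open>b\<close> and then sets the
  variables equal, the calculus leaves \<open>b\<close> alone and evaluates at the ratio Q^m. The
  polynomials correspond by f(x) = p(x / Q^m).\<close>

lemma poly_act_prod2_dilate:
  assumes "a \<in> flds"
  shows "poly_act p shift (prod2 a (dilate scale (Q ^ m) b) v) =
    (\<lambda>(i, j). scale ((Q ^ m) powi j) (poly_act (pcompose p [:0, 1 / Q ^ m:]) shift (prod2 a b v) (i, j)))"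
proof -
  let ?w = "\<lambda>(i :: int, j). (Q ^ m) powi j"
  let ?f = "pcompose p [:0, 1 / Q ^ m:]"
  have "prod2 a (dilate scale (Q ^ m) b) v = (\<lambda>x. scale (?w x) (prod2 a b v x))"
    using assms by (auto simp: prod2_def dilate_def flds_scale)
  moreover have "poly_act (pcompose ?f [:0, Q ^ m:]) shift (\<lambda>x. scale (?w x) (prod2 a b v x)) =
      (\<lambda>x. scale (?w x) (poly_act ?f shift (prod2 a b v) x))"
    by (rule poly_act_weight) (use Q_nonzero in \<open>auto simp: shift_def power_int_diff\<close>)
  moreover have "pcompose ?f [:0, Q ^ m:] = p"
  proof -
    have "pcompose [:0, 1 / Q ^ m:] [:0, Q ^ m:] = [:0, 1:]"
      using Q_nonzero by (simp add: pcompose_pCons)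
    then show ?thesis by (simp flip: pcompose_assoc)
  qed
  ultimately show ?thesis by (simp add: case_prod_unfold)
qed

lemma qc_witness_iff:
  assumes "a \<in> flds" "b \<in> flds"
  shows "qc_witness scale Q [(a, m), (b, k)] p \<longleftrightarrow>
    p \<in> poly0 Q \<and> (\<forall>v. regular2 (poly_act (pcompose p [:0, 1 / Q ^ m:]) shift (prod2 a b v)))"
proof -
  let ?u = "\<lambda>v. poly_act p shift (prod2 a (dilate scale (Q ^ m) b) v)"
  let ?F = "mult_ratios scale p 2 (shifted_product scale Q [(a, m), (b, k)])"
  have "lin (?F \<kappa>)" for \<kappa>
    by (rule linI)
       (simp_all add: shifted_ratio poly_act_def shift_power prod2_def dilate_def flds_add[OF assms(1)]
        flds_add[OF assms(2)] flds_scale[OF assms(1)] flds_scale[OF assms(2)]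
        scale_right_distrib sum.distrib scale_sum_right mult_ac)
  moreover have "?F \<kappa> = ?F \<kappa>'" if "\<forall>i<2. \<kappa> i = \<kappa>' i" for \<kappa> \<kappa>'
    using that by (auto simp: fun_eq_iff shifted_ratio)
  ultimately have "?F \<in> mfields scale 2 \<longleftrightarrow>
      (\<forall>v. \<exists>N. \<forall>\<kappa>. ?F \<kappa> v \<noteq> 0 \<longrightarrow> (\<forall>i<2. N \<le> \<kappa> i))"
    unfolding mfields_def by blast
  also have "\<dots> \<longleftrightarrow> (\<forall>v. regular2 (?u v))"
  proof -
    have "(\<exists>N. \<forall>\<kappa>. ?F \<kappa> v \<noteq> 0 \<longrightarrow> (\<forall>i<2. N \<le> \<kappa> i)) \<longleftrightarrow> regular2 (?u v)" for v
    proof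
      assume "\<exists>N. \<forall>\<kappa>. ?F \<kappa> v \<noteq> 0 \<longrightarrow> (\<forall>i<2. N \<le> \<kappa> i)"
      then obtain N where N: "\<And>\<kappa> i. ?F \<kappa> v \<noteq> 0 \<Longrightarrow> i < 2 \<Longrightarrow> N \<le> \<kappa> i" by blast
      show "regular2 (?u v)"
      proof (rule reg2I)
        fix i j assume nz: "?u v (i, j) \<noteq> 0"
        define \<kappa> where "\<kappa> = (\<lambda>t :: nat. if t = 0 then i else j)"
        from nz have "?F \<kappa> v \<noteq> 0" by (simp add: shifted_ratio \<kappa>_def)
        then show "N \<le> i \<and> N \<le> j"
          using N[of \<kappa> 0] N[of \<kappa> 1] by (simp add: \<kappa>_def)
      qed
    next
      assume "regular2 (?u v)"
      then obtain N where "\<And>i j. ?u v (i, j) \<noteq> 0 \<Longrightarrow> N \<le> i \<and> N \<le> j"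
        unfolding regular2_def by blast
      then have "\<forall>\<kappa>. ?F \<kappa> v \<noteq> 0 \<longrightarrow> (\<forall>i<2. N \<le> \<kappa> i)"
        by (auto simp: shifted_ratio less_2_cases_iff)
      then show "\<exists>N. \<forall>\<kappa>. ?F \<kappa> v \<noteq> 0 \<longrightarrow> (\<forall>i<2. N \<le> \<kappa> i)" by blast
    qed
    then show ?thesis by simp
  qed
  also have "\<dots> \<longleftrightarrow> (\<forall>v. regular2 (poly_act (pcompose p [:0, 1 / Q ^ m:]) shift (prod2 a b v)))"
    unfolding poly_act_prod2_dilate[OF assms(1)] regular2_def using Q_nonzero by simp
  finally show ?thesis
    by (simp add: qc_witness_def numeral_2_eq_2)
qed

lemma qc_witness_exists:
  assumes "a \<in> flds" "b \<in> flds" "regularizable2 m a b"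
  shows "\<exists>p. qc_witness scale Q [(a, m), (b, k)] p"
proof -
  obtain f where f: "nonvanishing_from m f" "\<And>v. regular2 (poly_act f shift (prod2 a b v))"
    using assms(3) by (auto simp: regularizable2_def)
  let ?c = "poly f (Q ^ m)"
  \<comment> \<open>Normalised to the value 1 at 1; at Q^n it is a nonzero multiple of
    f(Q^(m+n)).\<close>
  let ?p = "smult (1 / ?c) (pcompose f [:0, Q ^ m:])"
  have c: "?c \<noteq> 0" using goodD[OF f(1)] by simp
  have "?p \<in> poly0 Q"
    using c goodD[OF f(1)] by (simp add: poly0_def poly_dilation flip: power_add)
  moreover have "pcompose ?p [:0, 1 / Q ^ m:] = smult (1 / ?c) f"
  proof -
    have "pcompose [:0, Q ^ m:] [:0, 1 / Q ^ m:] = [:0, 1:]"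
      using Q_nonzero by (simp add: pcompose_pCons)
    then show ?thesis by (simp add: pcompose_smult flip: pcompose_assoc)
  qed
  moreover have "poly_act (smult (1 / ?c) f) shift u = (\<lambda>x. scale (1 / ?c) (poly_act f shift u x))" for u
    by (simp add: fun_eq_iff poly_act_smult_poly)
  ultimately show ?thesis
    using assms(1,2) f(2) by (auto simp: qc_witness_iff regular2_scale intro!: exI[of _ ?p])
qed

text \<open>Uniqueness of regularised values makes the choice of \<open>p\<close> immaterial. Since
  p(1) = 1, the polynomial \<open>?f\<close> is 1 at Q^m and no division is left.\<close>

lemma diagonal_eq_reg_val:
  assumes "a \<in> flds" "b \<in> flds" "regularizable2 m a b" "hs = [(a, m), (b, k)]"
  shows "diagonal (mult_ratios scale (SOME p. qc_witness scale Q hs p) 2 (shifted_product scale Q hs))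
    = reg_val m a b"
proof -
  define p where "p = (SOME p. qc_witness scale Q hs p)"
  let ?f = "pcompose p [:0, 1 / Q ^ m:]"
  let ?F = "mult_ratios scale p 2 (shifted_product scale Q hs)"
  have "qc_witness scale Q hs p"
    unfolding p_def assms(4) by (rule someI_ex) (rule qc_witness_exists[OF assms(1-3)])
  then have p: "p \<in> poly0 Q" "\<And>v. regular2 (poly_act ?f shift (prod2 a b v))"
    using assms(1,2) by (simp_all add: assms(4) qc_witness_iff)
  have f: "poly ?f (Q ^ m) = 1"
    using p(1) Q_nonzero by (simp add: poly0_def poly_dilation)
  have "diagonal ?F k v = ev (Q ^ m) (poly_act ?f shift (prod2 a b v)) k" for k v
  proof -
    let ?h = "poly_act ?f shift (prod2 a b v)"
    let ?c = "\<lambda>i. scale ((Q ^ m) powi (k - i)) (?h (i, k - i))"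
    have c: "?F (\<lambda>t. if t = 0 then i else k - i) v = ?c i" for i
      unfolding assms(4) shifted_ratio poly_act_prod2_dilate[OF assms(1)] by simp
    have "{x. add2 x = k \<and> ?h x \<noteq> 0} = (\<lambda>i. (i, k - i)) ` {i. ?c i \<noteq> 0}"
      using Q_nonzero by (auto simp: image_iff)
    then have "ev (Q ^ m) ?h k = (\<Sum>x\<in>(\<lambda>i. (i, k - i)) ` {i. ?c i \<noteq> 0}.
        scale (case x of (i, j) \<Rightarrow> (Q ^ m) powi j) (?h x))"
      by (simp only: ev_def push_def)
    also have "\<dots> = (\<Sum>i | ?c i \<noteq> 0. ?c i)"
      by (subst sum.reindex) (auto simp: inj_on_def)
    finally show ?thesis
      by (simp only: diagonal_def Let_def c)
  qed
  then have "is_reg_val_with ?f m a b (diagonal ?F)"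
    using p(2) by (simp add: is_reg_val_with_def f)
  then show ?thesis
    unfolding p_def by (intro reg_val_eq[symmetric] is_reg_val_with_is_reg_val)
qed

text \<open>The index matters: with index n the identity would produce b(Q^n z). The vacuum has
  weight 0, so 0 is the index that occurs.\<close>

lemma reg_val_one_left:
  assumes "b \<in> flds"
  shows "reg_val 0 one b = b"
proof (rule reg_val_eq)
  have h: "prod2 one b v (i, j) = (if i = 0 then b j v else 0)" for v i j
    by (simp add: prod2_def one_def)
  have "regular2 (prod2 one b v)" for v
  proof -
    obtain N where "\<And>k. k < N \<Longrightarrow> b k v = 0" using fldsD[OF assms] by blast
    then show ?thesis
      by (intro reg2I[of _ "min N 0"]) (force simp: h split: if_splits)
  qed
  moreover have "ev 1 (prod2 one b v) k = b k v" for k v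
  proof -
    have "ev 1 (prod2 one b v) k = (\<Sum>x\<in>{(0, k)}. scale (case x of (i, j) \<Rightarrow> 1 powi j) (prod2 one b v x))"
      unfolding ev_def by (rule push_eq) (auto simp: h split: if_splits)
    then show ?thesis by (simp add: h)
  qed
  moreover have "poly_act 1 shift u = u" for u by (simp add: fun_eq_iff)
  ultimately have "is_reg_val_with 1 0 one b b"
    by (simp add: is_reg_val_with_def)
  then show "is_reg_val 0 one b b" by (rule is_reg_val_with_is_reg_val)
qed

lemma reg_val_one_right:
  assumes "a \<in> flds"
  shows "reg_val n a one = a"
proof (rule reg_val_eq)
  have h: "prod2 a one v (i, j) = (if j = 0 then a i v else 0)" for v i j
    using assms by (simp add: prod2_def one_def flds_0)
  have "regular2 (prod2 a one v)" for v
  proof -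
    obtain N where "\<And>k. k < N \<Longrightarrow> a k v = 0" using fldsD[OF assms] by blast
    then show ?thesis
      by (intro reg2I[of _ "min N 0"]) (force simp: h split: if_splits)
  qed
  moreover have "ev c (prod2 a one v) k = a k v" for c k v
  proof -
    have "ev c (prod2 a one v) k = (\<Sum>x\<in>{(k, 0)}. scale (case x of (i, j) \<Rightarrow> c powi j) (prod2 a one v x))"
      unfolding ev_def by (rule push_eq) (auto simp: h split: if_splits)
    then show ?thesis by (simp add: h)
  qed
  moreover have "poly_act 1 shift u = u" for u by (simp add: fun_eq_iff)
  ultimately have "is_reg_val_with 1 n a one a"
    by (simp add: is_reg_val_with_def)
  then show "is_reg_val n a one a" by (rule is_reg_val_with_is_reg_val)
qed

lemma qderiv_one: "qderiv scale Q one = 0"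
  by (auto simp: qderiv_def dilate_def one_def fun_eq_iff)

end

section \<open>Bilinearity, vacuum and associativity on polynomials in t\<close>

context local_fields
begin

lemma divided_qderiv_one: "0 < r \<Longrightarrow> divided_qderiv r one = 0"
proof (induction r)
  case (Suc r)
  have "(qderiv scale Q ^^ r) 0 = 0"
    by (induction r) (simp_all only: funpow.simps comp_apply id_apply qderiv_zero)
  then have "(qderiv scale Q ^^ Suc r) one = 0"
    by (simp only: funpow_Suc_right comp_apply qderiv_one)
  then show ?case
    by (simp only: divided_qderiv_def distr.scale_zero_right)
qed simp

lemma weighted_one: "weighted 0 one"
  by (intro weighted.pure pure.one)

lemma divided_qderiv_zero: "divided_qderiv r 0 = 0"
  using divided_qderiv_dscale[of r 0 0] by simp

lemma mode_prod_zero_left: "mode_prod r 0 m b = 0"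
  by (simp only: mode_prod_def divided_qderiv_zero reg_val_zero_left)

lemma mode_prod_zero_right: "weighted m a \<Longrightarrow> mode_prod r a m 0 = 0"
  unfolding mode_prod_def by (intro reg_val_zero_right weighted_fields[OF weighted_divided_qderiv])

lemma mode_prod_add_left:
  "weighted m a \<Longrightarrow> weighted m a' \<Longrightarrow> weighted k b \<Longrightarrow> mode_prod r (a + a') m b = mode_prod r a m b + mode_prod r a' m b"
  unfolding mode_prod_def divided_qderiv_add by (intro reg_val_add_left[OF weighted_divided_qderiv weighted_divided_qderiv]) auto

lemma mode_prod_add_right:
  "weighted m a \<Longrightarrow> weighted k b \<Longrightarrow> weighted k b' \<Longrightarrow> mode_prod r a m (b + b') = mode_prod r a m b + mode_prod r a m b'"
  unfolding mode_prod_def by (intro reg_val_add_right[OF weighted_divided_qderiv]) auto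

lemma mode_prod_dscale_left: "weighted m a \<Longrightarrow> weighted k b \<Longrightarrow> mode_prod r (dscale c a) m b = dscale c (mode_prod r a m b)"
  unfolding mode_prod_def divided_qderiv_dscale by (intro reg_val_dscale_left[OF weighted_divided_qderiv]) auto

lemma mode_prod_dscale_right: "weighted m a \<Longrightarrow> weighted k b \<Longrightarrow> mode_prod r a m (dscale c b) = dscale c (mode_prod r a m b)"
  unfolding mode_prod_def by (intro reg_val_dscale_right[OF weighted_divided_qderiv]) auto

text \<open>The definition divides by the q-factorial after multiplying, \<open>mode_prod\<close>
  before; linearity in the left factor reconciles the two.\<close>

lemma hom_product_eq:
  assumes "weighted m a" "weighted k b"
  shows "hom_product scale Q r a m b k = monom (mode_prod r a m b) (m + k + r)"
proof -
  have weighted: "weighted (m + r) ((qderiv scale Q ^^ r) a)"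
    by (induction r) (use assms(1) in \<open>auto intro: weighted_qderiv\<close>)
  have "mode_prod r a m b = dscale (1 / qfact Q r) (reg_val (m + r) ((qderiv scale Q ^^ r) a) b)"
    unfolding mode_prod_def divided_qderiv_def by (rule reg_val_dscale_left[OF weighted assms(2)]) simp
  then show ?thesis
    unfolding hom_product_def Let_def
      diagonal_eq_reg_val[OF weighted_fields[OF weighted] weighted_fields[OF assms(2)] weighted_regularizable2[OF weighted assms(2)] refl]
    by (simp only: dscale_def)
qed

text \<open>The ambient space in which all products exist and all identities hold; the vertex
  algebra is a subspace of it.\<close>

definition weighted_polys :: "'l distr poly set" where
  "weighted_polys = {A. \<forall>u. weighted u (coeff A u)}"

lemma VVD: "A \<in> weighted_polys \<Longrightarrow> weighted u (coeff A u)"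
  by (simp add: weighted_polys_def)

lemma subspace_weighted_polys: "polyt.subspace weighted_polys"
  by (rule polyt.subspaceI)
     (simp_all only: weighted_polys_def mem_Collect_eq coeff_0 coeff_add coeff_scale_t weighted.intros simp_thms)

lemma weighted_polys_monom: "weighted u a \<Longrightarrow> monom a u \<in> weighted_polys"
  unfolding weighted_polys_def by (simp only: mem_Collect_eq coeff_monom weighted.zero split: if_split) blast

lemma weighted_polys_zero: "0 \<in> weighted_polys"
  using polyt.subspace_0[OF subspace_weighted_polys] .

lemma weighted_polys_add: "A \<in> weighted_polys \<Longrightarrow> B \<in> weighted_polys \<Longrightarrow> A + B \<in> weighted_polys"
  using polyt.subspace_add[OF subspace_weighted_polys] .

lemma weighted_polys_scale: "A \<in> weighted_polys \<Longrightarrow> scale_t scale c A \<in> weighted_polys"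
  using polyt.subspace_scale[OF subspace_weighted_polys] .

lemma weighted_polys_sum: "(\<And>i. i \<in> I \<Longrightarrow> A i \<in> weighted_polys) \<Longrightarrow> (\<Sum>i\<in>I. A i) \<in> weighted_polys"
  using polyt.subspace_sum[OF subspace_weighted_polys] .

text \<open>The degree of a sum may drop or depend on one summand, so additivity needs double sums
  over a common range.\<close>

lemma nth_product_bound:
  assumes "A \<in> weighted_polys" "B \<in> weighted_polys" "degree A \<le> N" "degree B \<le> M" "s = - int r - 1"
  shows "nth_product scale Q A s B =
    (\<Sum>\<alpha>\<le>N. \<Sum>\<beta>\<le>M. monom (mode_prod r (coeff A \<alpha>) \<alpha> (coeff B \<beta>)) (\<alpha> + \<beta> + r))"
proof -
  have "nth_product scale Q A s B =
    (\<Sum>\<alpha>\<le>degree A. \<Sum>\<beta>\<le>degree B. monom (mode_prod r (coeff A \<alpha>) \<alpha> (coeff B \<beta>)) (\<alpha> + \<beta> + r))"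
    using assms(5) by (simp add: nth_product_def hom_product_eq[OF VVD[OF assms(1)] VVD[OF assms(2)]])
  also have "\<dots> = (\<Sum>\<alpha>\<le>degree A. \<Sum>\<beta>\<le>M. monom (mode_prod r (coeff A \<alpha>) \<alpha> (coeff B \<beta>)) (\<alpha> + \<beta> + r))"
  proof (rule sum.cong[OF refl], rule sum.mono_neutral_left)
    fix \<alpha>
    show "\<forall>\<beta>\<in>{..M} - {..degree B}. monom (mode_prod r (coeff A \<alpha>) \<alpha> (coeff B \<beta>)) (\<alpha> + \<beta> + r) = 0"
    proof
      fix \<beta> assume "\<beta> \<in> {..M} - {..degree B}"
      then have "coeff B \<beta> = 0" by (simp add: coeff_eq_0)
      then show "monom (mode_prod r (coeff A \<alpha>) \<alpha> (coeff B \<beta>)) (\<alpha> + \<beta> + r) = 0"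
        by (simp only: mode_prod_zero_right[OF VVD[OF assms(1)]] monom_eq_0)
    qed
  qed (use assms(4) in auto)
  also have "\<dots> = (\<Sum>\<alpha>\<le>N. \<Sum>\<beta>\<le>M. monom (mode_prod r (coeff A \<alpha>) \<alpha> (coeff B \<beta>)) (\<alpha> + \<beta> + r))"
  proof (rule sum.mono_neutral_left)
    show "\<forall>\<alpha>\<in>{..N} - {..degree A}. (\<Sum>\<beta>\<le>M. monom (mode_prod r (coeff A \<alpha>) \<alpha> (coeff B \<beta>)) (\<alpha> + \<beta> + r)) = 0"
    proof
      fix \<alpha> assume "\<alpha> \<in> {..N} - {..degree A}"
      then have "coeff A \<alpha> = 0" by (simp add: coeff_eq_0)
      then show "(\<Sum>\<beta>\<le>M. monom (mode_prod r (coeff A \<alpha>) \<alpha> (coeff B \<beta>)) (\<alpha> + \<beta> + r)) = 0"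
        by (simp only: mode_prod_zero_left monom_eq_0 sum.neutral_const)
    qed
  qed (use assms(3) in auto)
  finally show ?thesis .
qed

lemma nth_product_nonneg: "0 \<le> s \<Longrightarrow> nth_product scale Q A s B = 0"
  by (simp add: nth_product_def)

lemma negE:
  assumes "\<not> 0 \<le> (s :: int)"
  obtains r where "s = - int r - 1"
  by (rule that[of "nat (- s - 1)"]) (use assms in simp)

lemma weighted_polys_nth_product:
  assumes "A \<in> weighted_polys" "B \<in> weighted_polys"
  shows "nth_product scale Q A s B \<in> weighted_polys"
proof (cases "0 \<le> s")
  case True
  then show ?thesis by (simp add: nth_product_nonneg weighted_polys_zero)
next
  case False
  then obtain r where r: "s = - int r - 1" by (rule negE)
  have "weighted (\<alpha> + \<beta> + r) (mode_prod r (coeff A \<alpha>) \<alpha> (coeff B \<beta>))" for \<alpha> \<beta>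
    using weighted_mode_prod[OF VVD[OF assms(1)] VVD[OF assms(2)], of \<alpha> r \<beta>] by (simp add: ac_simps)
  then show ?thesis
    unfolding nth_product_bound[OF assms order_refl order_refl r]
    by (intro weighted_polys_sum weighted_polys_monom)
qed

lemma nth_product_add_left:
  assumes "A \<in> weighted_polys" "A' \<in> weighted_polys" "B \<in> weighted_polys"
  shows "nth_product scale Q (A + A') s B = nth_product scale Q A s B + nth_product scale Q A' s B"
proof (cases "0 \<le> s")
  case False
  then obtain r where r: "s = - int r - 1" by (rule negE)
  let ?N = "max (degree A) (degree A')"
  have "degree (A + A') \<le> ?N" by (rule degree_add_le_max)
  note b1 = nth_product_bound[OF weighted_polys_add[OF assms(1,2)] assms(3) this order_refl r]
  note b2 = nth_product_bound[OF assms(1,3) max.cobounded1 order_refl r, of "degree A'"]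
  note b3 = nth_product_bound[OF assms(2,3) max.cobounded2 order_refl r, of "degree A"]
  show ?thesis
    unfolding b1 b2 b3
    by (simp only: coeff_add mode_prod_add_left[OF VVD[OF assms(1)] VVD[OF assms(2)] VVD[OF assms(3)]]
        add_monom[symmetric] sum.distrib)
qed (simp add: nth_product_nonneg)

lemma nth_product_add_right:
  assumes "A \<in> weighted_polys" "B \<in> weighted_polys" "B' \<in> weighted_polys"
  shows "nth_product scale Q A s (B + B') = nth_product scale Q A s B + nth_product scale Q A s B'"
proof (cases "0 \<le> s")
  case False
  then obtain r where r: "s = - int r - 1" by (rule negE)
  let ?N = "max (degree B) (degree B')"
  have "degree (B + B') \<le> ?N" by (rule degree_add_le_max)
  note b1 = nth_product_bound[OF assms(1) weighted_polys_add[OF assms(2,3)] order_refl this r]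
  note b2 = nth_product_bound[OF assms(1,2) order_refl max.cobounded1 r, of "degree B'"]
  note b3 = nth_product_bound[OF assms(1,3) order_refl max.cobounded2 r, of "degree B"]
  show ?thesis
    unfolding b1 b2 b3
    by (simp only: coeff_add mode_prod_add_right[OF VVD[OF assms(1)] VVD[OF assms(2)] VVD[OF assms(3)]]
        add_monom[symmetric] sum.distrib)
qed (simp add: nth_product_nonneg)

lemma degree_scale_t: "degree (scale_t scale c A) \<le> degree A"
  by (rule degree_le) (simp add: coeff_eq_0)

lemma nth_product_scale_left:
  assumes "A \<in> weighted_polys" "B \<in> weighted_polys"
  shows "nth_product scale Q (scale_t scale c A) s B = scale_t scale c (nth_product scale Q A s B)"
proof (cases "0 \<le> s")
  case False
  then obtain r where r: "s = - int r - 1" by (rule negE)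
  show ?thesis
    unfolding nth_product_bound[OF weighted_polys_scale[OF assms(1)] assms(2) degree_scale_t order_refl r]
      nth_product_bound[OF assms order_refl order_refl r]
    by (simp only: coeff_scale_t mode_prod_dscale_left[OF VVD[OF assms(1)] VVD[OF assms(2)]]
        scale_t_monom polyt.scale_sum_right)
qed (simp add: nth_product_nonneg)

lemma nth_product_scale_right:
  assumes "A \<in> weighted_polys" "B \<in> weighted_polys"
  shows "nth_product scale Q A s (scale_t scale c B) = scale_t scale c (nth_product scale Q A s B)"
proof (cases "0 \<le> s")
  case False
  then obtain r where r: "s = - int r - 1" by (rule negE)
  show ?thesis
    unfolding nth_product_bound[OF assms(1) weighted_polys_scale[OF assms(2)] order_refl degree_scale_t r]
      nth_product_bound[OF assms order_refl order_refl r]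
    by (simp only: coeff_scale_t mode_prod_dscale_right[OF VVD[OF assms(1)] VVD[OF assms(2)]]
        scale_t_monom polyt.scale_sum_right)
qed (simp add: nth_product_nonneg)

lemma nth_product_zero_left: "B \<in> weighted_polys \<Longrightarrow> nth_product scale Q 0 s B = 0"
  using nth_product_scale_left[OF weighted_polys_zero, where c = 0 and s = s] by simp

lemma nth_product_zero_right: "A \<in> weighted_polys \<Longrightarrow> nth_product scale Q A s 0 = 0"
  using nth_product_scale_right[OF _ weighted_polys_zero, where c = 0 and s = s] by simp

lemma nth_product_monom:
  assumes "weighted \<alpha> a" "B \<in> weighted_polys" "s = - int r - 1"
  shows "nth_product scale Q (monom a \<alpha>) s B =
    (\<Sum>\<beta>\<le>degree B. monom (mode_prod r a \<alpha> (coeff B \<beta>)) (\<alpha> + \<beta> + r))"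
proof -
  have "nth_product scale Q (monom a \<alpha>) s B = (\<Sum>\<alpha>'\<le>\<alpha>. \<Sum>\<beta>\<le>degree B.
      monom (mode_prod r (coeff (monom a \<alpha>) \<alpha>') \<alpha>' (coeff B \<beta>)) (\<alpha>' + \<beta> + r))"
    by (rule nth_product_bound[OF weighted_polys_monom[OF assms(1)] assms(2) degree_monom_le order_refl assms(3)])
  also have "\<dots> = (\<Sum>\<alpha>'\<in>{\<alpha>}. \<Sum>\<beta>\<le>degree B.
      monom (mode_prod r (coeff (monom a \<alpha>) \<alpha>') \<alpha>' (coeff B \<beta>)) (\<alpha>' + \<beta> + r))"
  proof (rule sum.mono_neutral_right)
    show "\<forall>\<alpha>'\<in>{..\<alpha>} - {\<alpha>}. (\<Sum>\<beta>\<le>degree B.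
      monom (mode_prod r (coeff (monom a \<alpha>) \<alpha>') \<alpha>' (coeff B \<beta>)) (\<alpha>' + \<beta> + r)) = 0"
    proof
      fix \<alpha>' assume "\<alpha>' \<in> {..\<alpha>} - {\<alpha>}"
      then have "coeff (monom a \<alpha>) \<alpha>' = 0" by simp
      then show "(\<Sum>\<beta>\<le>degree B.
        monom (mode_prod r (coeff (monom a \<alpha>) \<alpha>') \<alpha>' (coeff B \<beta>)) (\<alpha>' + \<beta> + r)) = 0"
        by (simp only: mode_prod_zero_left monom_eq_0 sum.neutral_const)
    qed
  qed auto
  finally show ?thesis by simp
qed

lemma nth_product_monom_monom:
  assumes "weighted \<alpha> a" "weighted \<beta> b" "s = - int r - 1"
  shows "nth_product scale Q (monom a \<alpha>) s (monom b \<beta>) = monom (mode_prod r a \<alpha> b) (\<alpha> + \<beta> + r)"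
\<comment> \<open>The zero monomial has degree 0 rather than \<open>\<beta>\<close>, which would
  change the range of summation.\<close>
proof (cases "b = 0")
  case True
  then show ?thesis
    using nth_product_zero_right[OF weighted_polys_monom[OF assms(1)]] mode_prod_zero_right[OF assms(1)]
    by (simp only: monom_eq_0)
next
  case False
  then have deg: "degree (monom b \<beta>) = \<beta>" by (rule degree_monom_eq)
  have "nth_product scale Q (monom a \<alpha>) s (monom b \<beta>) =
      (\<Sum>\<beta>'\<le>\<beta>. monom (mode_prod r a \<alpha> (coeff (monom b \<beta>) \<beta>')) (\<alpha> + \<beta>' + r))"
    using nth_product_monom[OF assms(1) weighted_polys_monom[OF assms(2)] assms(3)] by (simp only: deg)
  also have "\<dots> = (\<Sum>\<beta>'\<in>{\<beta>}. monom (mode_prod r a \<alpha> (coeff (monom b \<beta>) \<beta>')) (\<alpha> + \<beta>' + r))"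
  proof (rule sum.mono_neutral_right)
    show "\<forall>\<beta>'\<in>{..\<beta>} - {\<beta>}. monom (mode_prod r a \<alpha> (coeff (monom b \<beta>) \<beta>')) (\<alpha> + \<beta>' + r) = 0"
    proof
      fix \<beta>' assume "\<beta>' \<in> {..\<beta>} - {\<beta>}"
      then have "coeff (monom b \<beta>) \<beta>' = 0" by simp
      then show "monom (mode_prod r a \<alpha> (coeff (monom b \<beta>) \<beta>')) (\<alpha> + \<beta>' + r) = 0"
        by (simp only: mode_prod_zero_right[OF assms(1)] monom_eq_0)
    qed
  qed auto
  finally show ?thesis by simp
qed

lemma vacuum_eq: "vacuum = monom one 0"
  by (simp add: vacuum_def one_def)

lemma vacuum_weighted_polys: "vacuum \<in> weighted_polys"
  unfolding vacuum_eq by (rule weighted_polys_monom[OF weighted_one])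

lemma vacuum_product:
  assumes "B \<in> weighted_polys"
  shows "nth_product scale Q vacuum r B = (if r = -1 then B else 0)"
proof (cases "0 \<le> r")
  case False
  then obtain s where s: "r = - int s - 1" by (rule negE)
  have eq: "nth_product scale Q vacuum r B = (\<Sum>\<beta>\<le>degree B. monom (mode_prod s one 0 (coeff B \<beta>)) (\<beta> + s))"
    using nth_product_monom[OF weighted_one assms s] by (simp only: vacuum_eq add_0)
  show ?thesis
  proof (cases "s = 0")
    case True
    have "mode_prod 0 one 0 b = b" if "b \<in> flds" for b
      using reg_val_one_left[OF that] by (simp add: mode_prod_def)
    then have "nth_product scale Q vacuum r B = (\<Sum>\<beta>\<le>degree B. monom (coeff B \<beta>) \<beta>)"
      unfolding eq True using weighted_fields[OF VVD[OF assms]] by simp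
    then show ?thesis
      using s True by (simp add: poly_as_sum_of_monoms)
  next
    case False
    then have "mode_prod s one 0 b = 0" for b
      by (simp only: mode_prod_def divided_qderiv_one reg_val_zero_left neq0_conv)
    then have "nth_product scale Q vacuum r B = 0"
      unfolding eq by (simp only: monom_eq_0 sum.neutral_const)
    then show ?thesis using False s by simp
  qed
qed (simp add: nth_product_nonneg)

lemma product_vacuum:
  assumes "A \<in> weighted_polys"
  shows "nth_product scale Q A (-1) vacuum = A"
proof -
  have *: "mode_prod 0 (coeff A \<alpha>) \<alpha> one = coeff A \<alpha>" for \<alpha>
    using reg_val_one_right[OF weighted_fields[OF VVD[OF assms]]] by (simp add: mode_prod_def)
  have "nth_product scale Q A (-1) vacuum = (\<Sum>\<alpha>\<le>degree A. \<Sum>\<beta>\<le>0.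
      monom (mode_prod 0 (coeff A \<alpha>) \<alpha> (coeff vacuum \<beta>)) (\<alpha> + \<beta> + 0))"
    by (rule nth_product_bound[OF assms vacuum_weighted_polys order_refl])
       (use degree_monom_le[of one 0] in \<open>simp_all add: vacuum_eq\<close>)
  also have "\<dots> = (\<Sum>\<alpha>\<le>degree A. monom (coeff A \<alpha>) \<alpha>)"
    by (simp add: vacuum_eq *)
  finally show ?thesis by (simp add: poly_as_sum_of_monoms)
qed

text \<open>The right side of the associativity axiom with modes -r-1 and -s-1 in place of r and s:
  the q-binomial becomes that of l + r over l, the exponent of Q becomes (s - l)(\<alpha> + r), and
  terms with l > s vanish.\<close>

definition assoc_rhs :: "nat \<Rightarrow> 'l distr \<Rightarrow> nat \<Rightarrow> nat \<Rightarrow> 'l distr poly \<Rightarrow> 'l distr poly \<Rightarrow> 'l distr poly" where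
  "assoc_rhs \<alpha> a r s B C = (\<Sum>l\<le>s. scale_t scale (qbinom Q (int (l + r)) l * Q ^ ((s - l) * (\<alpha> + r)))
     (nth_product scale Q (monom a \<alpha>) (- int (r + l) - 1) (nth_product scale Q B (- int (s - l) - 1) C)))"

lemma assoc_rhs_add_left:
  assumes "weighted \<alpha> a" "B \<in> weighted_polys" "B' \<in> weighted_polys" "C \<in> weighted_polys"
  shows "assoc_rhs \<alpha> a r s (B + B') C = assoc_rhs \<alpha> a r s B C + assoc_rhs \<alpha> a r s B' C"
  unfolding assoc_rhs_def
  by (simp only: nth_product_add_left[OF assms(2-4)] sum.distrib polyt.scale_right_distrib
      nth_product_add_right[OF weighted_polys_monom[OF assms(1)] weighted_polys_nth_product[OF assms(2,4)] weighted_polys_nth_product[OF assms(3,4)]])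

lemma assoc_rhs_add_right:
  assumes "weighted \<alpha> a" "B \<in> weighted_polys" "C \<in> weighted_polys" "C' \<in> weighted_polys"
  shows "assoc_rhs \<alpha> a r s B (C + C') = assoc_rhs \<alpha> a r s B C + assoc_rhs \<alpha> a r s B C'"
  unfolding assoc_rhs_def
  by (simp only: nth_product_add_right[OF assms(2-4)] sum.distrib polyt.scale_right_distrib
      nth_product_add_right[OF weighted_polys_monom[OF assms(1)] weighted_polys_nth_product[OF assms(2,3)] weighted_polys_nth_product[OF assms(2,4)]])

text \<open>This is \<open>mode_prod_assoc\<close> supplied with powers of t: r + l and s - l always
  add up to r + s, so all terms carry the same power.\<close>

lemma assoc_monom:
  assumes "weighted \<alpha> a" "weighted \<beta> b" "weighted \<gamma> c"
  shows "nth_product scale Q (nth_product scale Q (monom a \<alpha>) (- int r - 1) (monom b \<beta>))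
      (- int s - 1) (monom c \<gamma>) = assoc_rhs \<alpha> a r s (monom b \<beta>) (monom c \<gamma>)"
proof -
  have weighted: "weighted (\<alpha> + \<beta> + r) (mode_prod r a \<alpha> b)"
    using weighted_mode_prod[OF assms(1,2), of r] by (simp add: ac_simps)
  have weighted': "weighted (\<beta> + \<gamma> + t) (mode_prod t b \<beta> c)" for t
    using weighted_mode_prod[OF assms(2,3), of t] by (simp add: ac_simps)
  have monom_sum: "monom (sum f A) u = (\<Sum>i\<in>A. monom (f i) u)" for f :: "nat \<Rightarrow> 'l distr" and A u
    by (induction A rule: infinite_finite_induct)
       (simp_all only: sum.infinite sum.empty sum.insert not_False_eq_True monom_eq_0 add_monom[symmetric])
  have "nth_product scale Q (nth_product scale Q (monom a \<alpha>) (- int r - 1) (monom b \<beta>))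
      (- int s - 1) (monom c \<gamma>) = monom (mode_prod s (mode_prod r a \<alpha> b) (\<alpha> + \<beta> + r) c) (\<alpha> + \<beta> + r + \<gamma> + s)"
    by (simp only: nth_product_monom_monom[OF assms(1,2) refl] nth_product_monom_monom[OF weighted assms(3) refl])
  also have "\<dots> = (\<Sum>l\<le>s. scale_t scale (qbinom Q (int (l + r)) l * Q ^ ((s - l) * (\<alpha> + r)))
      (monom (mode_prod (r + l) a \<alpha> (mode_prod (s - l) b \<beta> c)) (\<alpha> + \<beta> + r + \<gamma> + s)))"
    by (simp only: mode_prod_assoc[OF assms] monom_sum scale_t_monom)
  also have "\<dots> = assoc_rhs \<alpha> a r s (monom b \<beta>) (monom c \<gamma>)"
    unfolding assoc_rhs_def
  proof (rule sum.cong[OF refl])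
    fix l assume "l \<in> {..s}"
    then have "\<alpha> + (\<beta> + \<gamma> + (s - l)) + (r + l) = \<alpha> + \<beta> + r + \<gamma> + s" by simp
    then show "scale_t scale (qbinom Q (int (l + r)) l * Q ^ ((s - l) * (\<alpha> + r)))
        (monom (mode_prod (r + l) a \<alpha> (mode_prod (s - l) b \<beta> c)) (\<alpha> + \<beta> + r + \<gamma> + s)) =
      scale_t scale (qbinom Q (int (l + r)) l * Q ^ ((s - l) * (\<alpha> + r)))
        (nth_product scale Q (monom a \<alpha>) (- int (r + l) - 1)
          (nth_product scale Q (monom b \<beta>) (- int (s - l) - 1) (monom c \<gamma>)))"
      by (simp only: nth_product_monom_monom[OF assms(2,3) refl] nth_product_monom_monom[OF assms(1) weighted' refl])
  qed
  finally show ?thesis .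
qed

lemma weighted_polys_induct [consumes 1, case_names zero monom add]:
  assumes "A \<in> weighted_polys" "P 0" "\<And>a u. weighted u a \<Longrightarrow> P (monom a u)"
    and "\<And>A B. A \<in> weighted_polys \<Longrightarrow> B \<in> weighted_polys \<Longrightarrow> P A \<Longrightarrow> P B \<Longrightarrow> P (A + B)"
  shows "P A"
proof -
  have "P (\<Sum>i\<le>n. monom (coeff A i) i) \<and> (\<Sum>i\<le>n. monom (coeff A i) i) \<in> weighted_polys" for n
  proof (induction n)
    case 0
    show ?case
      using assms(3)[OF VVD[OF assms(1)], of 0] weighted_polys_monom[OF VVD[OF assms(1)], of 0] by simp
  next
    case (Suc n)
    then show ?case
      using assms(3)[OF VVD[OF assms(1)], of "Suc n"] weighted_polys_monom[OF VVD[OF assms(1)], of "Suc n"]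
      by (simp add: assms(4) weighted_polys_add)
  qed
  from this[of "degree A"] show ?thesis
    by (simp add: poly_as_sum_of_monoms)
qed

text \<open>Both sides are additive in \<open>B\<close> and \<open>C\<close>, which reduces these to
  monomials. The first factor stays homogeneous because its weight enters the right side.\<close>

lemma product_assoc:
  assumes "weighted \<alpha> a" "B \<in> weighted_polys" "C \<in> weighted_polys"
  shows "nth_product scale Q (nth_product scale Q (monom a \<alpha>) (- int r - 1) B) (- int s - 1) C =
    assoc_rhs \<alpha> a r s B C"
proof -
  note aV = weighted_polys_monom[OF assms(1)]
  have rhs0: "assoc_rhs \<alpha> a r s 0 C = 0" if "C \<in> weighted_polys" for C
    using assoc_rhs_add_left[OF assms(1) weighted_polys_zero weighted_polys_zero that, of r s] by simp
  have rhs0': "assoc_rhs \<alpha> a r s B 0 = 0" if "B \<in> weighted_polys" for B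
    using assoc_rhs_add_right[OF assms(1) that weighted_polys_zero weighted_polys_zero, of r s] by simp
  show ?thesis using assms(2)
  proof (induction B rule: weighted_polys_induct)
    case zero
    show ?case
      by (simp only: nth_product_zero_right[OF aV] nth_product_zero_left[OF assms(3)] rhs0[OF assms(3)])
  next
    case (monom b u)
    note bV = weighted_polys_monom[OF monom]
    note abV = weighted_polys_nth_product[OF aV bV]
    show ?case using assms(3)
    proof (induction C rule: weighted_polys_induct)
      case zero
      show ?case by (simp only: nth_product_zero_right[OF abV] rhs0'[OF bV])
    next
      case (monom c w)
      show ?case by (rule assoc_monom[OF assms(1) \<open>weighted u b\<close> monom])
    next
      case (add C C')
      then show ?case
        by (simp only: nth_product_add_right[OF abV add.hyps] assoc_rhs_add_right[OF assms(1) bV add.hyps])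
    qed
  next
    case (add B B')
    then show ?case
      by (simp only: nth_product_add_right[OF aV add.hyps] assoc_rhs_add_left[OF assms(1) add.hyps assms(3)]
          nth_product_add_left[OF weighted_polys_nth_product[OF aV add.hyps(1)] weighted_polys_nth_product[OF aV add.hyps(2)] assms(3)])
  qed
qed

lemma quasi_commutative_weighted_polys:
  assumes "A \<in> weighted_polys" "B \<in> weighted_polys"
  shows "quasi_commutative scale Q [A, B]"
  unfolding quasi_commutative_def
proof (intro allI impI)
  fix us :: "nat list" assume "length us = length [A, B]"
  then obtain u w where us: "us = [u, w]"
    by (auto simp: length_Suc_conv)
  note weighted = VVD[OF assms(1), of u] VVD[OF assms(2), of w]
  show "\<exists>p. qc_witness scale Q (map2 (\<lambda>A u. (coeff A u, u)) [A, B] us) p"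
    using qc_witness_exists[OF weighted_fields[OF weighted(1)] weighted_fields[OF weighted(2)] weighted_regularizable2[OF weighted]] by (simp add: us)
qed

end

section \<open>The grading by powers of t\<close>

lemma weight_space_zero: "0 \<in> V \<Longrightarrow> 0 \<in> weight_space V u"
  using monom_eq_0[of "nat u"] unfolding weight_space_def by auto

lemma weight_spaceI: "monom a k \<in> V \<Longrightarrow> monom a k \<in> weight_space V (int k)"
  by (auto simp: weight_space_def)

lemma weight_spaceE:
  assumes "A \<in> weight_space V u"
  shows "A = 0 \<or> (\<exists>a k. u = int k \<and> A = monom a k \<and> A \<in> V)"
proof (cases u rule: int_cases)
  case (nonneg k)
  then have "\<exists>a. A = monom a k \<and> monom a k \<in> V"
    using assms by (simp add: weight_space_def)
  then show ?thesis using nonneg by blast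
qed (use assms in \<open>simp add: weight_space_def\<close>)

lemma coeff_weight_space:
  assumes "A \<in> weight_space V u" "u \<noteq> int k"
  shows "coeff A k = 0"
  using weight_spaceE[OF assms(1)] assms(2) by auto

lemma weight_decomposition:
  assumes V0: "0 \<in> V" and homog: "\<And>u. monom (coeff A u) u \<in> V"
  shows "\<exists>!c. (\<forall>u. c u \<in> weight_space V u) \<and> finite {u. c u \<noteq> 0} \<and> A = (\<Sum>u | c u \<noteq> 0. c u)"
    (is "\<exists>!c. ?P c")
proof (rule ex1I)
  \<comment> \<open>The homogeneous components; no power of t belongs to a negative weight, so the
    component there is 0.\<close>
  define c0 where "c0 u = (if u < 0 then 0 else monom (coeff A (nat u)) (nat u))" for u
  have c0_int: "c0 (int k) = monom (coeff A k) k" for k by (simp add: c0_def)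
  have sub: "{u. c0 u \<noteq> 0} \<subseteq> int ` {..degree A}"
  proof
    fix u assume u: "u \<in> {u. c0 u \<noteq> 0}"
    then obtain k where k: "u = int k"
      by (cases u rule: int_cases) (auto simp: c0_def)
    have "coeff A k \<noteq> 0"
    proof
      assume "coeff A k = 0"
      then have "c0 u = 0" unfolding k c0_int by (simp only: monom_eq_0)
      then show False using u by simp
    qed
    then show "u \<in> int ` {..degree A}" unfolding k by (intro imageI) (simp add: le_degree)
  qed
  have "(\<Sum>u | c0 u \<noteq> 0. c0 u) = (\<Sum>u\<in>int ` {..degree A}. c0 u)"
    by (rule sum.mono_neutral_left) (use sub in auto)
  also have "\<dots> = (\<Sum>k\<le>degree A. monom (coeff A k) k)"
    by (subst sum.reindex) (simp_all only: c0_int inj_on_of_nat o_def)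
  finally have "A = (\<Sum>u | c0 u \<noteq> 0. c0 u)"
    by (simp only: poly_as_sum_of_monoms)
  moreover have "c0 u \<in> weight_space V u" for u
    by (cases u rule: int_cases)
       (simp_all only: c0_int weight_spaceI[OF homog], simp add: c0_def weight_space_def)
  ultimately show "?P c0"
    using finite_subset[OF sub] by blast
  fix c assume c: "?P c"
  show "c = c0"
  proof
    fix u
    show "c u = c0 u"
    proof (cases u rule: int_cases)
      case (nonneg k)
      \<comment> \<open>Uniqueness by comparing coefficients: only the component of weight k
        contributes to t^k.\<close>
      have coeff_c: "coeff (c w) j = 0" if "w \<noteq> int j" for w j
        using c that coeff_weight_space by blast
      have "coeff A k = coeff (\<Sum>w | c w \<noteq> 0. c w) k" using c by simp
      also have "\<dots> = (\<Sum>w | c w \<noteq> 0. coeff (c w) k)" by (rule coeff_sum)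
      also have "\<dots> = (\<Sum>w\<in>{u}. coeff (c w) k)"
        by (rule sum.mono_neutral_cong) (use c nonneg coeff_c[of _ k] in auto)
      finally have A: "coeff A k = coeff (c u) k" by simp
      have "coeff (c u) j = coeff (monom (coeff A k) k) j" for j
        using coeff_c[of u j] A by (cases "j = k") (simp_all add: nonneg)
      then show ?thesis
        unfolding nonneg c0_int by (intro poly_eqI) (simp add: nonneg)
    next
      case (neg k)
      have "c u \<in> weight_space V u" using c by blast
      then show ?thesis by (simp add: neg c0_def weight_space_def)
    qed
  qed
qed

section \<open>The vertex algebra axioms for subspaces\<close>

context local_fields
begin

lemma product_assoc_weighted:
  assumes A: "A = 0 \<or> (\<exists>a k. u = int k \<and> A = monom a k \<and> weighted k a)" and B: "B \<in> weighted_polys" and C: "C \<in> weighted_polys"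
  shows "nth_product scale Q (nth_product scale Q A r B) s C =
        (\<Sum>l | nth_product scale Q B (s + int l) C \<noteq> 0.
          scale_t scale (qbinom Q (int l - r - 1) l * Q powi ((s + int l + 1) * (r - u + 1)))
            (nth_product scale Q A (r - int l) (nth_product scale Q B (s + int l) C)))"
proof -
  let ?Y = "nth_product scale Q"
  let ?t = "\<lambda>l. scale_t scale (qbinom Q (int l - r - 1) l * Q powi ((s + int l + 1) * (r - u + 1)))
      (?Y A (r - int l) (?Y B (s + int l) C))"
  let ?L = "{l. ?Y B (s + int l) C \<noteq> 0}"
  have AV: "A \<in> weighted_polys" using A weighted_polys_zero weighted_polys_monom by blast
  show ?thesis
  proof (cases "A = 0 \<or> 0 \<le> r \<or> 0 \<le> s")
    case True
    \<comment> \<open>Every term of a degenerate case vanishes. For \<open>0 \<le> s\<close> there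
      is none, for \<open>A = 0\<close> the outer product is 0, and for \<open>0 \<le> r\<close>
      either the outer mode \<open>r - int l\<close> is nonnegative or the binomial is 0.\<close>
    have t0: "?t l = 0" if l: "l \<in> ?L" for l
    proof (cases "A = 0")
      case True
      then show ?thesis
        by (simp only: nth_product_zero_left[OF weighted_polys_nth_product[OF B C]] polyt.scale_zero_right)
    next
      case False
      have "\<not> 0 \<le> s" using l nth_product_nonneg[of "s + int l" B C] by auto
      then have r: "0 \<le> r" using True False by simp
      show ?thesis
      proof (cases "int l \<le> r")
        case True
        then show ?thesis
          by (simp only: nth_product_nonneg[of "r - int l"] polyt.scale_zero_right diff_ge_0_iff_ge)
      next
        case False
        \<comment> \<open>The position of the factor [0] in the numerator of the binomial; it is
          below l because r is nonnegative.\<close>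
        let ?j = "nat (int l - r - 1)"
        have "?j < l" "int l - r - 1 - int ?j = 0"
          using False r by auto
        then have "(\<Prod>t<l. qint Q (int l - r - 1 - int t)) = 0"
          by (intro prod_zero bexI[of _ ?j]) (simp_all only: qint_0 finite_lessThan lessThan_iff)
        then show ?thesis by (simp add: qbinom_def)
      qed
    qed
    have "?Y (?Y A r B) s C = 0"
    proof (cases "0 \<le> s")
      case False
      then have "?Y A r B = 0"
        using True nth_product_nonneg nth_product_zero_left[OF B] by auto
      then show ?thesis by (simp only: nth_product_zero_left[OF C])
    qed (rule nth_product_nonneg)
    moreover have "(\<Sum>l\<in>?L. ?t l) = 0" by (rule sum.neutral) (rule ballI, rule t0)
    ultimately show ?thesis by (simp only:)
  next
    case False
    then obtain a k where a: "u = int k" "A = monom a k" "weighted k a"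
      using A by blast
    obtain p where p: "r = - int p - 1" using False negE by blast
    obtain m where m: "s = - int m - 1" using False negE by blast
    have t: "?t l = scale_t scale (qbinom Q (int (l + p)) l * Q ^ ((m - l) * (k + p)))
        (?Y (monom a k) (- int (p + l) - 1) (?Y B (- int (m - l) - 1) C))" if "l \<le> m" for l
    proof -
      have "int ((m - l) * (k + p)) = (int m - int l) * (int k + int p)"
        using that by (simp add: of_nat_diff)
      then have "(s + int l + 1) * (r - u + 1) = int ((m - l) * (k + p))"
        unfolding p m a by (simp only:) (simp add: algebra_simps)
      then have "Q powi ((s + int l + 1) * (r - u + 1)) = Q ^ ((m - l) * (k + p))"
        by (simp only: power_int_of_nat)
      moreover have "int l - r - 1 = int (l + p)" "r - int l = - int (p + l) - 1"
          "s + int l = - int (m - l) - 1"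
        using that by (simp_all add: p m of_nat_diff)
      ultimately show ?thesis unfolding a(2) by (simp only:)
    qed
    \<comment> \<open>Beyond \<open>m\<close> the inner mode is nonnegative; up to \<open>m\<close>
      the terms off the support vanish with the inner product.\<close>
    have "(\<Sum>l\<in>?L. ?t l) = (\<Sum>l\<le>m. ?t l)"
    proof (rule sum.mono_neutral_left)
      show "?L \<subseteq> {..m}"
      proof
        fix l assume "l \<in> ?L"
        then have "\<not> 0 \<le> s + int l" using nth_product_nonneg[of "s + int l" B C] by auto
        then show "l \<in> {..m}" by (simp add: m)
      qed
      show "\<forall>l\<in>{..m} - ?L. ?t l = 0"
        by (simp add: nth_product_zero_right[OF AV])
    qed simp
    also have "\<dots> = assoc_rhs k a p m B C"
      unfolding assoc_rhs_def by (rule sum.cong[OF refl]) (rule t, simp)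
    also have "\<dots> = ?Y (?Y A r B) s C"
      unfolding a(2) p m by (rule product_assoc[OF a(3) B C, symmetric])
    finally show ?thesis by simp
  qed
qed

text \<open>All identities are inherited from \<open>weighted_polys\<close>. What a subspace
  contributes is the vacuum, closure under products, and the splitting of its elements into
  homogeneous components, on which the grading rests.\<close>

lemma vertex_algebra_subspace:
  assumes V: "polyt.subspace V" "V \<subseteq> weighted_polys" "vacuum \<in> V"
    and homog: "\<And>A u. A \<in> V \<Longrightarrow> monom (coeff A u) u \<in> V"
    and closed: "\<And>A B s. A \<in> V \<Longrightarrow> B \<in> V \<Longrightarrow> nth_product scale Q A s B \<in> V"
  shows "q_vertex_algebra_in_fields scale Q V"
proof -
  have weighted_polys: "A \<in> weighted_polys" if "A \<in> V" for A using V(2) that by blast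
  have V0: "0 \<in> V" using V(1) by (rule polyt.subspace_0)
  have V_add: "A + B \<in> V" if "A \<in> V" "B \<in> V" for A B
    using V(1) that by (rule polyt.subspace_add)
  have V_scale: "scale_t scale c A \<in> V" if "A \<in> V" for A c
    using V(1) that by (rule polyt.subspace_scale)
  have weighted_coeff: "weighted k a" if "monom a k \<in> V" for a k
    using VVD[OF weighted_polys[OF that], of k] by simp
  have "graded_nonlocal_q_vertex_algebra (scale_t scale) Q V (weight_space V) (nth_product scale Q) vacuum"
  proof (unfold_locales)
    show "polyt.subspace V" by (rule V(1))
  next
    fix u
    show "polyt.subspace (weight_space V u)"
    proof (rule polyt.subspaceI)
      show "0 \<in> weight_space V u" by (rule weight_space_zero[OF V0])
    next
      fix A B assume AB: "A \<in> weight_space V u" "B \<in> weight_space V u"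
      show "A + B \<in> weight_space V u"
      proof (cases "A = 0 \<or> B = 0")
        case True
        then show ?thesis using AB by auto
      next
        case False
        then obtain a b k where "u = int k" "A = monom a k" "B = monom b k" "A \<in> V" "B \<in> V"
          using weight_spaceE[OF AB(1)] weight_spaceE[OF AB(2)] by auto
        then show ?thesis
          using V_add[of A B] weight_spaceI[of "a + b" k] by (simp only: add_monom)
      qed
    next
      fix c A assume A: "A \<in> weight_space V u"
      show "scale_t scale c A \<in> weight_space V u"
      proof (cases "A = 0")
        case True
        then show ?thesis using A by simp
      next
        case False
        then obtain a k where "u = int k" "A = monom a k" "A \<in> V"
          using weight_spaceE[OF A] by auto
        then show ?thesis
          using V_scale[of A c] weight_spaceI[of "dscale c a" k] by (simp only: scale_t_monom)
      qed
    qed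
  next
    fix u show "weight_space V u \<subseteq> V"
      using weight_spaceE V0 by blast
  next
    fix A assume "A \<in> V"
    then show "\<exists>!c. (\<forall>u. c u \<in> weight_space V u) \<and> finite {u. c u \<noteq> 0} \<and> A = (\<Sum>u | c u \<noteq> 0. c u)"
      by (intro weight_decomposition V0 homog)
  next
    show "vacuum \<in> V" by (rule V(3))
  next
    fix A B and r assume "A \<in> V" "B \<in> V"
    then show "nth_product scale Q A r B \<in> V" by (rule closed)
  next
    fix A A' B and r assume "A \<in> V" "A' \<in> V" "B \<in> V"
    then show "nth_product scale Q (A + A') r B = nth_product scale Q A r B + nth_product scale Q A' r B"
      by (intro nth_product_add_left weighted_polys)
  next
    fix A B c and r assume "A \<in> V" "B \<in> V"
    then show "nth_product scale Q (scale_t scale c A) r B = scale_t scale c (nth_product scale Q A r B)"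
      by (intro nth_product_scale_left weighted_polys)
  next
    fix A B B' and r assume "A \<in> V" "B \<in> V" "B' \<in> V"
    then show "nth_product scale Q A r (B + B') = nth_product scale Q A r B + nth_product scale Q A r B'"
      by (intro nth_product_add_right weighted_polys)
  next
    fix A B c and r assume "A \<in> V" "B \<in> V"
    then show "nth_product scale Q A r (scale_t scale c B) = scale_t scale c (nth_product scale Q A r B)"
      by (intro nth_product_scale_right weighted_polys)
  next
    fix A B
    show "\<exists>N. \<forall>r\<ge>N. nth_product scale Q A r B = 0"
      using nth_product_nonneg by blast
  next
    fix B and r assume "B \<in> V"
    then show "nth_product scale Q vacuum r B = (if r = -1 then B else 0)"
      by (intro vacuum_product weighted_polys)
  next
    fix A :: "'l distr poly" and r :: int assume "0 \<le> r"
    then show "nth_product scale Q A r vacuum = 0" by (rule nth_product_nonneg)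
  next
    fix A assume "A \<in> V"
    then show "nth_product scale Q A (-1) vacuum = A" by (intro product_vacuum weighted_polys)
  next
    fix A B u s r assume AB: "A \<in> weight_space V u" "B \<in> weight_space V s"
    show "nth_product scale Q A r B \<in> weight_space V (s + u - r - 1)"
    proof (cases "0 \<le> r \<or> A = 0 \<or> B = 0")
      case True
      have "A \<in> weighted_polys" "B \<in> weighted_polys" using AB weight_spaceE weighted_polys weighted_polys_zero by blast+
      then have "nth_product scale Q A r B = 0"
        using True nth_product_nonneg nth_product_zero_left nth_product_zero_right by blast
      then show ?thesis using weight_space_zero[OF V0] by simp
    next
      case False
      then obtain a b k l where *: "u = int k" "A = monom a k" "A \<in> V" "s = int l" "B = monom b l" "B \<in> V"
        using weight_spaceE[OF AB(1)] weight_spaceE[OF AB(2)] by blast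
      obtain t where t: "r = - int t - 1" using negE False by blast
      have "nth_product scale Q A r B = monom (mode_prod t a k b) (k + l + t)"
        unfolding * by (rule nth_product_monom_monom[OF _ _ t]) (use * weighted_coeff in auto)
      moreover have "nth_product scale Q A r B \<in> V" using * closed by blast
      moreover have "s + u - r - 1 = int (k + l + t)" using * t by simp
      ultimately show ?thesis using weight_spaceI[of "mode_prod t a k b" "k + l + t"] by simp
    qed
  next
    fix A B C u r s assume A: "A \<in> weight_space V u" and B: "B \<in> V" and C: "C \<in> V"
    have "A = 0 \<or> (\<exists>a k. u = int k \<and> A = monom a k \<and> weighted k a)"
      using weight_spaceE[OF A] weighted_coeff by blast
    then show "nth_product scale Q (nth_product scale Q A r B) s C =
        (\<Sum>l | nth_product scale Q B (s + int l) C \<noteq> 0.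
          scale_t scale (qbinom Q (int l - r - 1) l * Q powi ((s + int l + 1) * (r - u + 1)))
            (nth_product scale Q A (r - int l) (nth_product scale Q B (s + int l) C)))"
      by (rule product_assoc_weighted) (intro weighted_polys B C)+
  qed
  moreover have "V \<subseteq> fields_t scale"
  proof
    fix A assume "A \<in> V"
    then show "A \<in> fields_t scale"
      unfolding fields_t_def using weighted_fields[OF VVD[OF weighted_polys]] by blast
  qed
  moreover have "\<forall>A\<in>V. \<forall>B\<in>V. quasi_commutative scale Q [A, B]"
    using quasi_commutative_weighted_polys weighted_polys by blast
  ultimately show ?thesis
    by (simp add: q_vertex_algebra_in_fields_def)
qed

section \<open>The span of the words\<close>

inductive_set words :: "'l distr poly set" where
  vacuum: "vacuum \<in> words"
| product: "a \<in> gens \<Longrightarrow> r < 0 \<Longrightarrow> w \<in> words \<Longrightarrow> nth_product scale Q (monom a 0) r w \<in> words"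

lemma gens_weighted_polys: "a \<in> gens \<Longrightarrow> monom a 0 \<in> weighted_polys"
  by (intro weighted_polys_monom weighted.pure pure.base)

lemma words_homogeneous: "w \<in> words \<Longrightarrow> \<exists>a u. w = monom a u \<and> weighted u a"
proof (induction rule: words.induct)
  case vacuum
  show ?case using vacuum_eq weighted_one by blast
next
  case (product a r w)
  then obtain b u where b: "w = monom b u" "weighted u b" by blast
  have "\<not> 0 \<le> r" using product(2) by simp
  then obtain t where t: "r = - int t - 1" by (rule negE)
  have a: "weighted 0 a" by (intro weighted.pure pure.base product)
  have "weighted (0 + u + t) (mode_prod t a 0 b)"
    using weighted_mode_prod[OF a b(2), of t] by (simp add: ac_simps)
  with nth_product_monom_monom[OF a b(2) t] show ?case
    unfolding b(1) by blast
qed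

lemma words_weighted_polys: "words \<subseteq> weighted_polys"
  using words_homogeneous weighted_polys_monom by blast

lemma span_words_weighted_polys: "polyt.span words \<subseteq> weighted_polys"
  by (rule polyt.span_minimal[OF words_weighted_polys subspace_weighted_polys])

text \<open>Taking the component of weight \<open>u\<close> is linear and sends each word to itself
  or to 0.\<close>

lemma span_words_homogeneous:
  assumes "A \<in> polyt.span words"
  shows "monom (coeff A u) u \<in> polyt.span words"
  using assms
proof (induction rule: polyt.span_induct)
  case base
  show ?case
  proof (rule polyt.subspaceI)
    fix A B assume "A \<in> {A. monom (coeff A u) u \<in> polyt.span words}" "B \<in> {A. monom (coeff A u) u \<in> polyt.span words}"
    then show "A + B \<in> {A. monom (coeff A u) u \<in> polyt.span words}"
      using polyt.span_add by (simp only: mem_Collect_eq coeff_add add_monom[symmetric])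
  next
    fix c A assume "A \<in> {A. monom (coeff A u) u \<in> polyt.span words}"
    then show "scale_t scale c A \<in> {A. monom (coeff A u) u \<in> polyt.span words}"
      using polyt.span_scale by (simp only: mem_Collect_eq coeff_scale_t scale_t_monom[symmetric])
  qed (simp add: polyt.span_zero)
next
  case (step A)
  then obtain a w where a: "A = monom a w" using words_homogeneous by blast
  show ?case
  proof (cases "u = w")
    case True
    then show ?thesis using a step by (auto intro: polyt.span_base)
  next
    case False
    then have "coeff A u = 0" using a by simp
    then show ?thesis by (simp only: monom_eq_0 polyt.span_zero)
  qed
qed

lemma span_words_closed_gen:
  assumes "a \<in> gens" "B \<in> polyt.span words"
  shows "nth_product scale Q (monom a 0) r B \<in> polyt.span words"
proof -
  note a = gens_weighted_polys[OF assms(1)]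
  \<comment> \<open>Linearity of the product is available within \<open>weighted_polys\<close>,
    hence the intersection.\<close>
  have "polyt.span words \<subseteq> weighted_polys \<inter> {B. nth_product scale Q (monom a 0) r B \<in> polyt.span words}"
  proof (rule polyt.span_minimal)
    show "words \<subseteq> weighted_polys \<inter> {B. nth_product scale Q (monom a 0) r B \<in> polyt.span words}"
    proof (cases "0 \<le> r")
      case True
      then show ?thesis
        using words_weighted_polys polyt.span_zero by (auto simp: nth_product_nonneg)
    next
      case False
      then show ?thesis
        using words_weighted_polys words.product[OF assms(1)] polyt.span_base by (simp add: subset_iff)
    qed
  next
    show "polyt.subspace (weighted_polys \<inter> {B. nth_product scale Q (monom a 0) r B \<in> polyt.span words})"
      by (rule polyt.subspaceI)
         (auto simp: weighted_polys_zero weighted_polys_add weighted_polys_scale nth_product_zero_right[OF a] nth_product_add_right[OF a]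
          nth_product_scale_right[OF a] polyt.span_zero intro: polyt.span_add polyt.span_scale)
  qed
  then show ?thesis using assms(2) by blast
qed

text \<open>For a word starting with \<open>a\<close>, associativity leaves products of the shorter
  word with \<open>B\<close>, to which \<open>a\<close> is then applied with various modes. The
  induction keeps \<open>s\<close> and \<open>B\<close> arbitrary because the inner modes differ
  from \<open>s\<close>.\<close>

lemma span_words_closed_word:
  assumes "w \<in> words" "B \<in> polyt.span words"
  shows "nth_product scale Q w s B \<in> polyt.span words"
  using assms
proof (induction arbitrary: B s rule: words.induct)
  case vacuum
  then have "B \<in> weighted_polys" using span_words_weighted_polys by blast
  then show ?case using vacuum polyt.span_zero by (simp add: vacuum_product)
next
  case (product a r w)
  show ?case
  proof (cases "0 \<le> s")
    case True
    then show ?thesis by (simp add: nth_product_nonneg polyt.span_zero)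
  next
    case False
    have "\<not> 0 \<le> r" using product(2) by simp
    then obtain p where p: "r = - int p - 1" by (rule negE)
    obtain m where m: "s = - int m - 1" using negE False by blast
    have a: "weighted 0 a" by (intro weighted.pure pure.base product)
    have "w \<in> weighted_polys" "B \<in> weighted_polys" using words_weighted_polys span_words_weighted_polys product by blast+
    then have "nth_product scale Q (nth_product scale Q (monom a 0) r w) s B = assoc_rhs 0 a p m w B"
      unfolding p m by (rule product_assoc[OF a])
    also have "\<dots> \<in> polyt.span words"
      unfolding assoc_rhs_def
      by (intro polyt.span_sum polyt.span_scale span_words_closed_gen product)
    finally show ?thesis .
  qed
qed

lemma span_words_closed:
  assumes "A \<in> polyt.span words" "B \<in> polyt.span words"
  shows "nth_product scale Q A s B \<in> polyt.span words"
proof -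
  have B: "B \<in> weighted_polys" using assms(2) span_words_weighted_polys by blast
  have "polyt.span words \<subseteq> weighted_polys \<inter> {A. nth_product scale Q A s B \<in> polyt.span words}"
  proof (rule polyt.span_minimal)
    show "words \<subseteq> weighted_polys \<inter> {A. nth_product scale Q A s B \<in> polyt.span words}"
      using words_weighted_polys span_words_closed_word[OF _ assms(2)] by blast
    show "polyt.subspace (weighted_polys \<inter> {A. nth_product scale Q A s B \<in> polyt.span words})"
      by (rule polyt.subspaceI)
         (auto simp: weighted_polys_zero weighted_polys_add weighted_polys_scale nth_product_zero_left[OF B] nth_product_add_left[OF _ _ B]
          nth_product_scale_left[OF _ B] polyt.span_zero intro: polyt.span_add polyt.span_scale)
  qed
  then show ?thesis using assms(1) by blast
qed

text \<open>A generator is recovered as its own product of mode -1 with the vacuum. A competitor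
  contains every word because it contains the vacuum and the generators and is closed under
  products.\<close>

theorem span_words_smallest:
  "smallest_q_vertex_algebra scale Q ((\<lambda>a. monom a 0) ` gens) (polyt.span words)"
  unfolding smallest_q_vertex_algebra_def
proof (intro conjI allI impI)
  show "q_vertex_algebra_in_fields scale Q (polyt.span words)"
    by (rule vertex_algebra_subspace)
       (auto intro: polyt.subspace_span span_words_weighted_polys[THEN subsetD] polyt.span_base words.vacuum
        span_words_homogeneous span_words_closed)
  show "(\<lambda>a. monom a 0) ` gens \<subseteq> polyt.span words"
  proof clarify
    fix a assume a: "a \<in> gens"
    have "nth_product scale Q (monom a 0) (-1) vacuum \<in> words"
      by (intro words.intros a) simp
    then show "monom a 0 \<in> polyt.span words"
      using product_vacuum[OF gens_weighted_polys[OF a]] by (simp add: polyt.span_base)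
  qed
next
  fix V assume V: "q_vertex_algebra_in_fields scale Q V \<and> (\<lambda>a. monom a 0) ` gens \<subseteq> V"
  then interpret V: graded_nonlocal_q_vertex_algebra "scale_t scale" Q V "weight_space V"
    "nth_product scale Q" vacuum
    by (simp add: q_vertex_algebra_in_fields_def)
  have "w \<in> V" if "w \<in> words" for w
    using that
  proof (induction rule: words.induct)
    case (product a r w)
    then show ?case using V by (intro V.Y_closed) auto
  qed (rule V.vac_closed)
  then show "polyt.span words \<subseteq> V"
    by (intro polyt.span_minimal V.subspace_V) blast
qed

text \<open>Bridges the inductive description and the lists of pairs used in the final statement,
  where generators are named by indices.\<close>

lemma words_eq:
  assumes "gens = x ` I"
  shows "words = {foldr (\<lambda>(i, r). nth_product scale Q (monom (x i) 0) r) irs vacuum | irs.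
    \<forall>(i, r)\<in>set irs. i \<in> I \<and> r < 0}" (is "_ = ?R")
proof
  show "words \<subseteq> ?R"
  proof
    fix w assume "w \<in> words"
    then show "w \<in> ?R"
    proof (induction rule: words.induct)
      case vacuum
      show ?case by (rule CollectI, rule exI[of _ "[]"]) simp
    next
      case (product a r w)
      then obtain irs i where "w = foldr (\<lambda>(i, r). nth_product scale Q (monom (x i) 0) r) irs vacuum"
          "\<forall>(i, r)\<in>set irs. i \<in> I \<and> r < 0" "a = x i" "i \<in> I"
        using assms by blast
      then show ?case using product(2) by (intro CollectI exI[of _ "(i, r) # irs"]) simp
    qed
  qed
  have "foldr (\<lambda>(i, r). nth_product scale Q (monom (x i) 0) r) irs vacuum \<in> words"
    if "\<forall>(i, r)\<in>set irs. i \<in> I \<and> r < 0" for irs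
    using that
  proof (induction irs)
    case (Cons ir irs)
    then have "x (fst ir) \<in> gens" "snd ir < 0" by (auto simp: assms case_prod_unfold)
    from words.product[OF this] Cons show ?case by (simp add: case_prod_unfold)
  qed (simp add: words.vacuum)
  then show "?R \<subseteq> words" by blast
qed

end

section \<open>The fields of the quantum affine algebra\<close>

text \<open>Powers of the indeterminate are distinct monomials; this is what shows that q is not a
  root of unity.\<close>

lemma qhalf_power: "qhalf ^ k = Fract (monom 1 k) 1"
proof (induction k)
  case 0
  show ?case by (simp add: One_fract_def monom_0 one_pCons)
next
  case (Suc k)
  have *: "[:0, 1:] * monom (1 :: complex) k = monom 1 (Suc k)"
    by (simp add: monom_Suc)
  have "qhalf ^ Suc k = Fract [:0, 1:] 1 * Fract (monom 1 k) 1"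
    by (simp only: power_Suc Suc.IH) (simp only: qhalf_def)
  also have "\<dots> = Fract (monom 1 (Suc k)) 1"
    by (simp only: mult_fract * mult_1)
  finally show ?case .
qed

lemma qhalf_power_inj: "qhalf ^ k = qhalf ^ l \<Longrightarrow> k = l"
  by (auto simp: qhalf_power eq_fract monom_eq_iff')

lemma qhalf_nonzero: "qhalf \<noteq> 0"
  by (simp add: qhalf_def Zero_fract_def eq_fract)

lemma qpar_nonzero: "qpar \<noteq> 0"
  by (simp add: qpar_def qhalf_nonzero)

lemma qpar_power: "qpar ^ k = qhalf ^ (2 * k)"
  by (simp add: qpar_def power_mult)

lemma qpar_powi_eq_1: "qpar powi k = 1 \<Longrightarrow> k = 0"
proof (cases "0 \<le> k")
  case True
  assume "qpar powi k = 1"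
  then have "qhalf ^ (2 * nat k) = qhalf ^ 0"
    using True by (simp add: power_int_def qpar_power)
  then show ?thesis using True qhalf_power_inj by fastforce
next
  case False
  assume "qpar powi k = 1"
  then have "qhalf ^ (2 * nat (- k)) = qhalf ^ 0"
    using False by (simp add: power_int_def qpar_power inverse_eq_divide power_one_over)
  then show ?thesis using False qhalf_power_inj by fastforce
qed

text \<open>The entry -2 occurs only for the affine diagram with a double bond. There n = 1, so it
  never concerns two distinct indices in \<open>{1..n}\<close>.\<close>

lemma finite_type_cartan_entry:
  assumes "is_affine_ADE_cartan_matrix n C" "i \<in> {1..n}" "j \<in> {1..n}"
  shows "i = j \<and> C i j = 2 \<or> i \<noteq> j \<and> C i j \<in> {0, -1}"
proof -
  obtain X \<sigma> where X: "ade_rank X = n" and \<sigma>: "\<sigma> permutes {1..n}"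
    and C: "\<And>i j. i \<le> n \<Longrightarrow> j \<le> n \<Longrightarrow> C i j = affine_cartan X (\<sigma> i) (\<sigma> j)"
    using assms(1) unfolding is_affine_ADE_cartan_matrix_def by blast
  have eq: "\<sigma> i = \<sigma> j \<longleftrightarrow> i = j"
    using permutes_inj[OF \<sigma>] by (rule inj_eq)
  have "X \<noteq> Type_A 1" if "i \<noteq> j"
  proof
    assume "X = Type_A 1"
    then have "n = 1" using X by simp
    then show False using assms(2,3) that by simp
  qed
  moreover have "C i j = affine_cartan X (\<sigma> i) (\<sigma> j)"
    using C assms(2,3) by simp
  ultimately show ?thesis
    by (simp add: affine_cartan_def eq)
qed

lemma (in quantum_affine_module) generators_local:
  assumes C: "is_affine_ADE_cartan_matrix n C" and ij: "i \<in> {1..n}" "j \<in> {1..n}"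
    and Q: "q_calculus scale Q" "Q = qpar ^ 2"
  shows "q_calculus.local_from scale Q 0 (field_of_modes (xp i)) (field_of_modes (xp j))"
proof -
  interpret q_calculus scale Q by (rule Q(1))
  show ?thesis
  proof (cases "C i j = 0")
    case True
    then have "i \<noteq> j" using finite_type_cartan_entry[OF C ij] by auto
    have q1: "qpar - inverse qpar \<noteq> 0"
    proof
      assume "qpar - inverse qpar = 0"
      then have "qpar = inverse qpar" by simp
      then have "qpar * qpar = qpar * inverse qpar" by (rule arg_cong)
      also have "\<dots> = 1" using qpar_nonzero by (rule right_inverse)
      finally have "qpar powi int 2 = 1" by (simp only: power_int_of_nat power2_eq_square)
      then show False using qpar_powi_eq_1[of "int 2"] by simp
    qed
    have "xp i k (xp j l v) = xp j l (xp i k v)" for k l v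
    proof -
      \<comment> \<open>For \<open>m = 1\<close> the symmetrisation has a single term, and once both
        binomials are seen to be 1 the relation reads x_j x_i - x_i x_j = 0.\<close>
      have perms: "{\<sigma>. \<sigma> permutes {1..1 :: nat}} = {id}"
        by simp
      have "sqbinom 1 0 = 1" "sqbinom 1 1 = 1"
        using q1 by (simp_all add: sqbinom_def sqint_def)
      then show ?thesis
        using serre[where x = xp and i = i and j = j and m = 1 and k = l and l = "\<lambda>_. k" and v = v] ij \<open>i \<noteq> j\<close> True unfolding perms
        by (simp add: upt_conv_Cons)
    qed
    then have "local_via 1 1 (field_of_modes (xp i)) (field_of_modes (xp j))"
      by (simp add: local_via_def prod2_def field_of_modes_def fun_eq_iff)
    then show ?thesis
      unfolding local_from_def using nonvanishing_from_one by blast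
  next
    case False
    let ?c = "qpar powi C i j"
    \<comment> \<open>The root is q to the power -a_ij, that is q^-2 or q. Neither is an even
      nonnegative power of q.\<close>
    have "poly [:1, - ?c:] (Q ^ m) \<noteq> 0" for m
    proof
      assume "poly [:1, - ?c:] (Q ^ m) = 0"
      moreover have "Q ^ m * ?c = qpar powi (C i j + 2 * int m)"
        using qpar_nonzero
        by (simp add: Q(2) power_int_add power_int_mult flip: power_mult)
      ultimately have "qpar powi (C i j + 2 * int m) = 1" by simp
      then have "C i j + 2 * int m = 0" by (rule qpar_powi_eq_1)
      then show False
        using finite_type_cartan_entry[OF C ij] False by auto presburger
    qed
    then have "nonvanishing_from 0 [:1, - ?c:]" by (simp add: nonvanishing_from_def)
    moreover have "local_via [:1, - ?c:] [:?c, - 1:] (field_of_modes (xp i)) (field_of_modes (xp j))"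
      unfolding local_via_def
    proof (intro allI ext)
      fix v and x :: "int \<times> int"
      obtain k l where x: "x = (k, l)" by (cases x)
      have e: "- k - 2 + 1 = - k - 1" "- l - 1 + 1 = - l" "- (k + 1) - 1 = - k - 2" "- (l - 1) - 1 = - l"
        by simp_all
      \<comment> \<open>The coefficient of z^k is the mode -k-1, so the defining relation is taken
        at the modes -k-2 and -l-1.\<close>
      have "xp i (- k - 1) (xp j (- l - 1) v) - scale ?c (xp j (- l - 1) (xp i (- k - 1) v)) =
          scale ?c (xp i (- k - 2) (xp j (- l) v)) - xp j (- l) (xp i (- k - 2) v)"
        using x_x[of 1 xp i j "- k - 2" "- l - 1" v] ij unfolding e mult_1 by blast
      \<comment> \<open>Collecting the terms with \<open>xp i\<close> on the left gives the factor 1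
        - c x, those with \<open>xp j\<close> on the left give c - x.\<close>
      then have "xp i (- k - 1) (xp j (- l - 1) v) - scale ?c (xp i (- k - 2) (xp j (- l) v)) =
          scale ?c (xp j (- l - 1) (xp i (- k - 1) v)) - xp j (- l) (xp i (- k - 2) v)"
        by (simp only: diff_eq_eq) (simp only: add_diff_eq diff_add_eq add.commute add.left_commute)
      then show "poly_act [:1, - ?c:] shift (prod2 (field_of_modes (xp i)) (field_of_modes (xp j)) v) x =
          poly_act [:?c, - 1:] shift (\<lambda>(k, l). field_of_modes (xp j) l (field_of_modes (xp i) k v)) x"
        by (simp only: poly_act_pCons poly_act_0 prod2_def field_of_modes_def shift_def x case_prod_conv e
            scale_one scale_minus_left add_0_right diff_conv_add_uminus[symmetric])
    qed
    ultimately show ?thesis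
      unfolding local_from_def by blast
  qed
qed

theorem theorem2p16:
  fixes n :: nat
    and C :: "nat \<Rightarrow> nat \<Rightarrow> int"
    and scale :: "qfield \<Rightarrow> 'l::ab_group_add \<Rightarrow> 'l"
    and xp xm a :: "nat \<Rightarrow> int \<Rightarrow> 'l \<Rightarrow> 'l"
    and K Kinv :: "nat \<Rightarrow> 'l \<Rightarrow> 'l"
    and g ginv d dinv :: "'l \<Rightarrow> 'l"
    and Q :: qfield
    and X :: "nat \<Rightarrow> 'l distr poly"
    and S :: "'l distr poly set"
  assumes "is_affine_ADE_cartan_matrix n C"
    and "quantum_affine_module n C scale xp xm a K Kinv g ginv d dinv"
    and "restricted_module n xp xm"
    and "Q = qpar ^ 2"
    and "\<And>i. X i = monom (field_of_modes (xp i)) 0"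
    and "S = X ` {1..n}"
  shows "(\<exists>!V. smallest_q_vertex_algebra scale Q S V) \<and>
    (\<forall>V. smallest_q_vertex_algebra scale Q S V \<longrightarrow>
      V = module.span (scale_t scale)
            {foldr (\<lambda>(i, r). nth_product scale Q (X i) r) irs vacuum | irs.
               \<forall>(i, r)\<in>set irs. i \<in> {1..n} \<and> r < 0})"
proof -
  interpret M: quantum_affine_module n C scale xp xm a K Kinv g ginv d dinv
    by (rule assms(2))
  have Q_power: "Q ^ k \<noteq> 1" if "0 < k" for k
  proof
    assume "Q ^ k = 1"
    then have "qpar powi (int (2 * k)) = 1"
      unfolding power_int_of_nat by (simp add: assms(4) power_mult)
    then show False using qpar_powi_eq_1 that by force
  qed
  interpret q_calculus scale Q
    by unfold_locales (use Q_power qpar_nonzero in \<open>auto simp: assms(4)\<close>)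
  define x where "x i = field_of_modes (xp i)" for i
  have x_fields: "x i \<in> fields scale" if "i \<in> {1..n}" for i
  proof (rule fldsI)
    fix k show "lin (x i k)"
      using M.linear_generators(1)[OF that] by (simp add: x_def field_of_modes_def)
  next
    fix v
    have "\<exists>N. \<forall>r\<ge>N. xp i r v = 0 \<and> xm i r v = 0"
      by (rule assms(3)[unfolded restricted_module_def, THEN spec, THEN bspec, OF that])
    then obtain N where N: "\<And>r. N \<le> r \<Longrightarrow> xp i r v = 0"
      by blast
    \<comment> \<open>The mode -k-1 is at least N exactly when k < -N.\<close>
    have "x i k v = 0" if "k < - N" for k
      unfolding x_def field_of_modes_def by (rule N) (use that in linarith)
    then show "\<exists>N. \<forall>k<N. x i k v = 0" by blast
  qed
  \<comment> \<open>From here on the quantum affine algebra enters only through these two facts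
    about the generating fields.\<close>
  interpret local_fields scale Q "x ` {1..n}"
  proof unfold_locales
    show "x ` {1..n} \<subseteq> fields scale" using x_fields by blast
    show "local_from 0 b c" if "b \<in> x ` {1..n}" "c \<in> x ` {1..n}" for b c
      using that M.generators_local[OF assms(1) _ _ q_calculus_axioms assms(4)]
      by (auto simp: x_def)
  qed
  have X: "X = (\<lambda>i. monom (x i) 0)" by (simp add: fun_eq_iff assms(5) x_def)
  have S: "S = (\<lambda>a. monom a 0) ` x ` {1..n}" by (simp add: assms(6) X image_image)
  have smallest: "smallest_q_vertex_algebra scale Q S (polyt.span words)"
    unfolding S by (rule span_words_smallest)
  moreover have unique: "V = polyt.span words" if "smallest_q_vertex_algebra scale Q S V" for V
    using that smallest unfolding smallest_q_vertex_algebra_def by blast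
  ultimately have "\<exists>!V. smallest_q_vertex_algebra scale Q S V" by blast
  moreover have "polyt.span words = module.span (scale_t scale)
            {foldr (\<lambda>(i, r). nth_product scale Q (X i) r) irs vacuum | irs.
               \<forall>(i, r)\<in>set irs. i \<in> {1..n} \<and> r < 0}"
    unfolding X words_eq[OF refl] ..
  ultimately show ?thesis using unique by metis
qed

end
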